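(* Suppose that $\Delta$ is a countable discrete group, $Y$ is a standard Borel space, and $\Delta \curvearrowright Y$ is a projectively rigid Borel action. Then the orbit equivalence relation $F = E_\Delta^Y$ induced by the action is projectively separable.
   Context: The orbit equivalence relation $E_\Delta^Y$ relates $y, y' \in Y$ if and only if $\delta \cdot y = y'$ for some $\delta \in \Delta$. An equivalence relation is countable (finite) if all of its classes are countable (finite). For a set $B$, $E \upharpoonright B = E \cap (B \times B)$. A Borel equivalence relation on a standard Borel space is hyperfinite if it is the union of an increasing sequence $(E_n)_{n \in \mathbb{N}}$ of finite Borel equivalence relations on that space. For a Borel measure $\mu$ on $X$, a Borel equivalence relation $E$ on $X$ is $\mu$-nowhere hyperfinite if there is no $\mu$-positive Borel set $B \subseteq X$ for which $E \upharpoonright B$ is hyperfinite. A function is countable-to-one if preimages of points are countable. A homomorphism from $E$ to $F$ is a function sending $E$-equivalent points to $F$-equivalent points. The difference set of functions $\phi \colon A \to Y$ and $\psi \colon B \to Y$, with $A, B \subseteq X$, is $D(\phi, \psi) = \{x \in A \cap B \mid \phi(x) \neq \psi(x)\} \cup (A \mathbin{\triangle} B)$. Given $R \subseteq X \times X$, an action $\Delta \curvearrowright Y$, and $\rho \colon R \to \Delta$, a function $\phi \colon X \to Y$ is $\rho$-invariant if $x_1 \mathrel{R} x_2 \implies \phi(x_1) = \rho(x_1, x_2) \cdot \phi(x_2)$ for all $x_1, x_2 \in X$. A Borel action $\Delta \curvearrowright Y$ is projectively rigid if whenever $X$ is a standard Borel space, $E$ is a countable Borel equivalence relation on $X$, $\rho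 \colon E \to \Delta$ is a Borel function, and $\phi, \psi \colon X \to Y$ are countable-to-one $\rho$-invariant Borel functions, the relation $E \upharpoonright D(\phi, \psi)$ is hyperfinite. For standard Borel spaces $X, Y$ and a finite Borel measure $\mu$ on $X$, $L(X, \mu, Y)$ denotes the set of Borel functions $\phi \colon B \to Y$, where $B$ ranges over Borel subsets of $X$, equipped with the pseudo-metric $d_\mu(\phi, \psi) = \mu(D(\phi, \psi))$. For countable Borel equivalence relations $E$ on $X$ and $F$ on $Y$, $\mathrm{Hom}(E, \mu, F)$ denotes the subspace of $L(X, \mu, Y)$ consisting of all countable-to-one $\phi \colon B \to Y$ in $L(X,\mu,Y)$ which are homomorphisms from $E \upharpoonright B$ to $F$. A countable Borel equivalence relation $F$ on $Y$ is projectively separable if whenever $X$ is a standard Borel space, $E$ is a countable Borel equivalence relation on $X$, and $\mu$ is a Borel probability measure on $X$ with respect to which $E$ is $\mu$-nowhere hyperfinite, the space $\mathrm{Hom}(E, \mu, F)$ is separable. *)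

theory Defs
  imports "HOL-Probability.Probability_Measure" "HOL-Algebra.Group_Action"
begin

text \<open>A standard Borel space is given by the points and the \<open>\<sigma>\<close>-algebra of a value of type
  \<^typ>\<open>'a measure\<close>; the measure component plays a role only where a measure \<open>\<mu>\<close> is mentioned,
  and then the underlying Borel space is that of \<open>\<mu>\<close> itself.\<close>

definition standard_borel :: "'a measure \<Rightarrow> bool" where
  "standard_borel M \<longleftrightarrow>
     (\<exists>T. completely_metrizable_space T \<and> separable_space T \<and> topspace T = space M \<and>
          sets M = sigma_sets (space M) {U. openin T U})"

definition borel_equiv :: "'a measure \<Rightarrow> 'a rel \<Rightarrow> bool" where
  "borel_equiv M E \<longleftrightarrow> equiv (space M) E \<and> E \<in> sets (M \<Otimes>\<^sub>M M)"

definition countable_borel_equiv :: "'a measure \<Rightarrow> 'a rel \<Rightarrow> bool" where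
  "countable_borel_equiv M E \<longleftrightarrow> borel_equiv M E \<and> (\<forall>x\<in>space M. countable (E `` {x}))"

definition finite_borel_equiv :: "'a measure \<Rightarrow> 'a rel \<Rightarrow> bool" where
  "finite_borel_equiv M E \<longleftrightarrow> borel_equiv M E \<and> (\<forall>x\<in>space M. finite (E `` {x}))"

definition hyperfinite :: "'a measure \<Rightarrow> 'a rel \<Rightarrow> bool" where
  "hyperfinite M E \<longleftrightarrow> borel_equiv M E \<and>
     (\<exists>S :: nat \<Rightarrow> 'a rel. (\<forall>n. finite_borel_equiv M (S n)) \<and> incseq S \<and> E = (\<Union>n. S n))"

definition rel_restrict :: "'a rel \<Rightarrow> 'a set \<Rightarrow> 'a rel" where
  "rel_restrict E B = E \<inter> (B \<times> B)"

definition nowhere_hyperfinite :: "'a measure \<Rightarrow> 'a rel \<Rightarrow> bool" where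
  "nowhere_hyperfinite \<mu> E \<longleftrightarrow>
     \<not> (\<exists>B\<in>sets \<mu>. emeasure \<mu> B > 0 \<and> hyperfinite (restrict_space \<mu> B) (rel_restrict E B))"

definition countable_to_one :: "'a set \<Rightarrow> ('a \<Rightarrow> 'b) \<Rightarrow> bool" where
  "countable_to_one A \<phi> \<longleftrightarrow> (\<forall>y. countable {x\<in>A. \<phi> x = y})"

definition rel_homomorphism :: "'a rel \<Rightarrow> 'b rel \<Rightarrow> ('a \<Rightarrow> 'b) \<Rightarrow> bool" where
  "rel_homomorphism E F \<phi> \<longleftrightarrow> (\<forall>x1 x2. (x1, x2) \<in> E \<longrightarrow> (\<phi> x1, \<phi> x2) \<in> F)"

text \<open>A function \<open>\<phi>: A \<rightarrow> Y\<close> with \<open>A \<subseteq> X\<close> is represented by the pair \<open>(A, \<phi>)\<close>.\<close>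

definition difference_set :: "'a set \<times> ('a \<Rightarrow> 'b) \<Rightarrow> 'a set \<times> ('a \<Rightarrow> 'b) \<Rightarrow> 'a set" where
  "difference_set = (\<lambda>(A, \<phi>) (B, \<psi>). {x \<in> A \<inter> B. \<phi> x \<noteq> \<psi> x} \<union> ((A - B) \<union> (B - A)))"

text \<open>In \<open>group_action G (space Y) act\<close> the maps \<open>act g\<close> are permutations of \<open>space Y\<close>. The
  acting group is discrete, hence \<^const>\<open>count_space\<close>.\<close>

definition borel_action ::
    "('d, 'm) monoid_scheme \<Rightarrow> 'y measure \<Rightarrow> ('d \<Rightarrow> 'y \<Rightarrow> 'y) \<Rightarrow> bool" where
  "borel_action G Y act \<longleftrightarrow> group_action G (space Y) act \<and>
     (\<lambda>(g, y). act g y) \<in> measurable (count_space (carrier G) \<Otimes>\<^sub>M Y) Y"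

definition orbit_equiv ::
    "('d, 'm) monoid_scheme \<Rightarrow> 'y measure \<Rightarrow> ('d \<Rightarrow> 'y \<Rightarrow> 'y) \<Rightarrow> 'y rel" where
  "orbit_equiv G Y act = {(y, y'). y \<in> space Y \<and> y' \<in> space Y \<and> (\<exists>g\<in>carrier G. act g y = y')}"

definition rho_invariant ::
    "'x rel \<Rightarrow> ('d \<Rightarrow> 'y \<Rightarrow> 'y) \<Rightarrow> ('x \<times> 'x \<Rightarrow> 'd) \<Rightarrow> ('x \<Rightarrow> 'y) \<Rightarrow> bool" where
  "rho_invariant R act \<rho> \<phi> \<longleftrightarrow> (\<forall>x1 x2. (x1, x2) \<in> R \<longrightarrow> \<phi> x1 = act (\<rho> (x1, x2)) (\<phi> x2))"

text \<open>The next notion and projective separability below quantify over all standard Borel spaces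
  \<open>X\<close>. A type argument names the type from which the points of \<open>X\<close> are taken. The type
  \<^typ>\<open>real\<close> already covers every standard Borel space up to Borel isomorphism: a standard
  Borel space has at most continuum many points, so transporting its structure along an injection
  into the reals gives an isomorphic copy whose points are reals (its \<open>\<sigma>\<close>-algebra need not be
  inherited from the reals).\<close>

definition projectively_rigid ::
    "'x itself \<Rightarrow> ('d, 'm) monoid_scheme \<Rightarrow> 'y measure \<Rightarrow> ('d \<Rightarrow> 'y \<Rightarrow> 'y) \<Rightarrow> bool" where
  "projectively_rigid (ty :: 'x itself) G Y act \<longleftrightarrow> borel_action G Y act \<and>
     (\<forall>(X :: 'x measure) E \<rho> \<phi> \<psi>.
        standard_borel X \<longrightarrow>
        countable_borel_equiv X E \<longrightarrow>
        \<rho> \<in> measurable (restrict_space (X \<Otimes>\<^sub>M X) E) (count_space (carrier G)) \<longrightarrow>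
        \<phi> \<in> measurable X Y \<longrightarrow> countable_to_one (space X) \<phi> \<longrightarrow> rho_invariant E act \<rho> \<phi> \<longrightarrow>
        \<psi> \<in> measurable X Y \<longrightarrow> countable_to_one (space X) \<psi> \<longrightarrow> rho_invariant E act \<rho> \<psi> \<longrightarrow>
        (let D = difference_set (space X, \<phi>) (space X, \<psi>)
         in hyperfinite (restrict_space X D) (rel_restrict E D)))"

text \<open>\<open>L(X, \<mu>, Y)\<close>. Extensionality makes the pair \<open>(B, \<phi>)\<close> a unique representation of a
  function with domain \<open>B\<close>.\<close>

definition L_space :: "'x measure \<Rightarrow> 'y measure \<Rightarrow> ('x set \<times> ('x \<Rightarrow> 'y)) set" where
  "L_space \<mu> Y =
     {(B, \<phi>). B \<in> sets \<mu> \<and> \<phi> \<in> extensional B \<and> \<phi> \<in> measurable (restrict_space \<mu> B) Y}"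

definition L_dist ::
    "'x measure \<Rightarrow> 'x set \<times> ('x \<Rightarrow> 'y) \<Rightarrow> 'x set \<times> ('x \<Rightarrow> 'y) \<Rightarrow> real" where
  "L_dist \<mu> f g = measure \<mu> (difference_set f g)"

definition Hom_space ::
    "'x rel \<Rightarrow> 'x measure \<Rightarrow> 'y rel \<Rightarrow> 'y measure \<Rightarrow> ('x set \<times> ('x \<Rightarrow> 'y)) set" where
  "Hom_space E \<mu> F Y =
     {(B, \<phi>). (B, \<phi>) \<in> L_space \<mu> Y \<and> countable_to_one B \<phi> \<and>
              rel_homomorphism (rel_restrict E B) F \<phi>}"

definition pseudometric_topology :: "'a set \<Rightarrow> ('a \<Rightarrow> 'a \<Rightarrow> real) \<Rightarrow> 'a topology" where
  "pseudometric_topology S d =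
     topology (\<lambda>U. U \<subseteq> S \<and> (\<forall>x\<in>U. \<exists>r>0. {y\<in>S. d x y < r} \<subseteq> U))"

lemma openin_pseudometric_topology:
  "openin (pseudometric_topology S d) U \<longleftrightarrow>
     U \<subseteq> S \<and> (\<forall>x\<in>U. \<exists>r>0. {y\<in>S. d x y < r} \<subseteq> U)"
proof -
  have "istopology (\<lambda>U. U \<subseteq> S \<and> (\<forall>x\<in>U. \<exists>r>0. {y\<in>S. d x y < r} \<subseteq> U))"
    unfolding istopology_def
  proof (intro conjI allI impI)
    fix U V
    assume U: "U \<subseteq> S \<and> (\<forall>x\<in>U. \<exists>r>0. {y\<in>S. d x y < r} \<subseteq> U)"
      and V: "V \<subseteq> S \<and> (\<forall>x\<in>V. \<exists>r>0. {y\<in>S. d x y < r} \<subseteq> V)"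
    show "U \<inter> V \<subseteq> S" using U by blast
    show "\<forall>x\<in>U \<inter> V. \<exists>r>0. {y\<in>S. d x y < r} \<subseteq> U \<inter> V"
    proof
      fix x assume x: "x \<in> U \<inter> V"
      obtain r where r: "r > 0" "{y\<in>S. d x y < r} \<subseteq> U" using U x by blast
      obtain s where s: "s > 0" "{y\<in>S. d x y < s} \<subseteq> V" using V x by blast
      show "\<exists>r>0. {y\<in>S. d x y < r} \<subseteq> U \<inter> V"
        using r s by (intro exI[of _ "min r s"]) auto
    qed
  next
    fix \<K>
    assume K: "\<forall>K\<in>\<K>. K \<subseteq> S \<and> (\<forall>x\<in>K. \<exists>r>0. {y\<in>S. d x y < r} \<subseteq> K)"
    then show "\<Union>\<K> \<subseteq> S" by blast
    show "\<forall>x\<in>\<Union>\<K>. \<exists>r>0. {y\<in>S. d x y < r} \<subseteq> \<Union>\<K>"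
    proof
      fix x assume "x \<in> \<Union>\<K>"
      then obtain K where "K \<in> \<K>" "x \<in> K" by blast
      with K obtain r where "r > 0" "{y\<in>S. d x y < r} \<subseteq> K" by blast
      with \<open>K \<in> \<K>\<close> show "\<exists>r>0. {y\<in>S. d x y < r} \<subseteq> \<Union>\<K>" by blast
    qed
  qed
  then show ?thesis
    by (simp add: pseudometric_topology_def)
qed

lemma topspace_pseudometric_topology: "topspace (pseudometric_topology S d) = S"
proof
  show "topspace (pseudometric_topology S d) \<subseteq> S"
    using openin_topspace[of "pseudometric_topology S d"]
    by (simp only: openin_pseudometric_topology)
  have "\<exists>r>0. {y\<in>S. d x y < r} \<subseteq> S" for x
    by (rule exI[of _ 1]) simp
  then have "openin (pseudometric_topology S d) S"
    by (simp add: openin_pseudometric_topology)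
  then show "S \<subseteq> topspace (pseudometric_topology S d)"
    by (rule openin_subset)
qed

definition projectively_separable :: "'x itself \<Rightarrow> 'y measure \<Rightarrow> 'y rel \<Rightarrow> bool" where
  "projectively_separable (ty :: 'x itself) Y F \<longleftrightarrow> countable_borel_equiv Y F \<and>
     (\<forall>(\<mu> :: 'x measure) E.
        standard_borel \<mu> \<longrightarrow> prob_space \<mu> \<longrightarrow> countable_borel_equiv \<mu> E \<longrightarrow>
        nowhere_hyperfinite \<mu> E \<longrightarrow>
        separable_space (pseudometric_topology (Hom_space E \<mu> F Y) (L_dist \<mu>)))"

end

theory Submission
  imports Defs "HOL-Probability.Discrete_Topology"
begin

text \<open>If the space of homomorphisms is not separable, then it contains an uncountable
  \<open>\<epsilon>\<close>-separated family. Outside a null set, \<open>E\<close> is covered by the graphs of countably many Borel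
  functions \<open>f\<^sub>n\<close> (an almost everywhere version of the Lusin-Novikov theorem), so a homomorphism \<open>\<phi>\<close>
  is described by the countably many functions sending \<open>x\<close> to the first group element carrying
  \<open>\<phi> (f\<^sub>n x)\<close> to \<open>\<phi> x\<close>. Measurable functions into a countable set form a separable space, so the family
  contains some \<open>\<phi>\<close> and \<open>\<psi>\<^sub>k \<noteq> \<phi>\<close> whose descriptions converge to that of \<open>\<phi>\<close>. On the set \<open>D\<^sub>k\<close> where
  \<open>\<phi>\<close> and \<open>\<psi>\<^sub>k\<close> differ, the pairs in \<open>E\<close> for which one group element serves both functions form
  a relation that is hyperfinite by projective rigidity, and almost every pair in \<open>E\<close> over the domain
  of \<open>\<phi>\<close> eventually belongs to these relations. Since increasing unions of hyperfinite relations are hyperfinite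
  almost everywhere (Dye, Krieger), \<open>E\<close> is hyperfinite almost everywhere on the limit superior of
  the \<open>D\<^sub>k\<close>, whose measure is at least \<open>\<epsilon>\<close>.\<close>

text \<open>Rigidity compares functions that are invariant for one and the same
  \<open>\<rho>\<close>. Two homomorphisms need not admit a common \<open>\<rho>\<close> on all of
  \<open>E\<close>, hence the cut to pairs served by one group element. The relations so obtained
  for different \<open>k\<close> live on different sets and are not nested; what increases with
  \<open>n\<close> is the relation of agreeing with all of them from stage \<open>n\<close> on, and
  on the limit superior every point still meets some later stage. Any Borel set of positive measure
  with hyperfinite restriction contradicts the hypothesis on \<open>E\<close>, so null sets may be
  discarded throughout. Thus projections need be measurable only for the completion, and rigidity,
  assumed for spaces with real points, has to be applied only on pieces of nearly full measure that
  are isomorphic to compact sets and can be copied into the reals. Each approximation at stage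
  \<open>k\<close> costs less than \<open>(1/2)^k\<close>: summability lets Borel-Cantelli free
  almost every point from the exceptional sets eventually, and the costs tend to 0, so the limit
  superior keeps measure at least \<open>e\<close>.\<close>

subsection \<open>Projections of Borel sets are universally measurable\<close>

text \<open>At an arbitrarily small cost in outer measure the second coordinate can be confined to
  shrinking sets whose intersection is closed and totally bounded, hence compact.\<close>

lemma closed_inner_approx_projection:
  fixes M :: "'a::metric_space measure" and C :: "('a \<times> 'w::{complete_space, second_countable_topology}) set"
  assumes sets: "sets M = sets borel" and fin: "finite_measure M" and C: "closed C" and e: "e > (0::real)"
  shows "\<exists>T. closed T \<and> T \<subseteq> fst ` C \<and> outer_measure_of M (fst ` C) \<le> emeasure M T + ennreal e"
proof -
  interpret finite_measure M by fact
  have sp[simp]: "space M = UNIV" using sets_eq_imp_space_eq[OF sets] by simp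
  obtain Q :: "'w set" where Q: "countable Q" "\<And>U::'w set. open U \<Longrightarrow> U \<noteq> {} \<Longrightarrow> \<exists>d\<in>Q. d \<in> U"
    using countable_dense_setE by blast
  have "Q \<noteq> {}" using Q(2)[of UNIV] by auto
  define q where "q = from_nat_into Q"
  have rq: "range q = Q" unfolding q_def using \<open>Q \<noteq> {}\<close> Q(1) by simp
  \<comment> \<open>As \<open>n\<close> grows these finite unions of balls exhaust the space; using
    one of them for each radius \<open>1 / (j + 1)\<close> gives total boundedness.\<close>
  define B where "B j n = (\<Union>i\<in>{..n::nat}. cball (q i) (1 / real (Suc j)))" for j n
  have closedB: "closed (B j n)" for j n unfolding B_def by auto
  have BU: "(\<Union>n. B j n) = UNIV" for j
  proof -
    have "\<exists>n. w \<in> B j n" for w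
    proof -
      obtain d where "d \<in> Q" "d \<in> ball w (1 / real (Suc j))" using Q(2)[of "ball w (1 / real (Suc j))"] by auto
      then obtain i where "q i \<in> ball w (1 / real (Suc j))" using rq by (metis rangeE)
      then have "w \<in> B j i" unfolding B_def by (auto simp: dist_commute intro!: bexI[of _ i])
      then show ?thesis by blast
    qed
    then show ?thesis by auto
  qed
  define pr where "pr L = fst ` (C \<inter> (UNIV \<times> L))" for L
  let ?m = "outer_measure_of M"
  have mfin: "?m A < \<infinity>" for A
  proof -
    have "?m A \<le> ?m (space M)" by (rule outer_measure_of_mono) simp
    also have "\<dots> = emeasure M (space M)" by (rule outer_measure_of_eq) (rule sets.top)
    also have "\<dots> < \<infinity>" using emeasure_finite[of "space M"] by (metis infinity_ennreal_def top.not_eq_extremum)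
    finally show ?thesis .
  qed
  \<comment> \<open>Outer measure is continuous along any increasing sequence of sets, measurable or
    not; hence some \<open>n\<close> loses at most \<open>d\<close>.\<close>
  have step: "\<exists>n. ?m (pr L) \<le> ?m (pr (L \<inter> B j n)) + ennreal d" if "d > 0" for L j d
  proof -
    have U: "(\<Union>n. pr (L \<inter> B j n)) = pr L" 
    proof -
      have "C \<inter> (UNIV \<times> L) = (\<Union>n. C \<inter> (UNIV \<times> (L \<inter> B j n)))" using BU[of j] by auto
      then show ?thesis unfolding pr_def image_UN[symmetric] by simp
    qed
    have inc: "incseq (\<lambda>n. pr (L \<inter> B j n))"
    proof -
      have "B j n \<subseteq> B j m" if "n \<le> m" for n m
        unfolding B_def using that by (intro UN_mono) auto
      then show ?thesis unfolding incseq_def pr_def by (intro allI impI image_mono) auto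
    qed
    have sup: "(SUP n. ?m (pr (L \<inter> B j n))) = ?m (pr L)"
      using SUP_outer_measure_of_incseq[of "\<lambda>n. pr (L \<inter> B j n)" M] inc U by simp
    show ?thesis
    proof (rule ccontr)
      assume "\<not> ?thesis"
      then have "?m (pr (L \<inter> B j n)) + ennreal d < ?m (pr L)" for n by (simp add: not_le)
      then have le: "?m (pr (L \<inter> B j n)) + ennreal d \<le> ?m (pr L)" for n by (simp add: less_imp_le)
      have "(SUP n. ?m (pr (L \<inter> B j n))) + ennreal d = (SUP n. ?m (pr (L \<inter> B j n)) + ennreal d)"
        by (rule ennreal_SUP_add_left[symmetric]) auto
      also have "\<dots> \<le> ?m (pr L)" using le by (simp add: SUP_le_iff)
      finally have "?m (pr L) + ennreal d \<le> ?m (pr L)" using sup by simp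
      moreover have "?m (pr L) < ?m (pr L) + ennreal d"
        using mfin[of "pr L"] \<open>d > 0\<close> ennreal_add_left_cancel_less[of "?m (pr L)" 0 "ennreal d"] by simp
      ultimately show False by simp
    qed
  qed
  \<comment> \<open>The losses \<open>e * (1/2)^(Suc j)\<close> add up to at most
    \<open>e\<close>.\<close>
  have "\<exists>L::nat \<Rightarrow> 'w set. \<forall>j::nat. (closed (L j) \<and> (j = 0 \<longrightarrow> L j = UNIV)) \<and>
     (\<exists>n. L (Suc j) = L j \<inter> B j n \<and> ?m (pr (L j)) \<le> ?m (pr (L (Suc j))) + ennreal (e * (1/2)^(Suc j)))"
  proof (rule dependent_nat_choice)
    fix L :: "'w set" and j :: nat assume "closed L \<and> (j = 0 \<longrightarrow> L = UNIV)"
    moreover obtain n where "?m (pr L) \<le> ?m (pr (L \<inter> B j n)) + ennreal (e * (1/2)^(Suc j))"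
      using step[of "e * (1/2)^(Suc j)" L j] e by auto
    ultimately show "\<exists>L'. (closed L' \<and> (Suc j = 0 \<longrightarrow> L' = UNIV)) \<and>
        (\<exists>n. L' = L \<inter> B j n \<and> ?m (pr L) \<le> ?m (pr L') + ennreal (e * (1/2)^(Suc j)))"
      using closedB by (intro exI[of _ "L \<inter> B j n"]) auto
  qed auto
  then obtain L where L: "\<And>j. closed (L j)" "L 0 = UNIV" "\<And>j. \<exists>n. L (Suc j) = L j \<inter> B j n"
     "\<And>j. ?m (pr (L j)) \<le> ?m (pr (L (Suc j))) + ennreal (e * (1/2)^(Suc j))" by metis
  have decL: "decseq L" using L(3) by (intro decseq_SucI) blast
  have decpr: "pr (L k) \<subseteq> pr (L j)" if "j \<le> k" for j k using decseqD[OF decL that] unfolding pr_def by auto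
  have pr0: "pr (L 0) = fst ` C" by (auto simp: pr_def L(2))
  have bound: "?m (fst ` C) \<le> ?m (pr (L j)) + ennreal (e * (1 - (1/2)^j))" for j
  proof (induction j)
    case 0 then show ?case by (simp add: pr0)
  next
    case (Suc j)
    have "?m (fst ` C) \<le> ?m (pr (L (Suc j))) + ennreal (e * (1/2)^(Suc j)) + ennreal (e * (1 - (1/2)^j))"
      using Suc.IH L(4)[of j] by (meson add_right_mono order_trans)
    also have "\<dots> = ?m (pr (L (Suc j))) + ennreal (e * (1/2)^(Suc j) + e * (1 - (1/2)^j))"
      using e by (subst ennreal_plus) (auto simp: add.assoc power_le_one)
    also have "e * (1/2)^(Suc j) + e * (1 - (1/2)^j) = e * (1 - (1/2)^(Suc j))"
      by (simp add: algebra_simps)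
    finally show ?case .
  qed
  \<comment> \<open>Taking closures makes the projections measurable. The intersection still lies in
    the projection of \<open>C\<close>, since the second coordinates of approximating points stay in
    a compact set.\<close>
  define T where "T j = closure (pr (L j))" for j
  have Tm: "T j \<in> sets M" for j by (simp add: T_def sets)
  have decT: "decseq T" unfolding decseq_def T_def using decpr closure_mono by blast
  have boundT: "?m (fst ` C) \<le> emeasure M (T j) + ennreal e" for j
  proof -
    have "?m (pr (L j)) \<le> emeasure M (T j)"
      using outer_measure_of_mono[OF closure_subset] Tm outer_measure_of_eq unfolding T_def by metis
    moreover have "ennreal (e * (1 - (1/2)^j)) \<le> ennreal e" 
      using e by (intro ennreal_leI) (auto simp: mult_le_cancel_left2)
    ultimately show ?thesis using bound[of j] by (meson add_mono order_trans)
  qed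
  have lim: "(\<lambda>j. emeasure M (T j) + ennreal e) \<longlonglongrightarrow> emeasure M (\<Inter>j. T j) + ennreal e"
    by (intro tendsto_add Lim_emeasure_decseq tendsto_const) (use Tm decT in auto)
  have fin: "?m (fst ` C) \<le> emeasure M (\<Inter>j. T j) + ennreal e"
    by (rule LIMSEQ_le_const[OF lim]) (use boundT in auto)
  have "(\<Inter>j. T j) \<subseteq> fst ` C"
  proof
    fix x assume x: "x \<in> (\<Inter>j. T j)"
    have "\<exists>p. p \<in> C \<and> snd p \<in> L j \<and> dist (fst p) x < 1 / real (Suc j)" for j
    proof -
      have "x \<in> closure (pr (L j))" using x by (auto simp: T_def)
      then obtain x' where "x' \<in> pr (L j)" "dist x' x < 1 / real (Suc j)"
        unfolding closure_approachable by (metis of_nat_0_less_iff zero_less_Suc zero_less_divide_1_iff)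
      then show ?thesis unfolding pr_def by force
    qed
    then obtain p where p: "\<And>j. p j \<in> C" "\<And>j. snd (p j) \<in> L j" "\<And>j. dist (fst (p j)) x < 1 / real (Suc j)"
      by metis
    have fstlim: "(\<lambda>j. fst (p j)) \<longlonglongrightarrow> x"
    proof (rule metric_LIMSEQ_I)
      fix r :: real assume "r > 0"
      then obtain N where N: "1 / real (Suc N) < r" using nat_approx_posE by blast
      have "dist (fst (p n)) x < r" if "n \<ge> N" for n
      proof -
        have "1 / real (Suc n) \<le> 1 / real (Suc N)" using that by (simp add: frac_le)
        then show ?thesis using p(3)[of n] N by linarith
      qed
      then show "\<exists>no. \<forall>n\<ge>no. dist (fst (p n)) x < r" by blast
    qed
    let ?S = "closure (range (\<lambda>j. snd (p j)))"
    have "compact ?S"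
      unfolding compact_eq_totally_bounded
    proof (intro conjI allI impI)
      show "complete ?S" by (simp add: complete_eq_closed)
      fix r :: real assume "r > 0"
      then obtain N where N: "1 / real (Suc N) < r/2" using nat_approx_posE half_gt_zero by blast
      obtain n where n: "L (Suc N) = L N \<inter> B N n" using L(3) by blast
      \<comment> \<open>The points with index above \<open>N\<close> lie in the balls of stage
        \<open>N\<close>; the remaining \<open>N + 1\<close> points serve as their own
        centres.\<close>
      let ?k = "q ` {..n} \<union> (\<lambda>j. snd (p j)) ` {..N}"
      have cov: "range (\<lambda>j. snd (p j)) \<subseteq> (\<Union>x\<in>?k. cball x (r/2))"
      proof safe
        fix j
        show "snd (p j) \<in> (\<Union>x\<in>?k. cball x (r/2))"
        proof (cases "j \<le> N")
          case True then show ?thesis using \<open>r > 0\<close> by (intro UN_I[of "snd (p j)"]) auto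
        next
          case False
          then have "snd (p j) \<in> L (Suc N)" using p(2)[of j] decseqD[OF decL, of "Suc N" j] by auto
          then have "snd (p j) \<in> B N n" using n by auto
          then obtain i where "i \<le> n" "snd (p j) \<in> cball (q i) (1 / real (Suc N))" unfolding B_def by auto
          then show ?thesis using N by (intro UN_I[of "q i"]) auto
        qed
      qed
      have "closed (\<Union>x\<in>?k. cball x (r/2))" by (intro closed_UN) auto
      then have "?S \<subseteq> (\<Union>x\<in>?k. cball x (r/2))" by (rule closure_minimal[OF cov])
      also have "\<dots> \<subseteq> (\<Union>x\<in>?k. ball x r)" using \<open>r > 0\<close> by (intro UN_mono) auto
      finally show "\<exists>k. finite k \<and> ?S \<subseteq> (\<Union>x\<in>k. ball x r)"
        by (intro exI[of _ ?k]) auto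
    qed
    then have "seq_compact ?S" by (simp add: compact_eq_seq_compact_metric)
    moreover have "\<forall>j. snd (p j) \<in> ?S" by (meson closure_subset rangeI subsetD)
    ultimately obtain l r where lr: "strict_mono (r :: nat \<Rightarrow> nat)" "((\<lambda>j. snd (p j)) \<circ> r) \<longlonglongrightarrow> l"
      by (rule seq_compactE) 
    have "(\<lambda>j. p (r j)) \<longlonglongrightarrow> (x, l)"
      using tendsto_Pair[OF LIMSEQ_subseq_LIMSEQ[OF fstlim lr(1)] lr(2)] by (simp add: o_def)
    have "\<And>j. p (r j) \<in> C" by (rule p(1))
    from closed_sequentially[OF C this \<open>(\<lambda>j. p (r j)) \<longlonglongrightarrow> (x, l)\<close>] have "(x, l) \<in> C" .
    then show "x \<in> fst ` C" by force
  qed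
  moreover have "closed (\<Inter>j. T j)" by (auto simp: T_def)
  ultimately show ?thesis using fin by blast
qed

text \<open>The projection lies between the union of its closed inner approximations and a
  measurable hull \<open>H\<close>, and these two sets have the same measure.\<close>

lemma projection_closed_completion:
  fixes M :: "'a::metric_space measure" and C :: "('a \<times> 'w::{complete_space, second_countable_topology}) set"
  assumes sets: "sets M = sets borel" and fin: "finite_measure M" and C: "closed C"
  shows "fst ` C \<in> sets (completion M)"
proof -
  interpret finite_measure M by fact
  have sp[simp]: "space M = UNIV" using sets_eq_imp_space_eq[OF sets] by simp
  obtain H where H: "H \<in> sets M" "fst ` C \<subseteq> H" "outer_measure_of M (fst ` C) = emeasure M H"
    using outer_measure_of_attain[of "fst ` C" M] by auto
  have "\<exists>T. closed T \<and> T \<subseteq> fst ` C \<and> outer_measure_of M (fst ` C) \<le> emeasure M T + ennreal (1 / real (Suc n))" for n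
    by (rule closed_inner_approx_projection[OF sets fin C]) simp
  then obtain T where T: "\<And>n. closed (T n)" "\<And>n. T n \<subseteq> fst ` C"
      "\<And>n. emeasure M H \<le> emeasure M (T n) + ennreal (1 / real (Suc n))"
    using H(3) by metis
  let ?U = "\<Union>n. T n"
  have U: "?U \<in> sets M" using T(1) by (auto simp: sets)
  have UH: "?U \<subseteq> H" using T(2) H(2) by blast
  have le: "measure M (H - ?U) \<le> 1 / real (Suc n)" for n
  proof -
    have Tn: "T n \<in> sets M" using T(1) by (auto simp: sets)
    have "ennreal (measure M H) \<le> ennreal (measure M (T n) + 1 / real (Suc n))"
      using T(3)[of n] by (simp add: emeasure_eq_measure)
    then have "measure M H \<le> measure M (T n) + 1 / real (Suc n)"
      by (subst (asm) ennreal_le_iff) auto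
    moreover have "measure M (T n) \<le> measure M ?U" using U by (intro finite_measure_mono) auto
    moreover have "measure M (H - ?U) = measure M H - measure M ?U"
      using H(1) U UH by (rule finite_measure_Diff)
    ultimately show ?thesis by simp
  qed
  have "measure M (H - ?U) \<le> 0"
  proof (rule field_le_epsilon)
    fix r :: real assume "r > 0"
    then obtain N where N: "1 / real (Suc N) < r" using nat_approx_posE by blast
    then show "measure M (H - ?U) \<le> 0 + r" using le[of N] by simp
  qed
  then have null: "H - ?U \<in> null_sets M"
    using H(1) U by (auto simp: null_sets_def emeasure_eq_measure measure_le_0_iff)
  show ?thesis
    by (rule sets_completionI[of _ ?U "fst ` C - ?U" "H - ?U"]) (use T(2) H(2) null U in auto)
qed

section \<open>Borel sets as projections of closed sets\<close>

lemma open_countable_UN_closed: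
  fixes U :: "'a::metric_space set"
  assumes "open U"
  shows "\<exists>F::nat \<Rightarrow> 'a set. (\<forall>n. closed (F n)) \<and> U = (\<Union>n. F n)"
\<comment> \<open>\<open>infdist\<close> to the empty set is 0, so the level sets below need a
  nonempty complement.\<close>
proof (cases "U = UNIV")
  case True then show ?thesis by (intro exI[of _ "\<lambda>_. UNIV"]) auto
next
  case False
  define F where "F n = {x. 1 / real (Suc n) \<le> infdist x (- U)}" for n
  have "closed (F n)" for n unfolding F_def by (intro closed_Collect_le continuous_intros)
  moreover have "U = (\<Union>n. F n)"
  proof
    show "U \<subseteq> (\<Union>n. F n)"
    proof
      fix x assume "x \<in> U"
      then have "infdist x (- U) \<noteq> 0"
        using in_closed_iff_infdist_zero[of "- U" x] False assms by auto
      then have "infdist x (- U) > 0" using infdist_nonneg[of x "- U"] by linarith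
      then obtain n where "1 / real (Suc n) < infdist x (- U)" using nat_approx_posE by blast
      then have "x \<in> F n" by (simp add: F_def)
      then show "x \<in> (\<Union>n. F n)" by blast
    qed
    show "(\<Union>n. F n) \<subseteq> U"
    proof
      fix x assume "x \<in> (\<Union>n. F n)"
      then obtain n where "1 / real (Suc n) \<le> infdist x (- U)" by (auto simp: F_def)
      moreover have "0 < 1 / real (Suc n)" by simp
      ultimately have "infdist x (- U) > 0" by linarith
      then show "x \<in> U" by (metis ComplI infdist_zero less_irrefl)
    qed
  qed
  ultimately show ?thesis by blast
qed

text \<open>For Polish \<open>'z\<close> these are the analytic sets. The extra coordinate ranges
  over Baire space, given as a complete second countable type so that
  \<open>projection_closed_completion\<close> can project it away.\<close>

definition closed_projection :: "'z::topological_space set \<Rightarrow> bool" where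
  "closed_projection S \<longleftrightarrow> (\<exists>C :: ('z \<times> (nat \<Rightarrow> nat discrete)) set. closed C \<and> S = fst ` C)"

lemma closed_projection_closed: "closed S \<Longrightarrow> closed_projection S"
  unfolding closed_projection_def by (intro exI[of _ "S \<times> UNIV"]) (auto intro: closed_Times)

lemma continuous_on_snd_coordinate:
  "continuous_on UNIV (\<lambda>p :: 'a::topological_space \<times> ('i \<Rightarrow> 'b::topological_space). snd p k)"
  using continuous_on_compose[OF continuous_on_snd[OF continuous_on_id]
      continuous_on_subset[OF continuous_on_product_coordinates subset_UNIV]]
  by (simp add: o_def)

text \<open>Coordinate 0 of the sequence names an index \<open>i\<close>, and the tail of the
  sequence is a witness for membership in \<open>A i\<close>.\<close>

lemma closed_projection_UN:
  assumes "\<And>i::nat. closed_projection (A i)"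
  shows "closed_projection (\<Union>i. A i)"
proof -
  have "\<forall>i. \<exists>C :: ('a \<times> (nat \<Rightarrow> nat discrete)) set. closed C \<and> A i = fst ` C"
    using assms unfolding closed_projection_def by blast
  from choice[OF this] obtain C :: "nat \<Rightarrow> ('a \<times> (nat \<Rightarrow> nat discrete)) set"
    where CA: "\<forall>i. closed (C i) \<and> A i = fst ` C i" ..
  have C: "\<And>i. closed (C i)" "\<And>i. A i = fst ` C i" using CA by simp_all
  define tl where "tl p = (fst p, \<lambda>n. snd p (Suc n))" for p :: "'a \<times> (nat \<Rightarrow> nat discrete)"
  have tlc: "continuous_on UNIV tl" unfolding tl_def
    by (intro continuous_on_Pair continuous_on_fst continuous_on_id
        continuous_on_coordinatewise_then_product continuous_on_snd_coordinate)
  have hdc: "continuous_on UNIV (\<lambda>p::'a \<times> (nat \<Rightarrow> nat discrete). snd p 0)"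
    by (rule continuous_on_snd_coordinate)
  define D where "D = (\<Inter>i. ((\<lambda>p. snd p 0) -` (- {discrete i})) \<union> tl -` C i)"
  have "closed D" unfolding D_def
    using C(1) by (intro closed_INT ballI closed_Un closed_vimage hdc tlc) (auto simp: closed_def intro: open_discrete)
  moreover have "(\<Union>i. A i) = fst ` D"
  proof safe
    fix z i assume "z \<in> A i"
    then obtain a where "(z, a) \<in> C i" using C(2) by auto
    then have "(z, case_nat (discrete i) a) \<in> D" by (auto simp: D_def tl_def discrete_inject)
    then show "z \<in> fst ` D" by force
  next
    fix z a assume "(z, a) \<in> D"
    then have "tl (z, a) \<in> C (of_discrete (a 0))" by (auto simp: D_def of_discrete_inverse)
    then have "z \<in> A (of_discrete (a 0))" using C(2) by (force simp: tl_def)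
    then show "fst (z, a) \<in> (\<Union>i. A i)" by auto
  qed
  ultimately show ?thesis unfolding closed_projection_def by blast
qed

text \<open>A single sequence carries witnesses for all \<open>A i\<close> at once, interleaved by
  \<open>prod_encode\<close>.\<close>

lemma closed_projection_INT:
  assumes "\<And>i::nat. closed_projection (A i)"
  shows "closed_projection (\<Inter>i. A i)"
proof -
  have "\<forall>i. \<exists>C :: ('a \<times> (nat \<Rightarrow> nat discrete)) set. closed C \<and> A i = fst ` C"
    using assms unfolding closed_projection_def by blast
  from choice[OF this] obtain C :: "nat \<Rightarrow> ('a \<times> (nat \<Rightarrow> nat discrete)) set"
    where CA: "\<forall>i. closed (C i) \<and> A i = fst ` C i" ..
  have C: "\<And>i. closed (C i)" "\<And>i. A i = fst ` C i" using CA by simp_all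
  define h where "h i p = (fst p, \<lambda>n. snd p (prod_encode (i, n)))" for i and p :: "'a \<times> (nat \<Rightarrow> nat discrete)"
  have hc: "continuous_on UNIV (h i)" for i unfolding h_def
    by (intro continuous_on_Pair continuous_on_fst continuous_on_id
        continuous_on_coordinatewise_then_product continuous_on_snd_coordinate)
  define D where "D = (\<Inter>i. h i -` C i)"
  have "closed D" unfolding D_def using C(1) by (intro closed_INT ballI closed_vimage hc)
  moreover have "(\<Inter>i. A i) = fst ` D"
  proof
    show "(\<Inter>i. A i) \<subseteq> fst ` D"
    proof
      fix z assume "z \<in> (\<Inter>i. A i)"
      then have "\<exists>a. (z, a) \<in> C i" for i using C(2) by force
      then obtain a where a: "\<And>i. (z, a i) \<in> C i" by metis
      have "(z, \<lambda>m. case prod_decode m of (i, n) \<Rightarrow> a i n) \<in> D" using a by (auto simp: D_def h_def)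
      then show "z \<in> fst ` D" by force
    qed
    show "fst ` D \<subseteq> (\<Inter>i. A i)"
      using C(2) by (force simp: D_def h_def)
  qed
  ultimately show ?thesis unfolding closed_projection_def by blast
qed

lemma borel_imp_closed_projection:
  fixes S :: "'z::metric_space set"
  assumes "S \<in> sets borel"
  shows "closed_projection S"
proof -
  have "S \<in> sigma_sets UNIV {S. open S}" using assms by (simp add: borel_def)
  \<comment> \<open>Closed projections need not be stable under complements, so the induction
    carries the complement along.\<close>
  then have "closed_projection S \<and> closed_projection (- S)"
  proof (induction S rule: sigma_sets.induct)
    case (Basic U)
    then obtain F :: "nat \<Rightarrow> 'z set" where "\<And>n. closed (F n)" "U = (\<Union>n. F n)"
      using open_countable_UN_closed by blast
    then have "closed_projection U" using closed_projection_UN[of F] closed_projection_closed by metis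
    moreover have "closed_projection (- U)" using Basic by (intro closed_projection_closed) auto
    ultimately show ?case ..
  next
    case Empty
    then show ?case using closed_projection_closed[of "{}"] closed_projection_closed[of UNIV] by simp
  next
    case (Compl S) then show ?case by (auto simp: Compl_eq_Diff_UNIV double_diff)
  next
    case (Union S)
    then show ?case using closed_projection_UN[of S] closed_projection_INT[of "\<lambda>i. - S i"] by simp
  qed
  then show ?thesis ..
qed

text \<open>A Borel set of pairs is the projection of a closed set along Baire space; reassociating
  the product turns the two successive projections into one projection of a closed set.\<close>

lemma projection_borel_completion:
  fixes M :: "'a::metric_space measure" and S :: "('a \<times> 'w::{complete_space, second_countable_topology}) set"
  assumes sets: "sets M = sets borel" and fin: "finite_measure M" and S: "S \<in> sets borel"
  shows "fst ` S \<in> sets (completion M)"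
proof -
  obtain C :: "(('a \<times> 'w) \<times> (nat \<Rightarrow> nat discrete)) set" where C: "closed C" "S = fst ` C"
    using borel_imp_closed_projection[OF S] unfolding closed_projection_def by blast
  define h where "h p = ((fst p, fst (snd p)), snd (snd p))" for p :: "'a \<times> ('w \<times> (nat \<Rightarrow> nat discrete))"
  have "closed (h -` C)" using C(1) unfolding h_def
    by (intro closed_vimage continuous_intros)
  then have "fst ` (h -` C) \<in> sets (completion M)"
    by (rule projection_closed_completion[OF sets fin])
  moreover have "fst ` (h -` C) = fst ` S" 
  proof
    show "fst ` (h -` C) \<subseteq> fst ` S" unfolding C(2) h_def by force
    show "fst ` S \<subseteq> fst ` (h -` C)"
    proof
      fix x assume "x \<in> fst ` S"
      then obtain w a where "((x, w), a) \<in> C" unfolding C(2) by auto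
      then have "(x, (w, a)) \<in> h -` C" by (simp add: h_def)
      then show "x \<in> fst ` (h -` C)" by force
    qed
  qed
  ultimately show ?thesis by simp
qed

subsection \<open>Borel sets with countable sections, almost everywhere\<close>

text \<open>Exhaustion: the union of sets whose measures approach the supremum attains it, so a
  further set of the family can add only a null set.\<close>

lemma (in finite_measure) essentially_largest_set:
  assumes ne: "{} \<in> \<Z>" and sub: "\<Z> \<subseteq> sets M" and un: "\<And>A :: nat \<Rightarrow> 'a set. range A \<subseteq> \<Z> \<Longrightarrow> (\<Union>n. A n) \<in> \<Z>"
  shows "\<exists>Z\<in>\<Z>. \<forall>Z'\<in>\<Z>. Z' - Z \<in> null_sets M"
proof -
  let ?S = "measure M ` \<Z>"
  have bdd: "bdd_above ?S" by (intro bdd_aboveI2[of _ _ "measure M (space M)"]) (simp add: bounded_measure)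
  have neS: "?S \<noteq> {}" using ne by auto
  have "\<exists>Z\<in>\<Z>. Sup ?S - 1 / real (Suc n) < measure M Z" for n
  proof -
    have "Sup ?S - 1 / real (Suc n) < Sup ?S" by simp
    from less_cSupD[OF neS this] show ?thesis by blast
  qed
  then obtain A where A: "\<And>n::nat. A n \<in> \<Z>" "\<And>n. Sup ?S - 1 / real (Suc n) < measure M (A n)" by metis
  let ?Z = "\<Union>n. A n"
  have Z: "?Z \<in> \<Z>" using A(1) by (intro un) auto
  show ?thesis
  proof (intro bexI[OF _ Z] ballI)
    fix Z' assume Z': "Z' \<in> \<Z>"
    have sets: "Z' \<in> sets M" "?Z \<in> sets M" "A n \<in> sets M" for n using Z' Z A(1) sub by blast+
    have "(\<Union>n. (case n of 0 \<Rightarrow> Z' | Suc k \<Rightarrow> A k)) \<in> \<Z>" using Z' A(1) by (intro un) (auto split: nat.splits)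
    also have "(\<Union>n. (case n of 0 \<Rightarrow> Z' | Suc k \<Rightarrow> A k)) = Z' \<union> ?Z"
    proof -
      have "(\<Union>n. (case n of 0 \<Rightarrow> Z' | Suc k \<Rightarrow> A k)) = (case 0 of 0 \<Rightarrow> Z' | Suc k \<Rightarrow> A k) \<union> (\<Union>n. (case Suc n of 0 \<Rightarrow> Z' | Suc k \<Rightarrow> A k))"
        by (subst UNIV_nat_eq) (simp add: image_image)
      then show ?thesis by simp
    qed
    finally have le: "measure M (Z' \<union> ?Z) \<le> Sup ?S" by (intro cSup_upper bdd) auto
    have eq: "measure M (Z' - ?Z) = measure M (Z' \<union> ?Z) - measure M ?Z"
      using finite_measure_Union'[of ?Z Z'] sets by (simp add: Un_commute)
    have "measure M (Z' - ?Z) \<le> 0"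
    proof (rule field_le_epsilon)
      fix r :: real assume "r > 0"
      then obtain N where N: "1 / real (Suc N) < r" using nat_approx_posE by blast
      have "measure M (A N) \<le> measure M ?Z" using sets by (intro finite_measure_mono) auto
      then show "measure M (Z' - ?Z) \<le> 0 + r" using A(2)[of N] N le eq by simp
    qed
    then show "Z' - ?Z \<in> null_sets M"
      using sets by (auto simp: null_sets_def emeasure_eq_measure measure_le_0_iff)
  qed
qed

text \<open>Covering is asked in one direction only: \<open>f n x\<close> may lie outside the
  section over \<open>x\<close>, which allows total functions even where sections are empty.\<close>

definition ae_graph_covered :: "'a measure \<Rightarrow> ('a \<times> 'b::topological_space) set \<Rightarrow> bool" where
  "ae_graph_covered M A \<longleftrightarrow> (\<exists>f::nat \<Rightarrow> 'a \<Rightarrow> 'b. \<exists>N\<in>null_sets M. (\<forall>n. f n \<in> borel_measurable M) \<and>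
     (\<forall>x y. (x, y) \<in> A \<longrightarrow> x \<notin> N \<longrightarrow> (\<exists>n. y = f n x)))"

lemma ae_graph_covered_subset:
  assumes "ae_graph_covered M B" "A \<subseteq> B"
  shows "ae_graph_covered M A"
proof -
  obtain f :: "nat \<Rightarrow> 'a \<Rightarrow> 'b" and N where "N \<in> null_sets M" "\<forall>n. f n \<in> borel_measurable M"
    "\<forall>x y. (x, y) \<in> B \<longrightarrow> x \<notin> N \<longrightarrow> (\<exists>n. y = f n x)"
    using assms(1) unfolding ae_graph_covered_def by blast
  then show ?thesis unfolding ae_graph_covered_def
    using assms(2) by (intro exI[of _ f] bexI[of _ N] conjI) blast+
qed

lemma ae_graph_covered_null:
  assumes "N \<in> null_sets M" "A \<subseteq> N \<times> UNIV"
  shows "ae_graph_covered M A"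
  unfolding ae_graph_covered_def
  using assms by (intro exI[of _ "\<lambda>_ _. undefined"] bexI[of _ N]) auto

lemma ae_graph_covered_graph:
  assumes "f \<in> borel_measurable M" "\<And>x y. (x, y) \<in> A \<Longrightarrow> y = f x"
  shows "ae_graph_covered M A"
  unfolding ae_graph_covered_def
  using assms by (intro exI[of _ "\<lambda>_. f"] bexI[of _ "{}"]) auto

lemma ae_graph_covered_UN:
  assumes "\<And>i::nat. ae_graph_covered M (A i :: ('a \<times> 'b::topological_space) set)"
  shows "ae_graph_covered M (\<Union>i. A i)"
proof -
  have "\<forall>i. \<exists>p::(nat \<Rightarrow> 'a \<Rightarrow> 'b) \<times> 'a set. snd p \<in> null_sets M \<and> (\<forall>n. fst p n \<in> borel_measurable M) \<and>
     (\<forall>x y. (x, y) \<in> A i \<longrightarrow> x \<notin> snd p \<longrightarrow> (\<exists>n. y = fst p n x))"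
    using assms unfolding ae_graph_covered_def by (metis fst_conv snd_conv)
  from choice[OF this] obtain p :: "nat \<Rightarrow> (nat \<Rightarrow> 'a \<Rightarrow> 'b) \<times> 'a set" where "\<forall>i. snd (p i) \<in> null_sets M \<and> (\<forall>n. fst (p i) n \<in> borel_measurable M) \<and>
     (\<forall>x y. (x, y) \<in> A i \<longrightarrow> x \<notin> snd (p i) \<longrightarrow> (\<exists>n. y = fst (p i) n x))" ..
  then have p: "\<And>i. snd (p i) \<in> null_sets M" "\<And>i n. fst (p i) n \<in> borel_measurable M"
     "\<And>i x y. (x, y) \<in> A i \<Longrightarrow> x \<notin> snd (p i) \<Longrightarrow> \<exists>n. y = fst (p i) n x" by blast+
  let ?f = "\<lambda>k. fst (p (fst (prod_decode k))) (snd (prod_decode k))"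
  show ?thesis unfolding ae_graph_covered_def
  proof (intro exI[of _ ?f] bexI[of _ "\<Union>i. snd (p i)"] conjI allI impI)
    fix x y assume "(x, y) \<in> (\<Union>i. A i)" "x \<notin> (\<Union>i. snd (p i))"
    then obtain i n where "y = fst (p i) n x" using p(3) by blast
    then show "\<exists>k. y = ?f k x" by (intro exI[of _ "prod_encode (i, n)"]) simp
  qed (auto intro: p)
qed

text \<open>Baire category: the fibres of \<open>fst\<close> on \<open>K\<close> are countably many
  closed sets that cover the completely metrizable \<open>K\<close>, so one of them has an interior
  point, and the part of \<open>K\<close> in some basic neighbourhood of that point lies inside the
  fibre.\<close>

lemma countable_projection_locally_constant:
  fixes K :: "('b::complete_space \<times> 'c::complete_space) set" and V :: "nat \<Rightarrow> ('b \<times> 'c) set"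
  assumes K: "closed K" "K \<noteq> {}" and cnt: "countable (fst ` K)"
    and V: "\<And>O' w. open O' \<Longrightarrow> w \<in> O' \<Longrightarrow> \<exists>n. w \<in> V n \<and> V n \<subseteq> O'"
  shows "\<exists>n. K \<inter> V n \<noteq> {} \<and> (\<forall>w\<in>K \<inter> V n. \<forall>w'\<in>K \<inter> V n. fst w = fst w')"
proof -
  let ?X = "top_of_set K"
  let ?G = "(\<lambda>y. K \<inter> ({y} \<times> UNIV)) ` (fst ` K)"
  have cm: "completely_metrizable_space ?X"
    by (intro completely_metrizable_space_closedin completely_metrizable_space_euclidean) (use K in auto)
  have UG: "\<Union> ?G = K" by force
  have "\<exists>T\<in>?G. ?X interior_of T \<noteq> {}"
  proof (rule ccontr)
    assume "\<not> ?thesis"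
    then have "?X interior_of \<Union> ?G = {}"
      using cm cnt K(1)
      by (intro Baire_category_alt) (auto intro!: closedin_closed_Int closed_Times)
    then have "?X interior_of K = {}" unfolding UG .
    moreover have "?X interior_of K = K" using interior_of_topspace[of ?X] by simp
    ultimately show False using K(2) by simp
  qed
  then obtain y where y: "?X interior_of (K \<inter> ({y} \<times> UNIV)) \<noteq> {}" by blast
  then obtain w where w: "w \<in> ?X interior_of (K \<inter> ({y} \<times> UNIV))" by blast
  then obtain T where T: "openin ?X T" "w \<in> T" "T \<subseteq> K \<inter> ({y} \<times> UNIV)"
    unfolding interior_of_def by blast
  then obtain O' where O': "open O'" "T = K \<inter> O'" by (auto simp: openin_open)
  then obtain n where n: "w \<in> V n" "V n \<subseteq> O'" using V[of O' w] T(2) by blast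
  have *: "fst w' = y" if "w' \<in> K \<inter> V n" for w'
  proof -
    have "w' \<in> {y} \<times> UNIV" using that n(2) O'(2) T(3) by blast
    then show ?thesis by auto
  qed
  have "K \<inter> V n \<noteq> {}" using n(1) T(2) O'(2) by blast
  moreover have "\<forall>w\<in>K \<inter> V n. \<forall>w'\<in>K \<inter> V n. fst w = fst w'" using * by metis
  ultimately show ?thesis by blast
qed

text \<open>Serves to handle countably many projections, known to be measurable only for the
  completion, off a single null set.\<close>

lemma completion_sets_common_null:
  assumes "\<And>i::nat. A i \<in> sets (completion M)"
  shows "\<exists>N\<in>null_sets M. \<forall>i. A i - N \<in> sets M"
proof -
  have "\<exists>N\<in>null_sets M. A i - N \<in> sets M" for i
  proof -
    obtain S N N' where "A i = S \<union> N" "N \<subseteq> N'" "N' \<in> null_sets M" "S \<in> sets M"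
      using sets_completionE[OF assms[of i]] by metis
    moreover from this have "A i - N' = S - N'" by blast
    ultimately show ?thesis by (intro bexI[of _ N']) auto
  qed
  then obtain N where N: "\<And>i. N i \<in> null_sets M" "\<And>i. A i - N i \<in> sets M" by metis
  have "A i - (\<Union>i. N i) \<in> sets M" for i
  proof -
    have "A i - (\<Union>i. N i) = (A i - N i) - (\<Union>i. N i)" by blast
    also have "\<dots> \<in> sets M" using N null_sets_UN[of N M] by auto
    finally show ?thesis .
  qed
  then show ?thesis using N(1) by (intro bexI[of _ "\<Union>i. N i"]) auto
qed

lemma countable_base_sequence:
  "\<exists>V::nat \<Rightarrow> 'a::second_countable_topology set. (\<forall>n. open (V n)) \<and>
     (\<forall>U w. open U \<longrightarrow> w \<in> U \<longrightarrow> (\<exists>n. w \<in> V n \<and> V n \<subseteq> U))"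
proof -
  obtain B :: "'a set set" where B: "countable B" "topological_basis B"
    using ex_countable_basis by blast
  have "B \<noteq> {}"
  proof
    assume "B = {}"
    then show False using topological_basisE[OF B(2), of UNIV undefined] by auto
  qed
  then have r: "range (from_nat_into B) = B" using B(1) by simp
  show ?thesis
  proof (intro exI[of _ "from_nat_into B"] conjI allI impI)
    fix n show "open (from_nat_into B n)" using r topological_basis_open[OF B(2)] by (metis rangeI)
  next
    fix U and w :: 'a assume "open U" "w \<in> U"
    then obtain b where "b \<in> B" "w \<in> b" "b \<subseteq> U" using topological_basisE[OF B(2)] by metis
    then show "\<exists>n. w \<in> from_nat_into B n \<and> from_nat_into B n \<subseteq> U" using r by (metis rangeE)
  qed
qed

text \<open>Write \<open>R\<close> as the projection of a closed set \<open>C\<close>. For each basic open \<open>V\<close> let \<open>Z\<close> be the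
  essentially largest set of base points over which the part of \<open>C\<close> in \<open>V\<close> is covered by graphs, and
  remove these parts from \<open>C\<close>. A nonempty fibre of the remainder would, by the Baire category theorem, have a
  constant projection on some basic \<open>V\<close>, and such base points belong to \<open>Z\<close> almost everywhere.\<close>

theorem ae_graph_covered_countable_sections:
  fixes M :: "'a::{metric_space, second_countable_topology} measure"
    and R :: "('a \<times> 'b::{complete_space, second_countable_topology}) set"
  assumes sets: "sets M = sets borel" and fin: "finite_measure M" and R: "R \<in> sets borel"
    and cnt: "\<And>x. countable {y. (x, y) \<in> R}"
  shows "ae_graph_covered M R"
proof -
  interpret finite_measure M by fact
  have sp[simp]: "space M = UNIV" using sets_eq_imp_space_eq[OF sets] by simp
  obtain C0 :: "(('a \<times> 'b) \<times> (nat \<Rightarrow> nat discrete)) set" where C0: "closed C0" "R = fst ` C0"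
    using borel_imp_closed_projection[OF R] unfolding closed_projection_def by blast
  define C :: "('a \<times> ('b \<times> (nat \<Rightarrow> nat discrete))) set"
    where "C = (\<lambda>p. ((fst p, fst (snd p)), snd (snd p))) -` C0"
  have C: "closed C" using C0(1) unfolding C_def by (intro closed_vimage continuous_intros)
  have RC: "(x, y) \<in> R \<longleftrightarrow> (\<exists>a. (x, (y, a)) \<in> C)" for x y unfolding C0(2) C_def by force
  obtain V :: "nat \<Rightarrow> ('b \<times> (nat \<Rightarrow> nat discrete)) set" where V: "\<And>n. open (V n)"
     "\<And>U w. open U \<Longrightarrow> w \<in> U \<Longrightarrow> \<exists>n. w \<in> V n \<and> V n \<subseteq> U"
    using countable_base_sequence by metis
  obtain U :: "nat \<Rightarrow> 'b set" where U: "\<And>n. open (U n)"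
     "\<And>O' y. open O' \<Longrightarrow> y \<in> O' \<Longrightarrow> \<exists>n. y \<in> U n \<and> U n \<subseteq> O'"
    using countable_base_sequence by metis
  define A where "A Z n = (\<lambda>p. (fst p, fst (snd p))) ` (C \<inter> (Z \<times> V n))" for Z n
  have "\<exists>Z\<in>{Z \<in> sets M. ae_graph_covered M (A Z n)}. \<forall>Z'\<in>{Z \<in> sets M. ae_graph_covered M (A Z n)}. Z' - Z \<in> null_sets M" for n
  proof (rule essentially_largest_set)
    have "A {} n = {}" by (simp add: A_def)
    then show "{} \<in> {Z \<in> sets M. ae_graph_covered M (A Z n)}"
      using ae_graph_covered_null[of "{}" M "{}"] by simp
    fix Z :: "nat \<Rightarrow> 'a set" assume Z: "range Z \<subseteq> {Z \<in> sets M. ae_graph_covered M (A Z n)}"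
    have "A (\<Union>i. Z i) n = (\<Union>i. A (Z i) n)" unfolding A_def by blast
    moreover have "Z i \<in> sets M" "ae_graph_covered M (A (Z i) n)" for i using Z by (auto simp: image_subset_iff)
    ultimately show "(\<Union>i. Z i) \<in> {Z \<in> sets M. ae_graph_covered M (A Z n)}"
      using ae_graph_covered_UN[of M "\<lambda>i. A (Z i) n"] by auto
  qed auto
  then obtain Z where Z: "\<And>n. Z n \<in> sets M" "\<And>n. ae_graph_covered M (A (Z n) n)"
     "\<And>n Z'. Z' \<in> sets M \<Longrightarrow> ae_graph_covered M (A Z' n) \<Longrightarrow> Z' - Z n \<in> null_sets M"
    by (metis (no_types, lifting) mem_Collect_eq)
  define D where "D = C - (\<Union>n. Z n \<times> V n)"
  have D_borel: "D \<in> sets borel"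
    unfolding D_def using C Z(1) V(1) sets by (intro sets.Diff sets.countable_UN) (auto intro!: borel_Times)
  have proj: "fst ` (D \<inter> (UNIV \<times> O')) \<in> sets (completion M)" if "open O'" for O'
    using D_borel that by (intro projection_borel_completion[OF sets fin]) (auto intro!: sets.Int borel_Times)
  define P where "P n O' = fst ` (D \<inter> (UNIV \<times> (V n \<inter> (O' \<times> UNIV))))" for n O'
  have P_meas: "P n O' \<in> sets (completion M)" if "open O'" for n O'
    unfolding P_def using that V(1) by (intro proj open_Int open_Times) auto
  have P_iff: "x \<in> P n O' \<longleftrightarrow> (\<exists>w. (x, w) \<in> D \<and> w \<in> V n \<and> fst w \<in> O')" for x n O'
    unfolding P_def by (auto simp: image_iff Bex_def)
  \<comment> \<open>The base points over which the part of \<open>D\<close> in \<open>V n\<close> is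
    nonempty and has a single first coordinate. Distinct first coordinates are separated by disjoint
    basic open sets, so this is a countable combination of projections.\<close>
  define Q where "Q n = P n UNIV - (\<Union>p\<in>{p. U (fst p) \<inter> U (snd p) = {}}. P n (U (fst p)) \<inter> P n (U (snd p)))" for n
  have Q_meas: "Q n \<in> sets (completion M)" for n
  proof -
    have "P n (U i) \<inter> P n (U j) \<in> sets (completion M)" for i j by (intro sets.Int P_meas U(1))
    then have "(\<Union>p\<in>{p. U (fst p) \<inter> U (snd p) = {}}. P n (U (fst p)) \<inter> P n (U (snd p))) \<in> sets (completion M)"
      by (intro sets.countable_UN'' countableI_type)
    with P_meas[OF open_UNIV, of n] show ?thesis unfolding Q_def by (rule sets.Diff)
  qed
  have Q_const: "fst w = fst w'" if x: "x \<in> Q n" "(x, w) \<in> D" "w \<in> V n" "(x, w') \<in> D" "w' \<in> V n" for x n w w'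
  proof (rule ccontr)
    assume "fst w \<noteq> fst w'"
    from hausdorff[OF this] obtain O1 O2
      where O: "open O1" "open O2" "fst w \<in> O1" "fst w' \<in> O2" "O1 \<inter> O2 = {}" by blast
    obtain i where "fst w \<in> U i" "U i \<subseteq> O1" using U(2)[OF O(1,3)] by blast
    moreover obtain j where "fst w' \<in> U j" "U j \<subseteq> O2" using U(2)[OF O(2,4)] by blast
    ultimately have "x \<in> P n (U i)" "x \<in> P n (U j)" "U i \<inter> U j = {}" using x O(5) unfolding P_iff by blast+
    then have "x \<in> (\<Union>p\<in>{p. U (fst p) \<inter> U (snd p) = {}}. P n (U (fst p)) \<inter> P n (U (snd p)))"
      by (intro UN_I[of "(i, j)"]) auto
    then show False using x(1) unfolding Q_def by blast
  qed
  \<comment> \<open>Over \<open>Q n\<close> the first coordinate in \<open>D\<close> is a function,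
    and what was removed from \<open>C\<close> is covered already. So \<open>Q n\<close> off a null
    set qualifies for the family in which \<open>Z n\<close> is essentially largest; being disjoint
    from \<open>Z n\<close>, it is null.\<close>
  have Q_null: "Q n \<in> null_sets (completion M)" for n
  proof -
    obtain N where N: "N \<in> null_sets M" "\<And>i. (case i of 0 \<Rightarrow> Q n | Suc k \<Rightarrow> P n (U k)) - N \<in> sets M"
      using completion_sets_common_null[of "\<lambda>i. case i of 0 \<Rightarrow> Q n | Suc k \<Rightarrow> P n (U k)" M]
        Q_meas P_meas U(1) by (force split: nat.splits)
    let ?Q = "Q n - N"
    have Q': "?Q \<in> sets M" using N(2)[of 0] by simp
    have P': "P n (U k) - N \<in> sets M" for k using N(2)[of "Suc k"] by simp
    define g where "g x = (if x \<in> ?Q then fst (SOME w. (x, w) \<in> D \<and> w \<in> V n) else undefined)" for x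
    have g_eq: "g x = fst w" if "x \<in> ?Q" "(x, w) \<in> D" "w \<in> V n" for x w
    proof -
      have "(x, SOME w. (x, w) \<in> D \<and> w \<in> V n) \<in> D \<and> (SOME w. (x, w) \<in> D \<and> w \<in> V n) \<in> V n"
        using that by (intro someI[where P = "\<lambda>w. (x, w) \<in> D \<and> w \<in> V n"]) auto
      then have "fst (SOME w. (x, w) \<in> D \<and> w \<in> V n) = fst w"
        using that by (intro Q_const[of x n]) auto
      with that(1) show ?thesis unfolding g_def by (subst if_P)
    qed
    \<comment> \<open>Off \<open>?Q\<close> the function takes the value \<open>undefined\<close>,
      whose membership in \<open>U k\<close> decides the two cases.\<close>
    have gU: "g -` U k = (if undefined \<in> U k then (- ?Q) \<union> (?Q \<inter> (P n (U k) - N)) else ?Q \<inter> (P n (U k) - N))" for k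
    proof -
      have "g x \<in> U k \<longleftrightarrow> x \<in> P n (U k)" if x: "x \<in> ?Q" for x
      proof -
        have xQ: "x \<in> Q n" using x by blast
        then have "x \<in> P n UNIV" by (simp add: Q_def)
        then obtain w where w: "(x, w) \<in> D" "w \<in> V n" unfolding P_iff by blast
        have "(\<exists>w'. (x, w') \<in> D \<and> w' \<in> V n \<and> fst w' \<in> U k) \<longleftrightarrow> fst w \<in> U k"
        proof
          assume "\<exists>w'. (x, w') \<in> D \<and> w' \<in> V n \<and> fst w' \<in> U k"
          then obtain w' where w': "(x, w') \<in> D" "w' \<in> V n" "fst w' \<in> U k" by blast
          have "fst w' = fst w" by (rule Q_const[OF xQ w'(1,2) w])
          then show "fst w \<in> U k" using w'(3) by simp
        qed (use w in blast)
        then show ?thesis unfolding P_iff g_eq[OF x w] by simp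
      qed
      then have "?Q \<inter> g -` U k = ?Q \<inter> (P n (U k) - N)" by auto
      moreover have "- ?Q \<inter> g -` U k = (if undefined \<in> U k then - ?Q else {})" by (auto simp: g_def)
      moreover have "g -` U k = (- ?Q \<inter> g -` U k) \<union> (?Q \<inter> g -` U k)" by blast
      ultimately show ?thesis by (simp split: if_splits)
    qed
    have "g \<in> borel_measurable M"
    proof (rule borel_measurableI)
      fix S :: "'b set" assume "open S"
      then have "S = (\<Union>k\<in>{k. U k \<subseteq> S}. U k)" using U(2) by blast
      then have "g -` S = (\<Union>k\<in>{k. U k \<subseteq> S}. g -` U k)" by blast
      moreover have "g -` U k \<in> sets M" for k
      proof -
        have "- ?Q \<in> sets M" using sets.compl_sets[OF Q'] by (simp add: Compl_eq_Diff_UNIV)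
        then show ?thesis unfolding gU using sets.Int[OF Q' P'[of k]] sets.Un[of "- ?Q" M] by (simp del: Compl_Diff_eq)
      qed
      ultimately show "g -` S \<inter> space M \<in> sets M" by (auto intro!: sets.countable_UN'')
    qed
    then have g_cov: "ae_graph_covered M {(x, y). y = g x}" by (rule ae_graph_covered_graph) auto
    have "A ?Q n \<subseteq> (\<Union>i. case i of 0 \<Rightarrow> {(x, y). y = g x} | Suc k \<Rightarrow> A (Z k) k)"
    proof
      fix p assume "p \<in> A ?Q n"
      then obtain x w where p: "p = (x, fst w)" "(x, w) \<in> C" "x \<in> ?Q" "w \<in> V n" by (auto simp: A_def)
      show "p \<in> (\<Union>i. case i of 0 \<Rightarrow> {(x, y). y = g x} | Suc k \<Rightarrow> A (Z k) k)"
      proof (cases "(x, w) \<in> D")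
        case True
        then have "p \<in> (case 0 of 0 \<Rightarrow> {(x, y). y = g x} | Suc k \<Rightarrow> A (Z k) k)" using p g_eq by simp
        then show ?thesis by blast
      next
        case False
        then obtain k where "x \<in> Z k" "w \<in> V k" using p(2) by (auto simp: D_def)
        then have "p \<in> A (Z k) k" unfolding A_def p(1) using p(2) by force
        then have "p \<in> (case Suc k of 0 \<Rightarrow> {(x, y). y = g x} | Suc k \<Rightarrow> A (Z k) k)" by simp
        then show ?thesis by blast
      qed
    qed
    then have "ae_graph_covered M (A ?Q n)"
      by (rule ae_graph_covered_subset[rotated]) (auto intro!: ae_graph_covered_UN g_cov Z(2) split: nat.splits)
    then have "?Q - Z n \<in> null_sets M" using Z(3)[OF Q'] by blast
    moreover have "?Q - Z n = ?Q"
    proof -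
      have "x \<notin> Z n" if x: "x \<in> Q n" for x
      proof -
        have "x \<in> P n UNIV" using x by (simp add: Q_def)
        then obtain w where "(x, w) \<in> D" "w \<in> V n" unfolding P_iff by blast
        then show ?thesis by (auto simp: D_def)
      qed
      then show ?thesis by blast
    qed
    ultimately have "?Q \<in> null_sets M" by (simp only:)
    from null_sets.Un[OF this N(1)] have "?Q \<union> N \<in> null_sets (completion M)"
      by (rule null_sets_completionI)
    then show ?thesis by (rule null_sets_completion_subset[rotated]) blast
  qed
  then have "(\<Union>n. Q n) \<in> null_sets (completion M)" by (rule null_sets_UN)
  then obtain N where N: "N \<in> null_sets M" "(\<Union>n. Q n) \<subseteq> N"
    unfolding null_sets_completion_iff2 by blast
  have fiber: "x \<in> N" if xw: "(x, w) \<in> D" for x w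
  proof -
    let ?K = "Pair x -` D"
    \<comment> \<open>Over a fixed \<open>x\<close> the removed sets are open, so the fibre of
      \<open>D\<close> is closed although \<open>D\<close> need not be.\<close>
    have "?K = Pair x -` C - (\<Union>n\<in>{n. x \<in> Z n}. V n)" unfolding D_def by auto
    moreover have "closed (Pair x -` C)" using C by (intro closed_vimage continuous_intros)
    moreover have "open (\<Union>n\<in>{n. x \<in> Z n}. V n)" using V(1) by auto
    ultimately have K: "closed ?K" by (simp add: closed_Diff)
    have "fst ` ?K \<subseteq> {y. (x, y) \<in> R}" using RC by (auto simp: D_def)
    then have "countable (fst ` ?K)" using cnt countable_subset by blast
    moreover have "?K \<noteq> {}" using xw by blast
    ultimately obtain n where
      "?K \<inter> V n \<noteq> {}" "\<forall>w\<in>?K \<inter> V n. \<forall>w'\<in>?K \<inter> V n. fst w = fst w'"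
      using countable_projection_locally_constant[OF K _ _ V(2)] by meson
    then have n: "?K \<inter> V n \<noteq> {}" "\<And>w w'. w \<in> ?K \<inter> V n \<Longrightarrow> w' \<in> ?K \<inter> V n \<Longrightarrow> fst w = fst w'" by blast+
    have "x \<in> P n UNIV" using n(1) unfolding P_iff by blast
    moreover have "\<not> (x \<in> P n (U i) \<and> x \<in> P n (U j))" if "U i \<inter> U j = {}" for i j
    proof
      assume "x \<in> P n (U i) \<and> x \<in> P n (U j)"
      then obtain w w' where "w \<in> ?K \<inter> V n" "w' \<in> ?K \<inter> V n" "fst w \<in> U i" "fst w' \<in> U j"
        unfolding P_iff by blast
      then show False using n(2)[of w w'] that by auto
    qed
    ultimately have "x \<in> Q n" unfolding Q_def by blast
    then show ?thesis using N(2) by blast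
  qed
  have "R \<subseteq> (\<Union>i. case i of 0 \<Rightarrow> N \<times> UNIV | Suc k \<Rightarrow> A (Z k) k)"
  proof
    fix p assume "p \<in> R"
    then obtain x y a where p: "p = (x, y)" "(x, (y, a)) \<in> C" using RC by (cases p) blast
    show "p \<in> (\<Union>i. case i of 0 \<Rightarrow> N \<times> UNIV | Suc k \<Rightarrow> A (Z k) k)"
    proof (cases "(x, (y, a)) \<in> D")
      case True
      then have "p \<in> (case 0 of 0 \<Rightarrow> N \<times> UNIV | Suc k \<Rightarrow> A (Z k) k)" using fiber p(1) by auto
      then show ?thesis by blast
    next
      case False
      then obtain k where "x \<in> Z k" "(y, a) \<in> V k" using p(2) by (auto simp: D_def)
      then have "p \<in> A (Z k) k" unfolding A_def p(1) using p(2) by force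
      then have "p \<in> (case Suc k of 0 \<Rightarrow> N \<times> UNIV | Suc k \<Rightarrow> A (Z k) k)" by simp
      then show ?thesis by blast
    qed
  qed
  moreover have "ae_graph_covered M (N \<times> (UNIV :: 'b set))" using N(1) by (intro ae_graph_covered_null) auto
  ultimately show ?thesis
    by (elim ae_graph_covered_subset[rotated]) (auto intro!: ae_graph_covered_UN Z(2) split: nat.splits)
qed

subsection \<open>Standard Borel spaces\<close>

lemma sigma_sets_preimage:
  assumes A: "A \<in> sigma_sets \<Omega> G" and h: "h \<in> \<Omega> \<rightarrow> space N"
    and G: "\<And>a. a \<in> G \<Longrightarrow> \<exists>B\<in>sets N. a = h -` B \<inter> \<Omega>"
  shows "\<exists>B\<in>sets N. A = h -` B \<inter> \<Omega>"
  using A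
proof (induction A rule: sigma_sets.induct)
  case (Basic a) then show ?case by (rule G)
next
  case Empty then show ?case by (intro bexI[of _ "{}"]) auto
next
  case (Compl a)
  then obtain B where "B \<in> sets N" "a = h -` B \<inter> \<Omega>" by blast
  then show ?case using h by (intro bexI[of _ "space N - B"]) auto
next
  case (Union a)
  then obtain B where "\<And>i. B i \<in> sets N" "\<And>i. a i = h -` B i \<inter> \<Omega>" by metis
  then show ?case by (intro bexI[of _ "\<Union>i. B i"]) auto
qed

text \<open>A point is sent to its distances from a dense sequence \<open>q\<close>. A limit of
  image points lies in the image exactly when it has arbitrarily small coordinates, so the image is
  the intersection of its closure with countably many open sets.\<close>

lemma standard_borel_embedding:
  fixes X :: "'x measure"
  assumes "standard_borel X"
  shows "\<exists>e :: 'x \<Rightarrow> nat \<Rightarrow> real. inj_on e (space X) \<and> e \<in> borel_measurable X \<and>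
     e ` space X \<in> sets borel \<and> (\<forall>A\<in>sets X. \<exists>B\<in>sets borel. A = e -` B \<inter> space X)"
proof (cases "space X = {}")
  case True
  have "A = {}" if "A \<in> sets X" for A using sets.sets_into_space[OF that] True by simp
  then have "\<forall>A\<in>sets X. \<exists>B\<in>sets borel. A = (\<lambda>_ _. 0) -` B \<inter> space X"
    using True by (intro ballI bexI[of _ "{}"]) auto
  then show ?thesis by (intro exI[of _ "\<lambda>_ _. 0"]) (simp add: True)
next
  case False
  obtain T where T: "completely_metrizable_space T" "separable_space T" "topspace T = space X"
    "sets X = sigma_sets (space X) {U. openin T U}"
    using assms unfolding standard_borel_def by blast
  obtain M d where Md: "Metric_space M d" "Metric_space.mcomplete M d" "T = Metric_space.mtopology M d"
    using T(1) unfolding completely_metrizable_space_def by blast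
  interpret Metric_space M d by fact
  have MX: "M = space X" using T(3) Md(3) by simp
  obtain C where C: "countable C" "C \<subseteq> M" "mtopology closure_of C = M"
    using T(2) unfolding separable_space_def Md(3) by auto
  have "C \<noteq> {}" using C(3) False MX by auto
  define q where "q = from_nat_into C"
  have rq: "range q = C" using C(1) \<open>C \<noteq> {}\<close> by (simp add: q_def)
  have qM: "q n \<in> M" for n using rq C(2) by auto
  have dense: "\<exists>n. d x (q n) < r" if xr: "x \<in> M" "r > 0" for x r
  proof -
    have "x \<in> mtopology closure_of C" using C(3) xr by simp
    then obtain y where "y \<in> C" "y \<in> mball x r" using xr(2) unfolding metric_closure_of by blast
    then show ?thesis using rq by auto
  qed
  define e where "e x n = d x (q n)" for x n
  have inj: "inj_on e M"
  proof (rule inj_onI)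
    fix x y assume xy: "x \<in> M" "y \<in> M" "e x = e y"
    show "x = y"
    proof (rule ccontr)
      assume "x \<noteq> y"
      then have "d x y / 2 > 0" using xy by simp
      then obtain n where n: "d x (q n) < d x y / 2" using dense[OF xy(1)] by blast
      have "d x (q n) = d y (q n)" using fun_cong[OF xy(3), of n] by (simp add: e_def)
      then show False using n triangle[OF xy(1) qM[of n] xy(2)] commute[of y "q n"] by simp
    qed
  qed
  have sets_open: "U \<in> sets X" if "openin mtopology U" for U
    using that T(4) Md(3) by (auto intro: sigma_sets.Basic)
  have ball_eq: "{x \<in> M. d x (q n) < a} = mball (q n) a" for n a
    using qM by (auto simp: commute)
  have open_pre: "\<exists>B. open B \<and> U = e -` B \<inter> M" if U: "openin mtopology U" for U
  proof -
    \<comment> \<open>Each ball around \<open>q n\<close> is the preimage of a half space in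
      coordinate \<open>n\<close>, and \<open>U\<close> is the union of the balls of radius
      \<open>1 / (k + 1)\<close> inside it.\<close>
    let ?S = "{(n, k). mball (q n) (1 / real (Suc k)) \<subseteq> U}"
    let ?B = "\<Union>p\<in>?S. {y. y (fst p) < 1 / real (Suc (snd p))}"
    have "open ?B"
    proof (intro open_UN ballI open_Collect_less continuous_on_const)
      fix p :: "nat \<times> nat"
      show "continuous_on UNIV (\<lambda>y :: nat \<Rightarrow> real. y (fst p))" by (rule continuous_on_product_coordinates)
    qed
    moreover have "U = e -` ?B \<inter> M"
    proof
      show "e -` ?B \<inter> M \<subseteq> U"
      proof
        fix x assume x: "x \<in> e -` ?B \<inter> M"
        then obtain n k where nk: "(n, k) \<in> ?S" "d x (q n) < 1 / real (Suc k)" by (auto simp: e_def)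
        then have "x \<in> mball (q n) (1 / real (Suc k))" unfolding ball_eq[symmetric] using x by simp
        then show "x \<in> U" using nk(1) by blast
      qed
      show "U \<subseteq> e -` ?B \<inter> M"
      proof
        fix x assume x: "x \<in> U"
        then have xM: "x \<in> M" using openin_subset[OF U] by auto
        obtain r where r: "r > 0" "mball x r \<subseteq> U" using U x unfolding openin_mtopology by blast
        obtain k where k: "1 / real (Suc k) < r / 2" using nat_approx_posE[of "r / 2"] r(1) by auto
        obtain n where n: "d x (q n) < 1 / real (Suc k)" using dense[OF xM, of "1 / real (Suc k)"] by auto
        have "mball (q n) (1 / real (Suc k)) \<subseteq> mball x r"
        proof
          fix z assume z: "z \<in> mball (q n) (1 / real (Suc k))"
          then have "d x z \<le> d x (q n) + d (q n) z" using triangle[OF xM qM[of n]] by simp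
          then show "z \<in> mball x r" using z n k xM by auto
        qed
        then have "(n, k) \<in> ?S" using r(2) by auto
        then show "x \<in> e -` ?B \<inter> M" using n xM by (force simp: e_def)
      qed
    qed
    ultimately show ?thesis by blast
  qed
  have meas: "e \<in> borel_measurable X"
  proof (rule measurable_coordinatewise_then_product)
    fix n
    have "{x \<in> space X. e x n < a} \<in> sets X" for a
      using sets_open[OF openin_mball, of "q n" a] ball_eq[of n a] by (simp add: e_def MX)
    then show "(\<lambda>x. e x n) \<in> borel_measurable X" by (rule borel_measurableI_less)
  qed
  have img: "e ` M = closure (e ` M) \<inter> (\<Inter>m. \<Union>n. {y. y n < 1 / real (Suc m)})"
  proof
    show "e ` M \<subseteq> closure (e ` M) \<inter> (\<Inter>m. \<Union>n. {y. y n < 1 / real (Suc m)})"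
      using closure_subset[of "e ` M"] dense by (auto simp: e_def)
    show "closure (e ` M) \<inter> (\<Inter>m. \<Union>n. {y. y n < 1 / real (Suc m)}) \<subseteq> e ` M"
    proof
      fix y assume y: "y \<in> closure (e ` M) \<inter> (\<Inter>m. \<Union>n. {y. y n < 1 / real (Suc m)})"
      then have yc: "y \<in> closure (e ` M)" and yb: "y \<in> (\<Inter>m. \<Union>n. {y. y n < 1 / real (Suc m)})"
        by (rule IntD1, rule IntD2)
      obtain u where "\<forall>k. u k \<in> e ` M" and u2: "u \<longlonglongrightarrow> y"
        using iffD1[OF closure_sequential yc] by (elim exE conjE)
      then have u: "\<And>k. u k \<in> e ` M" "u \<longlonglongrightarrow> y" by simp_all
      then have "\<exists>x. x \<in> M \<and> u k = e x" for k by blast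
      then obtain x where x: "\<And>k. x k \<in> M" "\<And>k. u k = e (x k)" by metis
      have "(\<lambda>k. u k n) \<longlonglongrightarrow> y n" for n
        using continuous_on_tendsto_compose[OF continuous_on_product_coordinates[where i = n] u(2)] by simp
      then have lim: "(\<lambda>k. d (x k) (q n)) \<longlonglongrightarrow> y n" for n by (simp add: x(2) e_def)
      \<comment> \<open>A small coordinate \<open>y n\<close> puts all but finitely many
        \<open>x k\<close> into a small ball around \<open>q n\<close>, hence close to each
        other.\<close>
      have "MCauchy x" unfolding MCauchy_def
      proof (intro conjI allI impI)
        show "range x \<subseteq> M" using x(1) by auto
        fix r :: real assume "r > 0"
        then obtain m where m: "1 / real (Suc m) < r / 2" using nat_approx_posE[of "r / 2"] by auto
        have "y \<in> (\<Union>n. {y. y n < 1 / real (Suc m)})" using yb by (rule INT_D) simp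
        then obtain n where n: "y n < 1 / real (Suc m)" by auto
        then have "\<forall>\<^sub>F k in sequentially. d (x k) (q n) < 1 / real (Suc m)"
          using order_tendstoD(2)[OF lim] by blast
        then obtain N where N: "\<And>k. k \<ge> N \<Longrightarrow> d (x k) (q n) < 1 / real (Suc m)"
          unfolding eventually_sequentially by blast
        have "d (x k) (x l) < r" if "N \<le> k" "N \<le> l" for k l
          using triangle[OF x(1)[of k] qM[of n] x(1)[of l]] commute[of "x l" "q n"] N[OF that(1)] N[OF that(2)] m by linarith
        then show "\<exists>N. \<forall>n n'. N \<le> n \<longrightarrow> N \<le> n' \<longrightarrow> d (x n) (x n') < r" by blast
      qed
      then obtain z where z: "limitin mtopology x z sequentially" using Md(2) unfolding mcomplete_def by blast
      then have zM: "z \<in> M" and dz: "(\<lambda>k. d (x k) z) \<longlonglongrightarrow> 0"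
        unfolding limitin_metric_dist_null by (auto dest: limitin_mspace)
      have "y n = d z (q n)" for n
      proof -
        have "(\<lambda>k. d (x k) (q n) - d z (q n)) \<longlonglongrightarrow> 0"
        proof (rule Lim_null_comparison[OF _ dz], intro always_eventually allI)
          fix k show "norm (d (x k) (q n) - d z (q n)) \<le> d (x k) z"
            using triangle[OF x(1)[of k] zM qM[of n]] triangle[OF zM x(1)[of k] qM[of n]] commute[of z "x k"]
            by (simp add: abs_le_iff)
        qed
        then have "(\<lambda>k. d (x k) (q n)) \<longlonglongrightarrow> d z (q n)" using Lim_null by blast
        then show ?thesis using lim LIMSEQ_unique by blast
      qed
      then have "y = e z" by (simp add: e_def fun_eq_iff)
      then show "y \<in> e ` M" using zM by blast
    qed
  qed
  have opn: "open {y :: nat \<Rightarrow> real. y n < a}" for n a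
    by (intro open_Collect_less continuous_on_const continuous_on_product_coordinates)
  have "closure (e ` M) \<inter> (\<Inter>m. \<Union>n. {y. y n < 1 / real (Suc m)}) \<in> sets borel"
    using opn by (intro sets.Int sets.countable_INT'' borel_closed borel_open open_UN closed_closure) auto
  then have img_borel: "e ` M \<in> sets borel" by (subst img)
  have "\<exists>B\<in>sets borel. A = e -` B \<inter> space X" if "A \<in> sets X" for A
  proof (rule sigma_sets_preimage)
    show "A \<in> sigma_sets (space X) {U. openin T U}" using that T(4) by simp
    fix U assume "U \<in> {U. openin T U}"
    then show "\<exists>B\<in>sets borel. U = e -` B \<inter> space X" using open_pre[of U] Md(3) MX borel_open by blast
  qed simp
  then show ?thesis using inj meas img_borel MX by blast
qed

text \<open>Points of \<open>Y\<close> are equal iff their countably many real coordinates under the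
  embedding are.\<close>

lemma pred_eq_standard_borel:
  fixes Y :: "'a measure" and M :: "'b measure"
  assumes Y: "standard_borel Y" and f: "f \<in> measurable M Y" and g: "g \<in> measurable M Y"
  shows "{x \<in> space M. f x = g x} \<in> sets M"
proof -
  obtain e :: "'a \<Rightarrow> nat \<Rightarrow> real" where e: "inj_on e (space Y)" "e \<in> borel_measurable Y"
    using standard_borel_embedding[OF Y] by blast
  have m: "(\<lambda>x. e (h x) n) \<in> borel_measurable M" if "h \<in> measurable M Y" for h n
  proof -
    have "(\<lambda>y. y n) \<in> borel_measurable (borel :: (nat \<Rightarrow> real) measure)"
      by (intro borel_measurable_continuous_onI continuous_on_product_coordinates)
    from measurable_compose[OF measurable_compose[OF that e(2)] this] show ?thesis .
  qed
  have "f x = g x \<longleftrightarrow> (\<forall>n. e (f x) n = e (g x) n)" if "x \<in> space M" for x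
    using inj_onD[OF e(1)] measurable_space[OF f that] measurable_space[OF g that] by (auto simp flip: fun_eq_iff)
  then have "{x \<in> space M. f x = g x} = {x \<in> space M. \<forall>n. e (f x) n = e (g x) n}" by blast
  also have "\<dots> \<in> sets M"
    using m[OF f] m[OF g] by (intro sets.sets_Collect_countable_All borel_measurable_eq) auto
  finally show ?thesis .
qed

lemma standard_borel_embedding_inverse:
  assumes inj: "inj_on e (space X)" and img: "e ` space X \<in> sets N"
    and pre: "\<And>A. A \<in> sets X \<Longrightarrow> \<exists>B\<in>sets N. A = e -` B \<inter> space X"
  shows "inv_into (space X) e \<in> measurable (restrict_space N (e ` space X)) X"
proof (rule measurableI)
  have sp: "space (restrict_space N (e ` space X)) = e ` space X"
    using img by (rule space_restrict_space2)
  show "inv_into (space X) e y \<in> space X" if "y \<in> space (restrict_space N (e ` space X))" for y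
    using that unfolding sp by (rule inv_into_into)
  fix A assume A: "A \<in> sets X"
  then obtain B where B: "B \<in> sets N" "A = e -` B \<inter> space X" using pre by blast
  have "inv_into (space X) e -` A \<inter> e ` space X = B \<inter> e ` space X"
    using inj unfolding B(2) by (auto simp: inv_into_f_f)
  then show "inv_into (space X) e -` A \<inter> space (restrict_space N (e ` space X)) \<in> sets (restrict_space N (e ` space X))"
    unfolding sp using B(1) img by (auto simp: sets_restrict_space)
qed

text \<open>The relation is carried into the real sequences by the embedding \<open>e\<close> and
  covered there for the image measure; the covering functions are then pulled back.\<close>

theorem ae_covered_by_functions_countable_sections:
  fixes M :: "'x measure"
  assumes std: "standard_borel M" and fin: "finite_measure M" and R: "R \<in> sets (M \<Otimes>\<^sub>M M)"
    and cnt: "\<And>x. x \<in> space M \<Longrightarrow> countable (R `` {x})"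
  shows "\<exists>f :: nat \<Rightarrow> 'x \<Rightarrow> 'x. \<exists>N\<in>null_sets M. (\<forall>n. f n \<in> measurable M M) \<and>
     (\<forall>x y. (x, y) \<in> R \<longrightarrow> x \<notin> N \<longrightarrow> (\<exists>n. y = f n x))"
proof -
  interpret finite_measure M by fact
  obtain e :: "'x \<Rightarrow> nat \<Rightarrow> real" where "inj_on e (space M) \<and> e \<in> borel_measurable M \<and>
     e ` space M \<in> sets borel \<and> (\<forall>A\<in>sets M. \<exists>B\<in>sets borel. A = e -` B \<inter> space M)"
    using standard_borel_embedding[OF std] ..
  then have e: "inj_on e (space M)" "e \<in> borel_measurable M" "e ` space M \<in> sets borel"
    "\<And>A. A \<in> sets M \<Longrightarrow> \<exists>B\<in>sets borel. A = e -` B \<inter> space M" by simp_all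
  let ?g = "inv_into (space M) e"
  let ?h = "\<lambda>p. (e (fst p), e (snd p))"
  have Rsub: "R \<subseteq> space M \<times> space M" using sets.sets_into_space[OF R] by (simp add: space_pair_measure)
  have "\<exists>B\<in>sets (borel :: ((nat \<Rightarrow> real) \<times> (nat \<Rightarrow> real)) measure). R = ?h -` B \<inter> (space M \<times> space M)"
  proof (rule sigma_sets_preimage)
    show "R \<in> sigma_sets (space M \<times> space M) {a \<times> b |a b. a \<in> sets M \<and> b \<in> sets M}"
      using R by (simp add: sets_pair_measure)
    fix c assume "c \<in> {a \<times> b |a b. a \<in> sets M \<and> b \<in> sets M}"
    then obtain a b where c: "c = a \<times> b" "a \<in> sets M" "b \<in> sets M" by auto
    from e(4)[OF c(2)] obtain A where A: "A \<in> sets borel" "a = e -` A \<inter> space M" ..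
    from e(4)[OF c(3)] obtain B where B: "B \<in> sets borel" "b = e -` B \<inter> space M" ..
    have "c = ?h -` (A \<times> B) \<inter> (space M \<times> space M)" unfolding c(1) A(2) B(2) by auto
    moreover have "A \<times> B \<in> sets borel" using A(1) B(1) by (rule borel_Times)
    ultimately show "\<exists>B\<in>sets borel. c = ?h -` B \<inter> (space M \<times> space M)" by blast
  qed simp
  then obtain R1 :: "((nat \<Rightarrow> real) \<times> (nat \<Rightarrow> real)) set"
    where R1: "R1 \<in> sets borel" "R = ?h -` R1 \<inter> (space M \<times> space M)" ..
  \<comment> \<open>\<open>R1\<close> is arbitrary outside the image of \<open>e\<close>; cutting it
    down to the image keeps the sections countable.\<close>
  define R' where "R' = R1 \<inter> (e ` space M \<times> e ` space M)"
  have R'_borel: "R' \<in> sets borel" unfolding R'_def using R1(1) borel_Times[OF e(3) e(3)] by (rule sets.Int)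
  have "countable {y. (x, y) \<in> R'}" for x
  proof (cases "x \<in> e ` space M")
    case True
    then obtain x0 where x0: "x0 \<in> space M" "x = e x0" by auto
    have "{y. (x, y) \<in> R'} \<subseteq> e ` (R `` {x0})"
      unfolding R'_def R1(2) using x0 by auto
    then show ?thesis by (rule countable_subset[OF _ countable_image[OF cnt[OF x0(1)]]])
  next
    case False
    then have "{y. (x, y) \<in> R'} = {}" unfolding R'_def by auto
    then show ?thesis by simp
  qed
  then have "ae_graph_covered (distr M borel e) R'"
    by (intro ae_graph_covered_countable_sections finite_measure_distr e(2) R'_borel) simp
  then obtain f :: "nat \<Rightarrow> (nat \<Rightarrow> real) \<Rightarrow> (nat \<Rightarrow> real)" and N
    where N: "N \<in> null_sets (distr M borel e)" and f: "\<And>n. f n \<in> borel_measurable borel"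
      and cov: "\<And>x y. (x, y) \<in> R' \<Longrightarrow> x \<notin> N \<Longrightarrow> \<exists>n. y = f n x"
    unfolding ae_graph_covered_def by auto
  \<comment> \<open>Where the value misses the image, \<open>x\<close> itself is the default, which
    keeps the function inside \<open>space M\<close>.\<close>
  let ?f = "\<lambda>n x. if f n (e x) \<in> e ` space M then ?g (f n (e x)) else x"
  show ?thesis
  proof (intro exI[of _ ?f] bexI[of _ "e -` N \<inter> space M"] conjI allI impI)
    show "e -` N \<inter> space M \<in> null_sets M" using N e(2) by (simp add: null_sets_distr_iff)
    fix n
    have fe: "(\<lambda>x. f n (e x)) \<in> borel_measurable M" using e(2) f by (rule measurable_compose)
    show "?f n \<in> measurable M M"
    proof (rule measurableI)
      fix x assume "x \<in> space M" then show "?f n x \<in> space M" using inv_into_into[of _ e "space M"] by auto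
    next
      fix A assume A: "A \<in> sets M"
      obtain B where B: "B \<in> sets borel" "A = e -` B \<inter> space M" using e(4)[OF A] ..
      have "?f n -` A \<inter> space M = ((\<lambda>x. f n (e x)) -` (e ` space M \<inter> B) \<inter> space M) \<union>
          (((\<lambda>x. f n (e x)) -` (- (e ` space M)) \<inter> space M) \<inter> A)"
      proof -
        have "?f n x \<in> A \<longleftrightarrow> f n (e x) \<in> e ` space M \<inter> B \<or> f n (e x) \<in> - (e ` space M) \<and> x \<in> A"
          if "x \<in> space M" for x
        proof (cases "f n (e x) \<in> e ` space M")
          case True
          then obtain z where z: "z \<in> space M" "f n (e x) = e z" by auto
          then show ?thesis using e(1) by (simp add: inv_into_f_f B(2))
        qed simp
        then show ?thesis by auto
      qed
      also have "\<dots> \<in> sets M"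
        using B(1) e(3) A by (intro sets.Un sets.Int[OF _ A] measurable_sets[OF fe] sets.Int borel_comp) auto
      finally show "?f n -` A \<inter> space M \<in> sets M" .
    qed
  next
    fix x y assume xy: "(x, y) \<in> R" "x \<notin> e -` N \<inter> space M"
    then have sp: "x \<in> space M" "y \<in> space M" using Rsub by auto
    have "(e x, e y) \<in> R'" using xy(1) sp unfolding R'_def R1(2) by auto
    moreover have "e x \<notin> N" using xy(2) sp by auto
    ultimately obtain n where "e y = f n (e x)" using cov by blast
    then have "?f n x = y" using sp e(1) by (metis imageI inv_into_f_f)
    then show "\<exists>n. y = ?f n x" by metis
  qed
qed

section \<open>Inner regularity, and an injection of real sequences into the reals\<close>

lemma inner_regular_measure:
  fixes M :: "'a::{second_countable_topology, complete_space} measure"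
  assumes sb: "sets M = sets borel" and fin: "finite_measure M" and B: "B \<in> sets borel" and e: "e > 0"
  shows "\<exists>K. compact K \<and> K \<subseteq> B \<and> measure M (B - K) < e"
proof -
  interpret finite_measure M by fact
  have BM: "B \<in> sets M" using B sb by simp
  have KM: "K \<in> sets M" if "compact K" for K using that sb by (simp add: borel_closed compact_imp_closed)
  have "\<exists>K. compact K \<and> K \<subseteq> B \<and> measure M B - e < measure M K"
  proof (rule ccontr)
    assume "\<not> ?thesis"
    then have le: "measure M K \<le> measure M B - e" if "compact K" "K \<subseteq> B" for K using that by (meson not_le)
    have nn: "0 \<le> measure M B - e" using le[of "{}"] by simp
    have "emeasure M B = (SUP K \<in> {K. K \<subseteq> B \<and> compact K}. emeasure M K)"
      by (rule inner_regular[OF sb _ B]) simp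
    also have "\<dots> \<le> ennreal (measure M B - e)"
      using le by (intro SUP_least) (auto simp: emeasure_eq_measure intro!: ennreal_leI)
    finally have "measure M B \<le> measure M B - e" using nn by (simp add: emeasure_eq_measure)
    then show False using e by simp
  qed
  then obtain K where K: "compact K" "K \<subseteq> B" "measure M B - e < measure M K" by blast
  then have "measure M (B - K) < e" using finite_measure_Diff[OF BM KM[OF K(1)] K(2)] by simp
  then show ?thesis using K by blast
qed

text \<open>A sequence \<open>y\<close> is determined by the pairs \<open>(n, q)\<close> with
  \<open>q\<close> rational and \<open>q < y n\<close>, hence by a set of naturals. The injection
  will carry spaces to the type for which rigidity is assumed.\<close>

lemma exists_inj_nat_to_real: "\<exists>j :: (nat \<Rightarrow> real) \<Rightarrow> real. inj j"
proof -
  let ?c = "\<lambda>y :: nat \<Rightarrow> real. {prod_encode (n, to_nat q) | n q. real_of_rat q < y n}"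
  have "inj ?c"
  proof (rule injI, rule ext, rule ccontr)
    have mem: "prod_encode (n, to_nat q) \<in> ?c y \<longleftrightarrow> real_of_rat q < y n" for n q y by auto
    fix y z n assume eq: "?c y = ?c z" and ne: "y n \<noteq> z n"
    have iff: "real_of_rat q < y n \<longleftrightarrow> real_of_rat q < z n" for q using mem[of n q y] mem[of n q z] eq by simp
    from ne consider "y n < z n" | "z n < y n" by linarith
    then show False
      by cases (metis iff of_rat_dense order_less_irrefl order_less_trans)+
  qed
  moreover obtain k :: "nat set \<Rightarrow> real" where "inj k"
    using eqpoll_imp_lepoll[OF nat_sets_eqpoll_reals] unfolding lepoll_def by blast
  ultimately have "inj (k \<circ> ?c)" by (intro inj_compose)
  then show ?thesis by blast
qed

subsection \<open>Hyperfinite equivalence relations\<close>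

lemma sets_pair_restrict_space:
  assumes A: "A \<in> sets M"
  shows "R \<in> sets (restrict_space M A \<Otimes>\<^sub>M restrict_space M A) \<longleftrightarrow> R \<subseteq> A \<times> A \<and> R \<in> sets (M \<Otimes>\<^sub>M M)"
proof
  have sp: "space (restrict_space M A) = A" using A by simp
  have AA: "A \<times> A \<in> sets (M \<Otimes>\<^sub>M M)" using A by simp
  assume R: "R \<in> sets (restrict_space M A \<Otimes>\<^sub>M restrict_space M A)"
  then have "R \<subseteq> A \<times> A" using sets.sets_into_space[OF R] by (simp add: space_pair_measure sp)
  moreover have "R \<in> sigma_sets (A \<times> A) {a \<times> b |a b. a \<in> sets (restrict_space M A) \<and> b \<in> sets (restrict_space M A)}"
    using R by (simp add: sets_pair_measure sp)
  then have "R \<in> sets (M \<Otimes>\<^sub>M M)"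
  proof (induction R rule: sigma_sets.induct)
    case (Basic c)
    then show ?case using A by (auto simp: sets_restrict_space_iff)
  next
    case (Compl c) then show ?case using AA by (simp add: sets.Diff)
  next
    case (Union c) then show ?case by (intro sets.countable_UN) auto
  qed simp
  ultimately show "R \<subseteq> A \<times> A \<and> R \<in> sets (M \<Otimes>\<^sub>M M)" ..
next
  assume R: "R \<subseteq> A \<times> A \<and> R \<in> sets (M \<Otimes>\<^sub>M M)"
  have "(\<lambda>x. x) \<in> measurable (restrict_space M A) M" by (intro measurable_restrict_space1) simp
  then have "(\<lambda>p. (fst p, snd p)) \<in> measurable (restrict_space M A \<Otimes>\<^sub>M restrict_space M A) (M \<Otimes>\<^sub>M M)"
    by (intro measurable_Pair measurable_compose[OF measurable_fst] measurable_compose[OF measurable_snd])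
  then have "(\<lambda>p. p) -` R \<inter> space (restrict_space M A \<Otimes>\<^sub>M restrict_space M A) \<in> sets (restrict_space M A \<Otimes>\<^sub>M restrict_space M A)"
    using R by (intro measurable_sets[where A = "M \<Otimes>\<^sub>M M"]) auto
  moreover have "(\<lambda>p. p) -` R \<inter> space (restrict_space M A \<Otimes>\<^sub>M restrict_space M A) = R"
    using R A by (auto simp: space_pair_measure)
  ultimately show "R \<in> sets (restrict_space M A \<Otimes>\<^sub>M restrict_space M A)" by simp
qed

text \<open>Being an equivalence relation passes to increasing unions, so only the finite relations
  have to be checked, with measurability stated in the ambient product.\<close>

lemma hyperfinite_restrict_space_iff:
  assumes A: "A \<in> sets M"
  shows "hyperfinite (restrict_space M A) R \<longleftrightarrow>
    (\<exists>S :: nat \<Rightarrow> _ rel. (\<forall>n. equiv A (S n) \<and> S n \<in> sets (M \<Otimes>\<^sub>M M) \<and> (\<forall>x\<in>A. finite (S n `` {x}))) \<and>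
       incseq S \<and> R = (\<Union>n. S n))" (is "_ \<longleftrightarrow> ?r")
proof
  have sp: "space (restrict_space M A) = A" using A by simp
  show ?r if "hyperfinite (restrict_space M A) R"
    using that unfolding hyperfinite_def finite_borel_equiv_def borel_equiv_def sp sets_pair_restrict_space[OF A] by auto
  assume ?r
  then obtain S :: "nat \<Rightarrow> _ rel" where S: "\<And>n. equiv A (S n)" "\<And>n. S n \<in> sets (M \<Otimes>\<^sub>M M)"
     "\<And>n x. x \<in> A \<Longrightarrow> finite (S n `` {x})" "incseq S" "R = (\<Union>n. S n)" by auto
  have sub: "S n \<subseteq> A \<times> A" for n using S(1)[of n] by (rule equiv_type)
  have "equiv A R"
  proof (rule equivI)
    show "R \<subseteq> A \<times> A" unfolding S(5) using sub by blast
    show "refl_on A R"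
      unfolding refl_on_def S(5) using S(1)[of 0] by (auto simp: equiv_def refl_on_def)
    show "sym R" unfolding S(5) using S(1) by (auto simp: equiv_def sym_def)
    show "trans R"
    proof (rule transI)
      fix x y z assume "(x, y) \<in> R" "(y, z) \<in> R"
      then obtain m n where mn: "(x, y) \<in> S m" "(y, z) \<in> S n" unfolding S(5) by auto
      have "S m \<subseteq> S (max m n)" "S n \<subseteq> S (max m n)" using incseqD[OF S(4)] by auto
      then have "(x, y) \<in> S (max m n)" "(y, z) \<in> S (max m n)" using mn by auto
      moreover have "trans (S (max m n))" using S(1)[of "max m n"] by (simp add: equiv_def)
      ultimately have "(x, z) \<in> S (max m n)" by (meson transD)
      then show "(x, z) \<in> R" unfolding S(5) by auto
    qed
  qed
  moreover have "R \<in> sets (M \<Otimes>\<^sub>M M)" unfolding S(5) using S(2) by auto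
  moreover have "R \<subseteq> A \<times> A" unfolding S(5) using sub by auto
  moreover have "\<forall>n. finite_borel_equiv (restrict_space M A) (S n)"
    unfolding finite_borel_equiv_def borel_equiv_def sp sets_pair_restrict_space[OF A] using S(1-3) sub by auto
  ultimately show "hyperfinite (restrict_space M A) R"
    unfolding hyperfinite_def borel_equiv_def sp sets_pair_restrict_space[OF A] using S(4,5) by auto
qed

section \<open>Pullbacks of hyperfinite relations along injective maps\<close>

definition pullback_rel :: "'a set \<Rightarrow> ('a \<Rightarrow> 'b) \<Rightarrow> 'b rel \<Rightarrow> 'a rel" where
  "pullback_rel A h E = {(x, y). x \<in> A \<and> y \<in> A \<and> (h x, h y) \<in> E}"

lemma borel_equiv_pullback:
  assumes h: "h \<in> measurable N M" and E: "borel_equiv M E"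
  shows "borel_equiv N (pullback_rel (space N) h E)"
proof -
  have eq: "equiv (space M) E" and sets: "E \<in> sets (M \<Otimes>\<^sub>M M)" using E by (auto simp: borel_equiv_def)
  have "equiv (space N) (pullback_rel (space N) h E)"
  proof (rule equivI)
    show "pullback_rel (space N) h E \<subseteq> space N \<times> space N" by (auto simp: pullback_rel_def)
    show "refl_on (space N) (pullback_rel (space N) h E)"
      using eq measurable_space[OF h] by (auto simp: equiv_def refl_on_def pullback_rel_def)
    show "sym (pullback_rel (space N) h E)"
      using eq by (auto simp: equiv_def sym_def pullback_rel_def)
    show "trans (pullback_rel (space N) h E)"
      using eq unfolding equiv_def trans_def pullback_rel_def by blast
  qed
  moreover have "(\<lambda>p. (h (fst p), h (snd p))) \<in> measurable (N \<Otimes>\<^sub>M N) (M \<Otimes>\<^sub>M M)"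
    using h by simp
  from measurable_sets[OF this sets] have "pullback_rel (space N) h E \<in> sets (N \<Otimes>\<^sub>M N)"
    by (rule back_subst[of "\<lambda>S. S \<in> sets (N \<Otimes>\<^sub>M N)"]) (auto simp: pullback_rel_def space_pair_measure)
  ultimately show ?thesis by (simp add: borel_equiv_def)
qed

lemma pullback_rel_Image_subset: "x \<in> A \<Longrightarrow> h ` (pullback_rel A h E `` {x}) \<subseteq> E `` {h x}"
  by (auto simp: pullback_rel_def)

lemma hyperfinite_pullback:
  assumes h: "h \<in> measurable N M" and inj: "inj_on h (space N)" and E: "hyperfinite M E"
  shows "hyperfinite N (pullback_rel (space N) h E)"
proof -
  obtain S :: "nat \<Rightarrow> 'b rel" where S: "\<And>n. finite_borel_equiv M (S n)" "incseq S" "E = (\<Union>n. S n)"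
    using E by (auto simp: hyperfinite_def)
  let ?S = "\<lambda>n. pullback_rel (space N) h (S n)"
  have "finite_borel_equiv N (?S n)" for n
  proof -
    have "finite (?S n `` {x})" if x: "x \<in> space N" for x
    proof (rule finite_imageD)
      have "finite (S n `` {h x})" using S(1)[of n] measurable_space[OF h x] by (auto simp: finite_borel_equiv_def)
      then show "finite (h ` (?S n `` {x}))" using pullback_rel_Image_subset[OF x] by (rule finite_subset[rotated])
      show "inj_on h (?S n `` {x})" using inj by (rule inj_on_subset) (auto simp: pullback_rel_def)
    qed
    then show ?thesis using borel_equiv_pullback[OF h, of "S n"] S(1)[of n] by (auto simp: finite_borel_equiv_def)
  qed
  moreover have "incseq ?S" using S(2) by (auto simp: incseq_def pullback_rel_def)
  moreover have "pullback_rel (space N) h E = (\<Union>n. ?S n)" unfolding S(3) by (auto simp: pullback_rel_def)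
  moreover have "borel_equiv N (pullback_rel (space N) h E)"
    using E by (intro borel_equiv_pullback[OF h]) (simp add: hyperfinite_def)
  ultimately show ?thesis unfolding hyperfinite_def by (intro conjI exI[of _ ?S]) simp_all
qed

section \<open>Increasing unions of hyperfinite relations, up to a null set\<close>

lemma (in finite_measure) AE_eventually_notin_geometric:
  assumes "\<And>k. V k \<in> sets M" and le: "\<And>k. k \<ge> n \<Longrightarrow> measure M (V k) \<le> (1/2)^k"
  shows "AE x in M. \<forall>\<^sub>F k in sequentially. x \<notin> V k"
proof -
  have "AE x in M. \<forall>\<^sub>F k in sequentially. x \<in> space M - V k"
  proof (rule borel_cantelli_AE1)
    have le: "norm (measure M (V k)) \<le> (1/2)^k" if "k \<ge> n" for k using le[OF that] by simp
    have "summable (\<lambda>n. (1/2 :: real)^n)" by (rule summable_geometric) simp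
    from summable_comparison_test'[OF this le] show "summable (\<lambda>n. measure M (V n))" .
  qed (use assms(1) in \<open>auto simp: less_top[symmetric]\<close>)
  then show ?thesis by (rule AE_mp) (auto intro!: AE_I2 elim: eventually_mono)
qed

text \<open>From the exhaustion of each \<open>F n\<close> a stage \<open>T n\<close> is picked so
  late that, for each \<open>i \<le> n\<close>, the pairs \<open>(x, f i x)\<close> of
  \<open>F n\<close> missing from it occupy measure below \<open>(1/2)^n\<close>. By Borel-Cantelli,
  for almost every \<open>x\<close> each pair \<open>(x, f i x)\<close> in the union lies in
  \<open>T n\<close> from some \<open>n\<close> on. The \<open>T n\<close> need not increase; the
  intersections of their tails do, and inherit finite classes.\<close>

theorem (in finite_measure) hyperfinite_incseq_union_ae:
  fixes F :: "nat \<Rightarrow> 'a rel" and f :: "nat \<Rightarrow> 'a \<Rightarrow> 'a"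
  assumes D: "D \<in> sets M" and F: "\<And>n. hyperfinite (restrict_space M D) (F n)" "incseq F"
    and f: "\<And>i. f i \<in> measurable M M" and cov: "\<And>n x y. (x, y) \<in> F n \<Longrightarrow> \<exists>i. y = f i x"
  shows "\<exists>D'\<in>sets M. D' \<subseteq> D \<and> D - D' \<in> null_sets M \<and>
    hyperfinite (restrict_space M D') ((\<Union>n. F n) \<inter> (D' \<times> D'))"
proof -
  have "\<forall>n. \<exists>S :: nat \<Rightarrow> 'a rel. (\<forall>j. equiv D (S j) \<and> S j \<in> sets (M \<Otimes>\<^sub>M M) \<and> (\<forall>x\<in>D. finite (S j `` {x}))) \<and>
       incseq S \<and> F n = (\<Union>j. S j)"
    using F(1) unfolding hyperfinite_restrict_space_iff[OF D] by simp
  from choice[OF this] obtain S :: "nat \<Rightarrow> nat \<Rightarrow> 'a rel"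
    where "\<forall>n. (\<forall>j. equiv D (S n j) \<and> S n j \<in> sets (M \<Otimes>\<^sub>M M) \<and> (\<forall>x\<in>D. finite (S n j `` {x}))) \<and>
       incseq (S n) \<and> F n = (\<Union>j. S n j)" ..
  then have S: "\<And>n j. equiv D (S n j)" "\<And>n j. S n j \<in> sets (M \<Otimes>\<^sub>M M)" "\<And>n j x. x \<in> D \<Longrightarrow> finite (S n j `` {x})"
      "\<And>n. incseq (S n)" "\<And>n. F n = (\<Union>j. S n j)" by simp_all
  have F_sets: "F n \<in> sets (M \<Otimes>\<^sub>M M)" for n unfolding S(5) using S(2) by auto
  define W where "W R i = {x \<in> D. (x, f i x) \<in> R}" for R i
  have W_sets: "W R i \<in> sets M" if R: "R \<in> sets (M \<Otimes>\<^sub>M M)" for R i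
  proof -
    have "(\<lambda>x. (x, f i x)) \<in> measurable M (M \<Otimes>\<^sub>M M)" using f by simp
    from sets.Int[OF D measurable_sets[OF this R]] show ?thesis
      by (rule back_subst[of "\<lambda>S. S \<in> sets M"]) (use sets.sets_into_space[OF D] in \<open>auto simp: W_def\<close>)
  qed
  have "\<exists>j. \<forall>i\<le>n. measure M (W (F n - S n j) i) < (1/2)^n" for n
  proof -
    have "\<forall>\<^sub>F j in sequentially. measure M (W (F n - S n j) i) < (1/2)^n" for i
    proof -
      have "(\<lambda>j. measure M (W (F n - S n j) i)) \<longlonglongrightarrow> measure M (\<Inter>j. W (F n - S n j) i)"
      proof (rule finite_Lim_measure_decseq)
        show "range (\<lambda>j. W (F n - S n j) i) \<subseteq> sets M" using W_sets[OF sets.Diff[OF F_sets S(2)]] by auto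
        show "decseq (\<lambda>j. W (F n - S n j) i)"
          using incseqD[OF S(4)[of n]] by (intro decseq_SucI) (auto simp: W_def dest: subsetD[OF incseq_SucD[OF S(4)]])
      qed
      \<comment> \<open>Every pair of \<open>F n\<close> occurs in some stage \<open>S n j\<close>,
        so the failure sets shrink to the empty set.\<close>
      moreover have "(\<Inter>j. W (F n - S n j) i) = {}" unfolding W_def S(5) by auto
      ultimately have "(\<lambda>j. measure M (W (F n - S n j) i)) \<longlonglongrightarrow> 0" by simp
      then show ?thesis by (rule order_tendstoD(2)) simp
    qed
    then have "\<forall>\<^sub>F j in sequentially. \<forall>i\<in>{..n}. measure M (W (F n - S n j) i) < (1/2)^n"
      by (intro eventually_ball_finite) auto
    then show ?thesis unfolding eventually_sequentially by auto
  qed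
  then obtain t where t: "\<And>n i. i \<le> n \<Longrightarrow> measure M (W (F n - S n (t n)) i) < (1/2)^n" by metis
  define T where "T n = S n (t n)" for n
  define V where "V i n = W (F n - T n) i" for i n
  have V_sets: "V i n \<in> sets M" for i n unfolding V_def T_def by (intro W_sets sets.Diff F_sets S(2))
  have "measure M (V i n) \<le> (1/2)^n" if "n \<ge> i" for i n
    using t[OF that] by (simp add: V_def T_def)
  then have V_ae: "AE x in M. \<forall>\<^sub>F n in sequentially. x \<notin> V i n" for i
    using V_sets by (intro AE_eventually_notin_geometric)
  define D' where "D' = {x \<in> D. \<forall>i. \<exists>m. \<forall>n\<ge>m. x \<notin> V i n}"
  have D'_eq: "D' = D - (\<Union>i. \<Inter>m. \<Union>n\<in>{m..}. V i n)"
  proof -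
    have "x \<in> (\<Union>i. \<Inter>m. \<Union>n\<in>{m..}. V i n) \<longleftrightarrow> \<not> (\<forall>i. \<exists>m. \<forall>n\<ge>m. x \<notin> V i n)" for x
      by (simp add: Bex_def)
    then show ?thesis unfolding D'_def set_eq_iff Diff_iff mem_Collect_eq by simp
  qed
  have D': "D' \<in> sets M" unfolding D'_eq using D V_sets by auto
  have "AE x in M. \<forall>i. \<forall>\<^sub>F n in sequentially. x \<notin> V i n" using V_ae by (simp add: AE_all_countable)
  then have "AE x in M. x \<notin> D - D'"
    by (rule AE_mp) (auto simp: D'_def eventually_sequentially intro!: AE_I2)
  then have null: "D - D' \<in> null_sets M" using D D' by (simp add: AE_iff_null_sets)
  define S' where "S' m = (\<Inter>n\<in>{m..}. T n) \<inter> (D' \<times> D')" for m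
  have D'D: "D' \<subseteq> D" by (auto simp: D'_def)
  have T_equiv: "equiv D (T n)" for n using S(1) by (simp add: T_def)
  have "equiv D' (S' m)" for m
  proof (rule equivI)
    show "S' m \<subseteq> D' \<times> D'" by (auto simp: S'_def)
    show "refl_on D' (S' m)" unfolding refl_on_def S'_def
      using T_equiv D'D by (auto simp: equiv_def refl_on_def)
    show "sym (S' m)" unfolding S'_def using T_equiv by (auto simp: equiv_def sym_def)
    show "trans (S' m)"
    proof (rule transI)
      fix x y z assume *: "(x, y) \<in> S' m" "(y, z) \<in> S' m"
      have "(x, z) \<in> T n" if "n \<ge> m" for n
      proof -
        have "trans (T n)" using T_equiv by (simp add: equiv_def)
        then show ?thesis using * that unfolding S'_def by (auto intro: transD)
      qed
      then show "(x, z) \<in> S' m" using * by (auto simp: S'_def)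
    qed
  qed
  moreover have "S' m \<in> sets (M \<Otimes>\<^sub>M M)" for m
    unfolding S'_def T_def using S(2) D' by (intro sets.Int sets.countable_INT') auto
  moreover have "finite (S' m `` {x})" if "x \<in> D'" for m x
  proof (rule finite_subset)
    show "S' m `` {x} \<subseteq> T m `` {x}" by (auto simp: S'_def)
    show "finite (T m `` {x})" using that D'D S(3) by (auto simp: T_def)
  qed
  moreover have "incseq S'" by (rule incseq_SucI) (auto simp: S'_def)
  moreover have "(\<Union>n. F n) \<inter> (D' \<times> D') = (\<Union>n. S' n)"
  proof
    show "(\<Union>n. S' n) \<subseteq> (\<Union>n. F n) \<inter> (D' \<times> D')"
      unfolding S'_def T_def S(5) by auto
    show "(\<Union>n. F n) \<inter> (D' \<times> D') \<subseteq> (\<Union>n. S' n)"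
    proof
      fix p assume p: "p \<in> (\<Union>n. F n) \<inter> (D' \<times> D')"
      then obtain x y k where xy: "p = (x, y)" "(x, y) \<in> F k" "x \<in> D'" "y \<in> D'" by auto
      obtain i where i: "y = f i x" using cov[OF xy(2)] ..
      obtain m where m: "\<And>n. n \<ge> m \<Longrightarrow> x \<notin> V i n" using xy(3) by (auto simp: D'_def)
      have "(x, y) \<in> T n" if n: "n \<ge> max m k" for n
      proof -
        have "(x, y) \<in> F n" using incseqD[OF F(2), of k n] n xy(2) by auto
        moreover have "x \<notin> V i n" using m n by simp
        ultimately show ?thesis using xy(3) D'D i by (auto simp: V_def W_def)
      qed
      then have "p \<in> S' (max m k)" using xy by (auto simp: S'_def)
      then show "p \<in> (\<Union>n. S' n)" by auto
    qed
  qed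
  ultimately have "hyperfinite (restrict_space M D') ((\<Union>n. F n) \<inter> (D' \<times> D'))"
    unfolding hyperfinite_restrict_space_iff[OF D'] by (intro exI[of _ S'] conjI allI ballI) simp_all
  then show ?thesis using D' D'D null by auto
qed

subsection \<open>Projective rigidity on arbitrary standard Borel spaces\<close>

lemma second_countable_euclidean: "second_countable (euclidean :: 'a::second_countable_topology topology)"
proof -
  obtain V :: "nat \<Rightarrow> 'a set" where V: "\<And>n. open (V n)"
     "\<And>U w. open U \<Longrightarrow> w \<in> U \<Longrightarrow> \<exists>n. w \<in> V n \<and> V n \<subseteq> U"
    using countable_base_sequence by metis
  show ?thesis unfolding second_countable_def
  proof (intro exI[of _ "range V"] conjI allI impI ballI)
    fix U and x :: 'a assume "openin euclidean U \<and> x \<in> U"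
    then obtain n where "x \<in> V n" "V n \<subseteq> U" using V(2)[of U x] by auto
    then show "\<exists>V\<in>range V. x \<in> V \<and> V \<subseteq> U" by auto
  qed (use V(1) in auto)
qed

text \<open>\<open>j\<close> is merely injective, so the copy carries the topology and Borel sets
  transported from \<open>K\<close> instead of any structure of the target type.\<close>

lemma standard_borel_embed_closed:
  fixes K :: "'a::{complete_space, second_countable_topology} set" and j :: "'a \<Rightarrow> 'b"
  assumes K: "closed K" and j: "inj j"
  shows "standard_borel (embed_measure (restrict_space borel K) j)"
proof -
  let ?N = "restrict_space borel K" and ?X = "embed_measure (restrict_space borel K) j"
  let ?T = "pullback_topology (j ` K) (inv_into UNIV j) (top_of_set K)"
  have Kb: "K \<in> sets borel" using K by simp
  have spN: "space ?N = K" using Kb by simp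
  have spX: "space ?X = j ` K" by (simp add: space_embed_measure spN)
  have topT: "topspace ?T = j ` K" using j by (auto simp: topspace_pullback_topology)
  have openT: "openin ?T S \<longleftrightarrow> (\<exists>U. open U \<and> S = j ` (K \<inter> U))" for S
  proof -
    have eq: "inv_into UNIV j -` (K \<inter> U) \<inter> j ` K = j ` (K \<inter> U)" for U using j by auto
    have "openin ?T S \<longleftrightarrow> (\<exists>U. open U \<and> S = inv_into UNIV j -` (K \<inter> U) \<inter> j ` K)"
      unfolding openin_pullback_topology openin_open by auto
    then show ?thesis unfolding eq .
  qed
  have "homeomorphic_maps (top_of_set K) ?T j (inv_into UNIV j)"
    unfolding homeomorphic_maps_def
  proof (intro conjI ballI)
    show "continuous_map (top_of_set K) ?T j" unfolding continuous_map_alt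
    proof (intro conjI allI impI)
      fix S assume "openin ?T S"
      then obtain U where U: "open U" "S = j ` (K \<inter> U)" unfolding openT by auto
      have "j -` S \<inter> topspace (top_of_set K) = K \<inter> U" using j unfolding U(2) by (auto dest: injD)
      then show "openin (top_of_set K) (j -` S \<inter> topspace (top_of_set K))" using U(1) by (auto simp: openin_open)
    qed (auto simp: topT)
    show "continuous_map ?T (top_of_set K) (inv_into UNIV j)" unfolding continuous_map_alt
    proof (intro conjI allI impI)
      fix U assume U: "openin (top_of_set K) U"
      then show "openin ?T (inv_into UNIV j -` U \<inter> topspace ?T)" unfolding topT openin_pullback_topology by auto
    qed (use j in \<open>auto simp: topT\<close>)
  qed (use j topT in auto)
  then have hom: "top_of_set K homeomorphic_space ?T" unfolding homeomorphic_space_def by auto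
  have "completely_metrizable_space (top_of_set K)"
    using K by (intro completely_metrizable_space_closedin completely_metrizable_space_euclidean) simp
  then have 1: "completely_metrizable_space ?T" using homeomorphic_completely_metrizable_space[OF hom] by simp
  have "separable_space (top_of_set K)"
    by (intro second_countable_imp_separable_space second_countable_subtopology second_countable_euclidean)
  then have 2: "separable_space ?T" using homeomorphic_separable_space[OF hom] by simp
  have setsX: "sets ?X = {j ` A |A. A \<in> sets ?N}" by (rule sets_embed_measure[OF j])
  have 3: "sets ?X = sigma_sets (space ?X) {U. openin ?T U}"
  proof
    have "j ` (K \<inter> U) \<in> sets ?X" if "open U" for U
    proof (rule in_sets_embed_measure)
      show "K \<inter> U \<in> sets ?N" using that Kb by (simp add: sets_restrict_space_iff)
    qed
    then show "sigma_sets (space ?X) {U. openin ?T U} \<subseteq> sets ?X"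
      by (intro sets.sigma_sets_subset) (auto simp: openT)
    have "j ` (K \<inter> B) \<in> sigma_sets (j ` K) {U. openin ?T U}" if "B \<in> sets borel" for B
    proof -
      have "B \<in> sigma_sets UNIV {S. open S}" using that by (simp add: borel_def)
      then show ?thesis
      proof (induction B rule: sigma_sets.induct)
        case (Basic U) then show ?case by (intro sigma_sets.Basic) (auto simp: openT)
      next
        case Empty then show ?case by (simp add: sigma_sets.Empty)
      next
        case (Compl B)
        have "j ` (K \<inter> (UNIV - B)) = j ` K - j ` (K \<inter> B)" using j by (auto dest: injD)
        then show ?case using sigma_sets.Compl[OF Compl.IH] by simp
      next
        case (Union B)
        have "j ` (K \<inter> (\<Union>i. B i)) = (\<Union>i. j ` (K \<inter> B i))" by auto
        then show ?case using sigma_sets.Union[OF Union.IH] by simp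
      qed
    qed
    then show "sets ?X \<subseteq> sigma_sets (space ?X) {U. openin ?T U}"
      unfolding spX setsX by (auto simp: sets_restrict_space)
  qed
  show ?thesis unfolding standard_borel_def
    using 1 2 3 topT spX by (intro exI[of _ ?T]) simp
qed

text \<open>Injectivity of \<open>g\<close> and \<open>g (h x) = x\<close> make \<open>g\<close> and
  \<open>h\<close> mutually inverse Borel isomorphisms of \<open>X\<close> and \<open>C\<close>. The
  points of \<open>X\<close> are real because rigidity is assumed for that type.\<close>

definition real_copy :: "'x measure \<Rightarrow> 'x set \<Rightarrow> real measure \<Rightarrow> (real \<Rightarrow> 'x) \<Rightarrow> ('x \<Rightarrow> real) \<Rightarrow> bool" where
  "real_copy M C X g h \<longleftrightarrow> standard_borel X \<and> g \<in> measurable X (restrict_space M C) \<and>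
     inj_on g (space X) \<and> h \<in> measurable (restrict_space M C) X \<and> (\<forall>x\<in>C. g (h x) = x)"

text \<open>A Borel subset of a standard Borel space is standard Borel, but a compact subset of almost
  full measure suffices and avoids refining the topology.\<close>

lemma exists_real_copy:
  fixes M :: "'x measure"
  assumes std: "standard_borel M" and fin: "finite_measure M" and B: "B \<in> sets M" and r: "r > 0"
  shows "\<exists>C\<in>sets M. C \<subseteq> B \<and> measure M (B - C) < r \<and> (\<exists>X g h. real_copy M C X g h)"
proof -
  interpret finite_measure M by fact
  obtain e :: "'x \<Rightarrow> nat \<Rightarrow> real" where "inj_on e (space M) \<and> e \<in> borel_measurable M \<and>
     e ` space M \<in> sets borel \<and> (\<forall>A\<in>sets M. \<exists>B\<in>sets borel. A = e -` B \<inter> space M)"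
    using standard_borel_embedding[OF std] ..
  then have e: "inj_on e (space M)" "e \<in> borel_measurable M" "e ` space M \<in> sets borel"
    "\<And>A. A \<in> sets M \<Longrightarrow> \<exists>B\<in>sets borel. A = e -` B \<inter> space M" by simp_all
  obtain B' where B': "B' \<in> sets borel" "B = e -` B' \<inter> space M" using e(4)[OF B] ..
  let ?D = "distr M borel e"
  \<comment> \<open>The image of \<open>B\<close>, Borel because \<open>e\<close> has Borel image; a
    compact subset of it supplies \<open>C\<close>.\<close>
  let ?B = "e ` space M \<inter> B'"
  have "finite_measure ?D" using e(2) by (rule finite_measure_distr)
  then obtain K where K: "compact K" "K \<subseteq> ?B" "measure ?D (?B - K) < r"
    using inner_regular_measure[of ?D ?B r] e(3) B'(1) r by auto
  have Kb: "K \<in> sets borel" using K(1) by (simp add: compact_imp_closed)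
  define C where "C = e -` K \<inter> space M"
  have C: "C \<in> sets M" unfolding C_def using e(2) Kb by (rule measurable_sets)
  have CB: "C \<subseteq> B" unfolding C_def B'(2) using K(2) by auto
  have "measure ?D (?B - K) = measure M (e -` (?B - K) \<inter> space M)"
    using e(2,3) B'(1) Kb by (intro measure_distr) auto
  moreover have "e -` (?B - K) \<inter> space M = B - C" unfolding C_def B'(2) by auto
  ultimately have small: "measure M (B - C) < r" using K(3) by simp
  obtain j :: "(nat \<Rightarrow> real) \<Rightarrow> real" where j: "inj j" using exists_inj_nat_to_real ..
  let ?N = "restrict_space borel K"
  let ?X = "embed_measure ?N j"
  let ?g = "\<lambda>r. inv_into (space M) e (inv_into UNIV j r)" and ?h = "\<lambda>x. j (e x)"
  have spN: "space ?N = K" using Kb by simp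
  have spC: "space (restrict_space M C) = C" using C by simp
  have eC: "e \<in> measurable (restrict_space M C) ?N"
    using e(2) by (intro measurable_restrict_space2 measurable_restrict_space1) (auto simp: C_def space_restrict_space)
  have KeM: "K \<subseteq> e ` space M" using K(2) by auto
  have inv_e: "e (inv_into (space M) e y) = y" if "y \<in> K" for y using that KeM by (auto intro: f_inv_into_f)
  have "inv_into (space M) e \<in> measurable (restrict_space borel (e ` space M)) M"
    using e(1,3,4) by (rule standard_borel_embedding_inverse)
  from measurable_restrict_space1[OF this, of K] have ie: "inv_into (space M) e \<in> measurable ?N M"
  proof -
    assume "inv_into (space M) e \<in> measurable (restrict_space (restrict_space borel (e ` space M)) K) M"
    moreover have "sets (restrict_space (restrict_space borel (e ` space M)) K) = sets ?N"
      using KeM by (simp add: sets_restrict_restrict_space Int_absorb1)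
    ultimately show ?thesis by (simp cong: measurable_cong_sets)
  qed
  have ieC: "inv_into (space M) e y \<in> C" if "y \<in> K" for y
    using that inv_into_into[of y e "space M"] KeM inv_e[OF that] by (auto simp: C_def)
  have "inv_into (space M) e \<in> measurable ?N (restrict_space M C)"
    using ie ieC by (intro measurable_restrict_space2) (auto simp: spN)
  then have "?g \<in> measurable ?X (restrict_space M C)"
    using j by (intro measurable_embed_measure1) simp
  moreover have "inj_on ?g (space ?X)"
  proof (rule inj_onI)
    fix r s assume rs: "r \<in> space ?X" "s \<in> space ?X" and eq: "?g r = ?g s"
    obtain y z where yz: "r = j y" "s = j z" "y \<in> K" "z \<in> K" using rs by (auto simp: space_embed_measure spN)
    then have "inv_into (space M) e y = inv_into (space M) e z" using eq j by simp
    then have "y = z" using inv_e yz(3,4) by metis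
    then show "r = s" using yz by simp
  qed
  moreover have "?h \<in> measurable (restrict_space M C) ?X"
    using eC measurable_embed_measure2[OF j] by (rule measurable_compose)
  moreover have "?g (?h x) = x" if "x \<in> C" for x
    using that j e(1) by (simp add: C_def inv_into_f_f)
  moreover have "standard_borel ?X" using K(1) by (intro standard_borel_embed_closed j compact_imp_closed)
  ultimately have "real_copy M C ?X ?g ?h" by (simp add: real_copy_def)
  then have "\<exists>X g h. real_copy M C X g h" by (intro exI)
  then show ?thesis using C CB small by (intro bexI[of _ C] conjI)
qed

lemma borel_action_measurable:
  assumes "borel_action G Y act" "g \<in> carrier G"
  shows "act g \<in> measurable Y Y"
proof -
  have act: "(\<lambda>(g, y). act g y) \<in> measurable (count_space (carrier G) \<Otimes>\<^sub>M Y) Y"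
    using assms(1) by (simp add: borel_action_def)
  have "(\<lambda>y. (g, y)) \<in> measurable Y (count_space (carrier G) \<Otimes>\<^sub>M Y)"
    using assms(2) by (intro measurable_Pair) auto
  from measurable_compose[OF this act] show ?thesis by simp
qed

text \<open>Rigidity is applied on the real copy \<open>X\<close> to the pullback of
  \<open>R\<close>, and its conclusion is brought back along the inverse \<open>h\<close>. By
  \<open>inv\<close>, one group element serves both functions on each pair of \<open>R\<close>,
  which gives the common \<open>\<rho>\<close>.\<close>

lemma projectively_rigid_hyperfinite:
  fixes M :: "'x measure" and Y :: "'y measure"
  assumes rigid: "projectively_rigid TYPE(real) G Y act" and cG: "countable (carrier G)" and neG: "carrier G \<noteq> {}"
    and Y: "standard_borel Y" and C: "C \<in> sets M" and copy: "real_copy M C X g h"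
    and meas: "\<phi> \<in> measurable (restrict_space M C) Y" "\<psi> \<in> measurable (restrict_space M C) Y"
    and cto: "countable_to_one C \<phi>" "countable_to_one C \<psi>"
    and R: "countable_borel_equiv (restrict_space M C) R"
    and inv: "\<And>x y. (x, y) \<in> R \<Longrightarrow> \<exists>g\<in>carrier G. \<phi> x = act g (\<phi> y) \<and> \<psi> x = act g (\<psi> y)"
  shows "hyperfinite (restrict_space M {x \<in> C. \<phi> x \<noteq> \<psi> x})
           (R \<inter> ({x \<in> C. \<phi> x \<noteq> \<psi> x} \<times> {x \<in> C. \<phi> x \<noteq> \<psi> x}))"
proof -
  have X: "standard_borel X" and g: "g \<in> measurable X (restrict_space M C)" "inj_on g (space X)"
    and h: "h \<in> measurable (restrict_space M C) X" "\<And>x. x \<in> C \<Longrightarrow> g (h x) = x"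
    using copy by (simp_all add: real_copy_def)
  have spC: "space (restrict_space M C) = C" using C by simp
  have act: "borel_action G Y act" using rigid by (simp add: projectively_rigid_def)
  define \<gamma> where "\<gamma> = from_nat_into (carrier G)"
  have \<gamma>: "\<gamma> i \<in> carrier G" for i unfolding \<gamma>_def using neG by (rule from_nat_into)
  have \<gamma>_onto: "\<exists>i. \<gamma> i = k" if "k \<in> carrier G" for k
    unfolding \<gamma>_def using from_nat_into_surj[OF cG that] by blast
  let ?\<phi> = "\<lambda>x. \<phi> (g x)" and ?\<psi> = "\<lambda>x. \<psi> (g x)"
  define E where "E = pullback_rel (space X) g R"
  have E_b: "borel_equiv X E" unfolding E_def using R by (intro borel_equiv_pullback[OF g(1)]) (simp add: countable_borel_equiv_def)
  have E_c: "countable (E `` {x})" if x: "x \<in> space X" for x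
  proof (rule countable_image_inj_on)
    have "countable (R `` {g x})" using R measurable_space[OF g(1) x] by (simp add: countable_borel_equiv_def)
    then show "countable (g ` (E `` {x}))"
      using pullback_rel_Image_subset[OF x] unfolding E_def by (rule countable_subset[rotated])
    show "inj_on g (E `` {x})" using g(2) by (rule inj_on_subset) (auto simp: E_def pullback_rel_def)
  qed
  have m\<phi>: "?\<phi> \<in> measurable X Y" using g(1) meas(1) by (rule measurable_compose)
  have m\<psi>: "?\<psi> \<in> measurable X Y" using g(1) meas(2) by (rule measurable_compose)
  have cto': "countable_to_one (space X) (\<lambda>x. \<theta> (g x))" if "countable_to_one C \<theta>" for \<theta> :: "'x \<Rightarrow> 'y"
    unfolding countable_to_one_def
  proof
    fix y
    have "countable {x \<in> C. \<theta> x = y}" using that by (simp add: countable_to_one_def)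
    moreover have "g ` {x \<in> space X. \<theta> (g x) = y} \<subseteq> {x \<in> C. \<theta> x = y}"
      using measurable_space[OF g(1)] spC by auto
    ultimately have "countable (g ` {x \<in> space X. \<theta> (g x) = y})" by (rule countable_subset[rotated])
    then show "countable {x \<in> space X. \<theta> (g x) = y}"
      by (rule countable_image_inj_on) (rule inj_on_subset[OF g(2)], auto)
  qed
  define P where "P i p \<longleftrightarrow> ?\<phi> (fst p) = act (\<gamma> i) (?\<phi> (snd p)) \<and> ?\<psi> (fst p) = act (\<gamma> i) (?\<psi> (snd p))" for i p
  \<comment> \<open>Taking the least index makes the choice measurable. Stabilizers may be
    nontrivial, so \<open>\<rho>\<close> need not be multiplicative; \<open>rho_invariant\<close>
    does not ask for that.\<close>
  define \<rho> where "\<rho> p = \<gamma> (LEAST i. P i p)" for p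
  let ?XX = "restrict_space (X \<Otimes>\<^sub>M X) E"
  have P_pred: "Measurable.pred ?XX (P i)" for i
  proof -
    have fst: "fst \<in> measurable ?XX X" and snd: "snd \<in> measurable ?XX X"
      by (auto intro: measurable_restrict_space1)
    have "{p \<in> space ?XX. \<theta> (fst p) = act (\<gamma> i) (\<theta> (snd p))} \<in> sets ?XX" if "\<theta> \<in> measurable X Y" for \<theta> :: "real \<Rightarrow> 'y"
      using measurable_compose[OF fst that]
        measurable_compose[OF measurable_compose[OF snd that] borel_action_measurable[OF act \<gamma>]]
      by (rule pred_eq_standard_borel[OF Y])
    from sets.Int[OF this[OF m\<phi>] this[OF m\<psi>]] show ?thesis
      unfolding pred_def by (rule back_subst[of "\<lambda>S. S \<in> sets ?XX"]) (auto simp: P_def)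
  qed
  have "(\<lambda>p. LEAST i. P i p) \<in> measurable ?XX (count_space UNIV)"
    using P_pred by (rule measurable_Least)
  moreover have "\<gamma> \<in> measurable (count_space UNIV) (count_space (carrier G))" using \<gamma> by simp
  ultimately have m\<rho>: "\<rho> \<in> measurable ?XX (count_space (carrier G))"
    unfolding \<rho>_def by (rule measurable_compose)
  have P_ex: "\<exists>i. P i (x, y)" if "(x, y) \<in> E" for x y
  proof -
    have "(g x, g y) \<in> R" using that by (simp add: E_def pullback_rel_def)
    from inv[OF this] obtain k where k: "k \<in> carrier G" "?\<phi> x = act k (?\<phi> y)" "?\<psi> x = act k (?\<psi> y)" by auto
    then show ?thesis using \<gamma>_onto[OF k(1)] by (auto simp: P_def)
  qed
  have P_\<rho>: "P (LEAST i. P i (x, y)) (x, y)" if "(x, y) \<in> E" for x y using P_ex[OF that] by (rule LeastI_ex)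
  have inv\<phi>: "rho_invariant E act \<rho> ?\<phi>" and inv\<psi>: "rho_invariant E act \<rho> ?\<psi>"
    unfolding rho_invariant_def \<rho>_def using P_\<rho> unfolding P_def by auto
  let ?D' = "{x \<in> space X. ?\<phi> x \<noteq> ?\<psi> x}" and ?D = "{x \<in> C. \<phi> x \<noteq> \<psi> x}"
  have "difference_set (space X, ?\<phi>) (space X, ?\<psi>) = ?D'" by (auto simp: difference_set_def)
  moreover have "countable_borel_equiv X E" using E_b E_c by (simp add: countable_borel_equiv_def)
  ultimately have hyp: "hyperfinite (restrict_space X ?D') (rel_restrict E ?D')"
    using rigid[unfolded projectively_rigid_def Let_def, THEN conjunct2, rule_format,
        OF X _ m\<rho> m\<phi> cto'[OF cto(1)] inv\<phi> m\<psi> cto'[OF cto(2)] inv\<psi>] by simp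
  have D: "?D \<in> sets M"
  proof -
    have "{x \<in> space (restrict_space M C). \<phi> x = \<psi> x} \<in> sets (restrict_space M C)"
      using meas by (rule pred_eq_standard_borel[OF Y])
    then have "C - {x \<in> C. \<phi> x = \<psi> x} \<in> sets M" using C by (auto simp: spC sets_restrict_space_iff)
    then show ?thesis by (rule back_subst[of "\<lambda>S. S \<in> sets M"]) auto
  qed
  have spD: "space (restrict_space M ?D) = ?D" using D by (rule space_restrict_space2)
  have hD: "h \<in> measurable (restrict_space M ?D) (restrict_space X ?D')"
  proof (rule measurable_restrict_space2)
    show "h \<in> space (restrict_space M ?D) \<rightarrow> ?D'"
      unfolding spD using measurable_space[OF h(1)] spC h(2) by auto
    have "h \<in> measurable (restrict_space (restrict_space M C) ?D) X" using h(1) by (rule measurable_restrict_space1)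
    moreover have "sets (restrict_space (restrict_space M C) ?D) = sets (restrict_space M ?D)"
      unfolding sets_restrict_restrict_space by (rule arg_cong[where f = "\<lambda>A. sets (restrict_space M A)"]) auto
    ultimately show "h \<in> measurable (restrict_space M ?D) X" by (simp cong: measurable_cong_sets)
  qed
  have "inj_on h (space (restrict_space M ?D))" unfolding spD by (rule inj_onI) (metis (no_types, lifting) h(2) mem_Collect_eq)
  from hyperfinite_pullback[OF hD this hyp] have "hyperfinite (restrict_space M ?D) (pullback_rel ?D h (rel_restrict E ?D'))"
    unfolding spD .
  moreover have "pullback_rel ?D h (rel_restrict E ?D') = R \<inter> (?D \<times> ?D)"
    using measurable_space[OF h(1)] spC h(2) by (auto simp: pullback_rel_def rel_restrict_def E_def)
  ultimately show ?thesis by simp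
qed

subsection \<open>Separability criteria\<close>

text \<open>The \<open>A n\<close> are the preimages of finite unions of basic open sets. Compact
  sets \<open>K\<close> inside \<open>B'\<close> and \<open>L\<close> inside its complement are
  chosen nearly full, and finitely many basic sets cover \<open>K\<close> and miss \<open>L\<close>;
  the error is then confined to the two parts left out.\<close>

lemma exists_countable_dense_sets:
  fixes M :: "'x measure"
  assumes std: "standard_borel M" and fin: "finite_measure M"
  shows "\<exists>A :: nat \<Rightarrow> 'x set. (\<forall>n. A n \<in> sets M) \<and>
    (\<forall>B\<in>sets M. \<forall>r>0. \<exists>n. measure M ((A n - B) \<union> (B - A n)) < r)"
proof -
  interpret finite_measure M by fact
  obtain e :: "'x \<Rightarrow> nat \<Rightarrow> real" where "inj_on e (space M) \<and> e \<in> borel_measurable M \<and>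
     e ` space M \<in> sets borel \<and> (\<forall>A\<in>sets M. \<exists>B\<in>sets borel. A = e -` B \<inter> space M)"
    using standard_borel_embedding[OF std] ..
  then have e: "e \<in> borel_measurable M" "\<And>A. A \<in> sets M \<Longrightarrow> \<exists>B\<in>sets borel. A = e -` B \<inter> space M"
    by simp_all
  obtain V :: "nat \<Rightarrow> (nat \<Rightarrow> real) set" where V: "\<And>n. open (V n)"
     "\<And>U w. open U \<Longrightarrow> w \<in> U \<Longrightarrow> \<exists>n. w \<in> V n \<and> V n \<subseteq> U"
    using countable_base_sequence by metis
  let ?D = "distr M borel e"
  have fD: "finite_measure ?D" using e(1) by (rule finite_measure_distr)
  define A where "A n = e -` (\<Union>i\<in>set_decode n. V i) \<inter> space M" for n
  have mA: "A n \<in> sets M" for n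
    unfolding A_def using V(1) by (intro measurable_sets[OF e(1)] borel_open open_UN) auto
  show ?thesis
  proof (intro exI[of _ A] conjI allI ballI impI)
    fix B and r :: real assume B: "B \<in> sets M" and r: "r > 0"
    obtain B' where B': "B' \<in> sets borel" "B = e -` B' \<inter> space M" using e(2)[OF B] ..
    obtain K where K: "compact K" "K \<subseteq> B'" "measure ?D (B' - K) < r / 2"
      using inner_regular_measure[OF _ fD B'(1), of "r / 2"] r by auto
    obtain L where L: "compact L" "L \<subseteq> - B'" "measure ?D (- B' - L) < r / 2"
      using inner_regular_measure[OF _ fD, of "- B'" "r / 2"] r B'(1) by auto
    have oL: "open (- L)" using L(1) by (simp add: compact_imp_closed open_Compl)
    have KL: "K \<subseteq> - L" using K(2) L(2) by auto
    have cov: "K \<subseteq> (\<Union>i\<in>{i. V i \<subseteq> - L}. V i)"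
    proof
      fix w assume "w \<in> K"
      then obtain n where "w \<in> V n" "V n \<subseteq> - L" using V(2)[OF oL, of w] KL by auto
      then show "w \<in> (\<Union>i\<in>{i. V i \<subseteq> - L}. V i)" by auto
    qed
    obtain C where C: "C \<subseteq> {i. V i \<subseteq> - L}" "finite C" "K \<subseteq> (\<Union>i\<in>C. V i)"
      using compactE_image[OF K(1) _ cov] V(1) by auto
    let ?n = "set_encode C"
    define W where "W = (\<Union>i\<in>C. V i)"
    have An: "A ?n = e -` W \<inter> space M" using C(2) by (simp add: A_def W_def)
    have W: "W \<subseteq> - L" "K \<subseteq> W" unfolding W_def using C(1,3) by blast+
    have m1: "e -` (B' - K) \<inter> space M \<in> sets M" "e -` (- B' - L) \<inter> space M \<in> sets M"
      using B'(1) K(1) L(1) by (intro measurable_sets[OF e(1)]; simp add: compact_imp_closed sets.Diff)+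
    have "(A ?n - B) \<union> (B - A ?n) \<subseteq> (e -` (B' - K) \<inter> space M) \<union> (e -` (- B' - L) \<inter> space M)"
      unfolding An B'(2) using W by auto
    then have "measure M ((A ?n - B) \<union> (B - A ?n)) \<le> measure M ((e -` (B' - K) \<inter> space M) \<union> (e -` (- B' - L) \<inter> space M))"
      using m1 by (intro finite_measure_mono) auto
    also have "\<dots> \<le> measure M (e -` (B' - K) \<inter> space M) + measure M (e -` (- B' - L) \<inter> space M)"
      using m1 by (rule measure_Un_le)
    also have "\<dots> = measure ?D (B' - K) + measure ?D (- B' - L)"
      using B'(1) K(1) L(1) e(1) by (simp add: measure_distr compact_imp_closed sets.Diff)
    also have "\<dots> < r" using K(3) L(3) by simp
    finally show "\<exists>n. measure M ((A n - B) \<union> (B - A n)) < r" ..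
  qed (rule mA)
qed

text \<open>A list of indices of approximating sets codes a function with values in \<^typ>\<open>nat\<close> up to
  an error in measure, and there are only countably many codes.\<close>

lemma uncountable_family_close:
  fixes M :: "'x measure" and a :: "'t \<Rightarrow> nat \<Rightarrow> 'x \<Rightarrow> nat"
  assumes std: "standard_borel M" and fin: "finite_measure M" and T: "uncountable T"
    and a: "\<And>t n. t \<in> T \<Longrightarrow> a t n \<in> measurable M (count_space UNIV)" and r: "\<And>k. r k > (0::real)"
  shows "\<exists>t\<in>T. \<forall>k::nat. \<exists>s\<in>T. s \<noteq> t \<and> (\<forall>n\<le>k. measure M {x \<in> space M. a t n x \<noteq> a s n x} < r k)"
proof -
  interpret finite_measure M by fact
  obtain A :: "nat \<Rightarrow> 'x set" where "(\<forall>n. A n \<in> sets M) \<and>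
    (\<forall>B\<in>sets M. \<forall>r>0. \<exists>n. measure M ((A n - B) \<union> (B - A n)) < r)"
    using exists_countable_dense_sets[OF std fin] ..
  then have A: "\<And>n. A n \<in> sets M"
    "\<And>B r. B \<in> sets M \<Longrightarrow> r > 0 \<Longrightarrow> \<exists>n. measure M ((A n - B) \<union> (B - A n)) < r" by simp_all
  define lev where "lev b i = {x \<in> space M. b x = i}" for b :: "'x \<Rightarrow> nat" and i
  define tail where "tail b L = {x \<in> space M. L \<le> b x}" for b :: "'x \<Rightarrow> nat" and L
  \<comment> \<open>Entry \<open>i\<close> of the code approximates the level set
    \<open>b = i\<close>; values from \<open>length c\<close> on are neglected. The denominator
    \<open>4 * (length c + 1)\<close> leaves at most \<open>e / 2\<close> for the level errors of
    two functions with the same code, and the tail of one of them takes the other half.\<close>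
  define close where "close e c b \<longleftrightarrow> measure M (tail b (length c)) < e / 2 \<and>
     (\<forall>i<length c. measure M ((A (c ! i) - lev b i) \<union> (lev b i - A (c ! i))) < e / (4 * (real (length c) + 1)))"
    for e c b
  have sub_meas: "{x \<in> space M. b x \<in> S} \<in> sets M" if "b \<in> measurable M (count_space UNIV)" for b :: "'x \<Rightarrow> nat" and S
    using measurable_sets[OF that, of S] by (simp add: vimage_def Int_def conj_commute)
  have lev_m: "lev b i \<in> sets M" if "b \<in> measurable M (count_space UNIV)" for b i
    using sub_meas[OF that, of "{i}"] by (simp add: lev_def)
  have tail_m: "tail b L \<in> sets M" if "b \<in> measurable M (count_space UNIV)" for b L
    using sub_meas[OF that, of "{L..}"] by (simp add: tail_def)
  have ex_close: "\<exists>c. close e c b" if b: "b \<in> measurable M (count_space UNIV)" and e: "e > 0" for b e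
  proof -
    have "(\<lambda>L. measure M (tail b L)) \<longlonglongrightarrow> measure M (\<Inter>L. tail b L)"
      using tail_m[OF b] by (intro finite_Lim_measure_decseq) (auto simp: decseq_def tail_def)
    moreover have "(\<Inter>L. tail b L) = {}"
    proof -
      have "x \<notin> tail b (Suc (b x))" for x by (simp add: tail_def)
      then show ?thesis by auto
    qed
    ultimately have "(\<lambda>L. measure M (tail b L)) \<longlonglongrightarrow> 0" by simp
    then have "\<forall>\<^sub>F L in sequentially. measure M (tail b L) < e / 2" by (rule order_tendstoD(2)) (use e in simp)
    then obtain L where L: "measure M (tail b L) < e / 2" unfolding eventually_sequentially by auto
    have "\<exists>n. measure M ((A n - lev b i) \<union> (lev b i - A n)) < e / (4 * (real L + 1))" for i
      using e by (intro A(2) lev_m[OF b]) auto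
    then obtain n where n: "\<And>i. measure M ((A (n i) - lev b i) \<union> (lev b i - A (n i))) < e / (4 * (real L + 1))"
      by metis
    have "close e (map n [0..<L]) b" unfolding close_def using L n by simp
    then show ?thesis ..
  qed
  have close_eq: "measure M {x \<in> space M. b x \<noteq> b' x} < e"
    if c: "close e c b" "close e c b'" and b: "b \<in> measurable M (count_space UNIV)" "b' \<in> measurable M (count_space UNIV)"
      and e: "e > 0" for e c b b'
  proof -
    let ?L = "length c"
    let ?d = "e / (4 * (real ?L + 1))"
    let ?X = "\<lambda>b i. (A (c ! i) - lev b i) \<union> (lev b i - A (c ! i))"
    have X_m: "?X b i \<in> sets M" "?X b' i \<in> sets M" for i using A(1) lev_m b by auto
    \<comment> \<open>If the values differ and \<open>b x\<close> is below the length,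
      \<open>x\<close> lies in the level set with index \<open>b x\<close> for \<open>b\<close> but
      not for \<open>b'\<close>, so one of the two disagrees with their common approximation at
      \<open>x\<close>.\<close>
    have sub: "{x \<in> space M. b x \<noteq> b' x} \<subseteq> tail b ?L \<union> (\<Union>i\<in>{..<?L}. ?X b i \<union> ?X b' i)"
    proof
      fix x assume x: "x \<in> {x \<in> space M. b x \<noteq> b' x}"
      show "x \<in> tail b ?L \<union> (\<Union>i\<in>{..<?L}. ?X b i \<union> ?X b' i)"
      proof (cases "?L \<le> b x")
        case True then show ?thesis using x by (simp add: tail_def)
      next
        case False
        then have i: "b x \<in> {..<?L}" by simp
        have "x \<in> lev b (b x)" "x \<notin> lev b' (b x)" using x by (auto simp: lev_def)
        then have "x \<in> ?X b (b x) \<union> ?X b' (b x)" by blast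
        then show ?thesis by (intro UnI2) (rule UN_I[OF i])
      qed
    qed
    have "measure M (\<Union>i\<in>{..<?L}. ?X b i \<union> ?X b' i) \<le> (\<Sum>i\<in>{..<?L}. measure M (?X b i \<union> ?X b' i))"
      using X_m by (intro finite_measure_subadditive_finite) auto
    also have "\<dots> \<le> (\<Sum>i\<in>{..<?L}. 2 * ?d)"
    proof (rule sum_mono)
      fix i assume "i \<in> {..<?L}"
      then have "measure M (?X b i) < ?d" "measure M (?X b' i) < ?d" using c by (simp_all add: close_def)
      then show "measure M (?X b i \<union> ?X b' i) \<le> 2 * ?d"
        using measure_Un_le[OF X_m(1)[of i] X_m(2)[of i]] by linarith
    qed
    also have "\<dots> = real ?L * (2 * ?d)" by simp
    also have "\<dots> \<le> e / 2" using e by (simp add: field_simps)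
    finally have 1: "measure M (\<Union>i\<in>{..<?L}. ?X b i \<union> ?X b' i) \<le> e / 2" .
    have Xm: "(\<Union>i\<in>{..<?L}. ?X b i \<union> ?X b' i) \<in> sets M" using X_m by auto
    have "measure M {x \<in> space M. b x \<noteq> b' x} \<le> measure M (tail b ?L \<union> (\<Union>i\<in>{..<?L}. ?X b i \<union> ?X b' i))"
      using sub Xm tail_m[OF b(1)] by (intro finite_measure_mono) auto
    also have "\<dots> \<le> measure M (tail b ?L) + measure M (\<Union>i\<in>{..<?L}. ?X b i \<union> ?X b' i)"
      using tail_m[OF b(1)] Xm by (rule measure_Un_le)
    also have "\<dots> < e" using 1 c(1) by (simp add: close_def)
    finally show ?thesis .
  qed
  define c where "c t k n = (SOME c. close (r k) c (a t n))" for t k n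
  have c: "close (r k) (c t k n) (a t n)" if "t \<in> T" for t k n
    unfolding c_def using ex_close[OF a[OF that] r] by (rule someI_ex)
  define Q where "Q t s k \<longleftrightarrow> (\<forall>n\<le>k. measure M {x \<in> space M. a t n x \<noteq> a s n x} < r k)" for t s k
  have "\<exists>t\<in>T. \<forall>k. \<exists>s\<in>T. s \<noteq> t \<and> Q t s k"
  proof (rule ccontr)
    assume "\<not> ?thesis"
    then have "\<forall>t\<in>T. \<exists>k. \<forall>s\<in>T. s \<noteq> t \<longrightarrow> \<not> Q t s k" by blast
    from bchoice[OF this] obtain \<kappa> where \<kappa>: "\<forall>t\<in>T. \<forall>s\<in>T. s \<noteq> t \<longrightarrow> \<not> Q t s (\<kappa> t)" ..
    \<comment> \<open>\<open>\<kappa> t\<close> is a stage at which \<open>t\<close> has no close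
      companion. It is part of the code, so that two members with equal codes are compared at the
      same precision.\<close>
    let ?code = "\<lambda>t. (\<kappa> t, map (c t (\<kappa> t)) [0..<Suc (\<kappa> t)])"
    have "inj_on ?code T"
    proof (rule inj_onI, rule ccontr)
      fix t s assume ts: "t \<in> T" "s \<in> T" "?code t = ?code s" "t \<noteq> s"
      have "measure M {x \<in> space M. a t n x \<noteq> a s n x} < r (\<kappa> t)" if n: "n \<le> \<kappa> t" for n
      proof -
        have \<kappa>eq: "\<kappa> s = \<kappa> t" using ts(3) by simp
        have "map (c t (\<kappa> t)) [0..<Suc (\<kappa> t)] ! n = map (c s (\<kappa> s)) [0..<Suc (\<kappa> s)] ! n"
          by (rule arg_cong[where f = "\<lambda>l. l ! n", OF Pair_inject[OF ts(3)]])
        then have "c t (\<kappa> t) n = c s (\<kappa> t) n" using n unfolding \<kappa>eq by (simp del: upt_Suc)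
        then show ?thesis
          using close_eq[OF c[OF ts(1), of "\<kappa> t" n] _ a[OF ts(1)] a[OF ts(2)] r] c[OF ts(2), of "\<kappa> t" n] by simp
      qed
      then have "Q t s (\<kappa> t)" by (simp add: Q_def)
      then show False using \<kappa> ts(1,2,4) by auto
    qed
    then have "countable T" by (rule countableI')
    then show False using T by simp
  qed
  then show ?thesis unfolding Q_def .
qed

text \<open>A maximal \<open>e\<close>-separated set, countable by \<open>sep\<close>, is within
  \<open>e\<close> of every point; the union of such sets over \<open>e = 1 / (n + 1)\<close> is
  dense.\<close>

lemma separable_pseudometric_topology:
  assumes refl: "\<And>x. x \<in> S \<Longrightarrow> d x x = 0" and sym: "\<And>x y. d x y = d y x"
    and sep: "\<And>e T. e > 0 \<Longrightarrow> T \<subseteq> S \<Longrightarrow> (\<And>x y. x \<in> T \<Longrightarrow> y \<in> T \<Longrightarrow> x \<noteq> y \<Longrightarrow> d x y \<ge> e) \<Longrightarrow> countable T"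
  shows "separable_space (pseudometric_topology S d)"
proof -
  have ex: "\<exists>T\<subseteq>S. countable T \<and> (\<forall>x\<in>S. \<exists>y\<in>T. d x y < e)" if e: "e > 0" for e
  proof -
    let ?P = "{T. T \<subseteq> S \<and> (\<forall>x\<in>T. \<forall>y\<in>T. x \<noteq> y \<longrightarrow> d x y \<ge> e)}"
    have "\<exists>T\<in>?P. \<forall>X\<in>?P. T \<subseteq> X \<longrightarrow> X = T"
    proof (rule subset_Zorn')
      fix c assume c: "subset.chain ?P c"
      have sub: "c \<subseteq> ?P" using c by (simp add: subset.chain_def)
      have dir: "\<exists>Z\<in>c. x \<in> Z \<and> y \<in> Z" if "x \<in> \<Union> c" "y \<in> \<Union> c" for x y
      proof -
        from that obtain X Y where XY: "X \<in> c" "Y \<in> c" "x \<in> X" "y \<in> Y" by auto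
        then have "X \<subseteq> Y \<or> Y \<subseteq> X" using c by (auto simp: subset_chain_def)
        then show ?thesis using XY by auto
      qed
      have "d x y \<ge> e" if "x \<in> \<Union> c" "y \<in> \<Union> c" "x \<noteq> y" for x y
      proof -
        from dir[OF that(1,2)] obtain Z where "Z \<in> c" "x \<in> Z" "y \<in> Z" by auto
        then show ?thesis using sub that(3) by auto
      qed
      then show "\<Union> c \<in> ?P" using sub by auto
    qed
    then obtain T where T: "T \<subseteq> S" "\<And>x y. x \<in> T \<Longrightarrow> y \<in> T \<Longrightarrow> x \<noteq> y \<Longrightarrow> d x y \<ge> e"
      and max: "\<And>X. X \<in> ?P \<Longrightarrow> T \<subseteq> X \<Longrightarrow> X = T" by auto
    have "\<exists>y\<in>T. d x y < e" if x: "x \<in> S" for x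
    proof (rule ccontr)
      assume "\<not> ?thesis"
      then have far: "\<And>y. y \<in> T \<Longrightarrow> d x y \<ge> e" by (auto simp: not_less)
      have "x \<notin> T" using far[of x] refl[OF x] e by auto
      moreover have "insert x T \<in> ?P" 
      proof -
        have "d y x \<ge> e" if "y \<in> T" for y using far[OF that] sym[of x y] by simp
        then show ?thesis using T far x by auto
      qed
      ultimately show False using max[of "insert x T"] by auto
    qed
    moreover have "countable T" using sep[OF e T] .
    ultimately show ?thesis using T(1) by auto
  qed
  have "\<exists>T\<subseteq>S. countable T \<and> (\<forall>x\<in>S. \<exists>y\<in>T. d x y < 1 / real (Suc n))" for n by (rule ex) simp
  then obtain T where T: "\<And>n. T n \<subseteq> S" "\<And>n. countable (T n)"
    "\<And>n x. x \<in> S \<Longrightarrow> \<exists>y\<in>T n. d x y < 1 / real (Suc n)" by metis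
  let ?X = "pseudometric_topology S d"
  have "x \<in> ?X closure_of (\<Union>n. T n)" if x: "x \<in> S" for x
    unfolding in_closure_of topspace_pseudometric_topology
  proof (intro conjI x allI impI)
    fix U assume U: "x \<in> U \<and> openin ?X U"
    then obtain r where r: "r > 0" "{y\<in>S. d x y < r} \<subseteq> U" unfolding openin_pseudometric_topology by auto
    obtain n where n: "1 / real (Suc n) < r" using nat_approx_posE[OF r(1)] .
    obtain y where y: "y \<in> T n" "d x y < 1 / real (Suc n)" using T(3)[OF x, of n] by auto
    then have "y \<in> U" using r(2) T(1)[of n] n by auto
    then show "\<exists>y. y \<in> (\<Union>n. T n) \<and> y \<in> U" using y(1) by auto
  qed
  then have "?X closure_of (\<Union>n. T n) = topspace ?X"
    using closure_of_subset_topspace[of ?X "\<Union>n. T n"] unfolding topspace_pseudometric_topology by auto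
  moreover have "(\<Union>n. T n) \<subseteq> topspace ?X" unfolding topspace_pseudometric_topology using T(1) by auto
  moreover have "countable (\<Union>n. T n)" using T(2) by simp
  ultimately show ?thesis unfolding separable_space_def by (intro exI[of _ "\<Union>n. T n"] conjI)
qed

section \<open>Hyperfiniteness on a limit superior of sets\<close>

lemma hyperfinite_piecewise:
  assumes A: "A \<in> sets M" and D: "\<And>k::nat. D k \<in> sets M" and R: "\<And>k. hyperfinite (restrict_space M (D k)) (R k)"
    and F: "equiv A F" "F \<in> sets (M \<Otimes>\<^sub>M M)"
    and \<kappa>: "\<And>x. x \<in> A \<Longrightarrow> x \<in> D (\<kappa> x)" "\<And>k. {x \<in> A. \<kappa> x = k} \<in> sets M"
    and inv: "\<And>x y. (x, y) \<in> F \<Longrightarrow> \<kappa> x = \<kappa> y \<and> (x, y) \<in> R (\<kappa> x)"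
  shows "hyperfinite (restrict_space M A) F"
proof -
  have "\<forall>k. \<exists>S :: nat \<Rightarrow> 'a rel. (\<forall>j. equiv (D k) (S j) \<and> S j \<in> sets (M \<Otimes>\<^sub>M M) \<and> (\<forall>x\<in>D k. finite (S j `` {x}))) \<and>
       incseq S \<and> R k = (\<Union>j. S j)"
    using R hyperfinite_restrict_space_iff[OF D] by simp
  from choice[OF this] obtain S :: "nat \<Rightarrow> nat \<Rightarrow> 'a rel"
    where "\<forall>k. (\<forall>j. equiv (D k) (S k j) \<and> S k j \<in> sets (M \<Otimes>\<^sub>M M) \<and> (\<forall>x\<in>D k. finite (S k j `` {x}))) \<and>
       incseq (S k) \<and> R k = (\<Union>j. S k j)" ..
  then have S: "\<And>n j. equiv (D n) (S n j)" "\<And>n j. S n j \<in> sets (M \<Otimes>\<^sub>M M)" "\<And>n j x. x \<in> D n \<Longrightarrow> finite (S n j `` {x})"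
      "\<And>n. incseq (S n)" "\<And>n. R n = (\<Union>j. S n j)" by simp_all
  \<comment> \<open>\<open>\<kappa>\<close> is constant on the classes of \<open>F\<close>, so on
    each class the exhaustion of a single \<open>R k\<close> is used.\<close>
  define T where "T j = {(x, y) \<in> F. (x, y) \<in> S (\<kappa> x) j}" for j
  have FA: "F \<subseteq> A \<times> A" using F(1) by (rule equiv_type)
  have spA: "A \<subseteq> space M" using A by (rule sets.sets_into_space)
  have Fsp: "F \<subseteq> space M \<times> space M" using FA spA by auto
  have "equiv A (T j)" for j
  proof (rule equivI)
    show "T j \<subseteq> A \<times> A" using FA by (auto simp: T_def)
    show "refl_on A (T j)"
    proof -
      have "(x, x) \<in> S (\<kappa> x) j" if "x \<in> A" for x using S(1)[of "\<kappa> x" j] \<kappa>(1)[OF that] by (auto simp: equiv_def refl_on_def)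
      then show ?thesis using F(1) by (auto simp: equiv_def refl_on_def T_def)
    qed
    show "sym (T j)"
    proof (rule symI)
      fix x y assume xy: "(x, y) \<in> T j"
      then have "(x, y) \<in> F" "(x, y) \<in> S (\<kappa> x) j" by (auto simp: T_def)
      moreover have "sym F" "sym (S (\<kappa> x) j)" using F(1) S(1) by (auto simp: equiv_def)
      ultimately show "(y, x) \<in> T j" using inv[of x y] unfolding T_def by (auto dest: symD)
    qed
    show "trans (T j)"
    proof (rule transI)
      fix x y z assume "(x, y) \<in> T j" "(y, z) \<in> T j"
      then have "(x, y) \<in> F" "(y, z) \<in> F" "(x, y) \<in> S (\<kappa> x) j" "(y, z) \<in> S (\<kappa> x) j"
        using inv[of x y] by (auto simp: T_def)
      moreover have "trans F" "trans (S (\<kappa> x) j)" using F(1) S(1) by (auto simp: equiv_def)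
      ultimately show "(x, z) \<in> T j" unfolding T_def by (auto dest: transD)
    qed
  qed
  moreover have "T j \<in> sets (M \<Otimes>\<^sub>M M)" for j
  proof -
    have "T j = (\<Union>k. F \<inter> S k j \<inter> ({x \<in> A. \<kappa> x = k} \<times> space M))"
      using FA Fsp by (auto simp: T_def)
    also have "\<dots> \<in> sets (M \<Otimes>\<^sub>M M)" using F(2) S(2) \<kappa>(2) by (intro sets.countable_UN'' sets.Int pair_measureI) auto
    finally show ?thesis .
  qed
  moreover have "finite (T j `` {x})" if "x \<in> A" for j x
  proof (rule finite_subset)
    show "T j `` {x} \<subseteq> S (\<kappa> x) j `` {x}" by (auto simp: T_def)
    show "finite (S (\<kappa> x) j `` {x})" using \<kappa>(1)[OF that] by (rule S(3))
  qed
  moreover have "incseq T" using incseq_SucD[OF S(4)] by (intro incseq_SucI) (auto simp: T_def)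
  moreover have "F = (\<Union>j. T j)"
  proof
    show "F \<subseteq> (\<Union>j. T j)"
    proof
      fix p assume "p \<in> F"
      then obtain x y where p: "p = (x, y)" "(x, y) \<in> F" by (cases p) auto
      then obtain j where "(x, y) \<in> S (\<kappa> x) j" using inv[OF p(2)] S(5) by auto
      then show "p \<in> (\<Union>j. T j)" using p by (auto simp: T_def)
    qed
  qed (auto simp: T_def)
  ultimately show ?thesis unfolding hyperfinite_restrict_space_iff[OF A] by (intro exI[of _ T] conjI allI ballI) simp_all
qed

text \<open>On points lying in infinitely many \<open>D k\<close>, the relation of agreeing from stage \<open>n\<close> on with
  the \<open>R k\<close> is hyperfinite, because it refines \<open>R k\<close> for the first \<open>k \<ge> n\<close> with \<open>x \<in> D k\<close>.\<close>

theorem (in finite_measure) hyperfinite_limsup: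
  fixes D :: "nat \<Rightarrow> 'a set" and R :: "nat \<Rightarrow> 'a rel" and f :: "nat \<Rightarrow> 'a \<Rightarrow> 'a"
  assumes E: "borel_equiv M E" and f: "\<And>i. f i \<in> measurable M M"
    and D: "\<And>k. D k \<in> sets M" and R: "\<And>k. hyperfinite (restrict_space M (D k)) (R k)"
    and A: "A \<in> sets M" "A \<subseteq> (\<Inter>m. \<Union>k\<in>{m..}. D k)"
    and cov: "\<And>x y. x \<in> A \<Longrightarrow> (x, y) \<in> E \<Longrightarrow> \<exists>i. y = f i x"
    and ev: "\<And>x y. x \<in> A \<Longrightarrow> y \<in> A \<Longrightarrow> (x, y) \<in> E \<Longrightarrow>
      \<exists>m. \<forall>k\<ge>m. (x \<in> D k \<or> y \<in> D k) \<longrightarrow> (x, y) \<in> R k"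
  shows "\<exists>D'\<in>sets M. D' \<subseteq> A \<and> A - D' \<in> null_sets M \<and> hyperfinite (restrict_space M D') (E \<inter> (D' \<times> D'))"
proof -
  have Deq: "equiv (D k) (R k)" and RM: "R k \<in> sets (M \<Otimes>\<^sub>M M)" for k
    using R[of k] D[of k] unfolding hyperfinite_def borel_equiv_def by (simp_all add: sets_pair_restrict_space)
  have RD: "R k \<subseteq> D k \<times> D k" for k using Deq by (rule equiv_type)
  have Eeq: "equiv (space M) E" and EM: "E \<in> sets (M \<Otimes>\<^sub>M M)" using E by (simp_all add: borel_equiv_def)
  have Asp: "A \<subseteq> space M" using A(1) by (rule sets.sets_into_space)
  \<comment> \<open>With the block outside \<open>D k\<close> added, each \<open>R k\<close> becomes
    an equivalence relation on the whole space, so the intersection is one on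
    \<open>A\<close>.\<close>
  define F where "F n = E \<inter> (A \<times> A) \<inter> (\<Inter>k\<in>{n..}. R k \<union> ((space M - D k) \<times> (space M - D k)))" for n
  have F_iff: "(x, y) \<in> F n \<longleftrightarrow> (x, y) \<in> E \<and> x \<in> A \<and> y \<in> A \<and> (\<forall>k\<ge>n. (x, y) \<in> R k \<or> (x \<notin> D k \<and> y \<notin> D k))" for x y n
    unfolding F_def using Asp by auto
  have F_equiv: "equiv A (F n)" for n
  proof (rule equivI)
    show "F n \<subseteq> A \<times> A" by (auto simp: F_def)
    show "refl_on A (F n)"
    proof (rule refl_onI)
      fix x assume x: "x \<in> A"
      have "(x, x) \<in> R k \<or> x \<notin> D k" for k using Deq[of k] by (auto simp: equiv_def refl_on_def)
      moreover have "(x, x) \<in> E" using Eeq Asp x by (auto simp: equiv_def refl_on_def)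
      ultimately show "(x, x) \<in> F n" using x by (auto simp: F_iff)
    qed
    show "sym (F n)"
    proof (rule symI)
      fix x y assume "(x, y) \<in> F n"
      moreover have "(x, y) \<in> R k \<Longrightarrow> (y, x) \<in> R k" for k using Deq[of k] by (auto simp: equiv_def dest: symD)
      moreover have "(x, y) \<in> E \<Longrightarrow> (y, x) \<in> E" using Eeq by (auto simp: equiv_def dest: symD)
      ultimately show "(y, x) \<in> F n" unfolding F_iff by auto
    qed
    show "trans (F n)"
    proof (rule transI)
      fix x y z assume xy: "(x, y) \<in> F n" and yz: "(y, z) \<in> F n"
      have tE: "(x, z) \<in> E" using xy yz Eeq by (auto simp: F_iff equiv_def dest: transD)
      have "(x, z) \<in> R k \<or> (x \<notin> D k \<and> z \<notin> D k)" if k: "k \<ge> n" for k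
      proof (cases "y \<in> D k")
        case True
        then have "(x, y) \<in> R k" "(y, z) \<in> R k" using xy yz k by (auto simp: F_iff)
        then show ?thesis using Deq[of k] by (auto simp: equiv_def dest: transD)
      next
        case False
        then have "(x, y) \<notin> R k" "(y, z) \<notin> R k" using RD by auto
        then show ?thesis using xy yz k by (auto simp: F_iff)
      qed
      then show "(x, z) \<in> F n" using tE xy yz by (auto simp: F_iff)
    qed
  qed
  have F_sets: "F n \<in> sets (M \<Otimes>\<^sub>M M)" for n
    unfolding F_def using EM A(1) RM D by (intro sets.Int sets.countable_INT' sets.Un pair_measureI) auto
  have F_hyp: "hyperfinite (restrict_space M A) (F n)" for n
  proof -
    \<comment> \<open>The two points of a pair of \<open>F n\<close> belong to the same sets
      \<open>D k\<close> with \<open>k \<ge> n\<close>, so \<open>\<kappa>\<close> is invariant;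
      such a \<open>k\<close> exists because \<open>A\<close> lies in the limit superior.\<close>
    define \<kappa> where "\<kappa> x = (LEAST k. n \<le> k \<and> x \<in> D k)" for x
    have ex: "n \<le> \<kappa> x \<and> x \<in> D (\<kappa> x)" if "x \<in> A" for x
    proof -
      have "x \<in> (\<Union>k\<in>{n..}. D k)" using A(2) that by auto
      then have "\<exists>k. n \<le> k \<and> x \<in> D k" by auto
      then show ?thesis unfolding \<kappa>_def by (rule LeastI_ex)
    qed
    show ?thesis
    proof (rule hyperfinite_piecewise[OF A(1) D R F_equiv F_sets])
      show "x \<in> D (\<kappa> x)" if "x \<in> A" for x using ex[OF that] ..
      have "\<kappa> \<in> measurable M (count_space UNIV)"
        unfolding \<kappa>_def using D by (intro measurable_Least) (auto simp: pred_def intro!: sets.sets_Collect)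
      from sets.Int[OF A(1) measurable_sets[OF this, of "{_}"]] show "{x \<in> A. \<kappa> x = k} \<in> sets M" for k
        by (rule back_subst[of "\<lambda>S. S \<in> sets M"]) (use Asp in auto)
      fix x y assume xy: "(x, y) \<in> F n"
      have "n \<le> k \<and> x \<in> D k \<longleftrightarrow> n \<le> k \<and> y \<in> D k" for k
        using xy RD[of k] by (auto simp: F_iff)
      then have "\<kappa> x = \<kappa> y" by (simp add: \<kappa>_def)
      moreover have "(x, y) \<in> R (\<kappa> x)" using xy ex[of x] by (auto simp: F_iff)
      ultimately show "\<kappa> x = \<kappa> y \<and> (x, y) \<in> R (\<kappa> x)" ..
    qed
  qed
  have F_inc: "incseq F" by (rule incseq_SucI) (auto simp: F_def)
  have F_cov: "\<exists>i. y = f i x" if "(x, y) \<in> F n" for n x y using that cov by (auto simp: F_iff)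
  have "\<exists>D'\<in>sets M. D' \<subseteq> A \<and> A - D' \<in> null_sets M \<and>
    hyperfinite (restrict_space M D') ((\<Union>n. F n) \<inter> (D' \<times> D'))"
    by (rule hyperfinite_incseq_union_ae[OF A(1) F_hyp F_inc f]) (rule F_cov)
  then obtain D' where D': "D' \<in> sets M" "D' \<subseteq> A" "A - D' \<in> null_sets M"
      "hyperfinite (restrict_space M D') ((\<Union>n. F n) \<inter> (D' \<times> D'))"
    by auto
  have "(\<Union>n. F n) \<inter> (D' \<times> D') = E \<inter> (D' \<times> D')"
  proof
    show "(\<Union>n. F n) \<inter> (D' \<times> D') \<subseteq> E \<inter> (D' \<times> D')" by (auto simp: F_def)
    show "E \<inter> (D' \<times> D') \<subseteq> (\<Union>n. F n) \<inter> (D' \<times> D')"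
    proof
      fix p assume "p \<in> E \<inter> (D' \<times> D')"
      then obtain x y where p: "p = (x, y)" "(x, y) \<in> E" "x \<in> D'" "y \<in> D'" by (cases p) auto
      then obtain m where "\<forall>k\<ge>m. (x \<in> D k \<or> y \<in> D k) \<longrightarrow> (x, y) \<in> R k" using ev[of x y] D'(2) by auto
      then have "(x, y) \<in> F m" using p D'(2) by (auto simp: F_iff)
      then show "p \<in> (\<Union>n. F n) \<inter> (D' \<times> D')" using p by auto
    qed
  qed
  then show ?thesis using D' by auto
qed

subsection \<open>Projective separability\<close>

lemma orbit_equiv_countable_borel_equiv:
  fixes Y :: "'y measure"
  assumes cG: "countable (carrier G)" and Y: "standard_borel Y" and act: "borel_action G Y act"
  shows "countable_borel_equiv Y (orbit_equiv G Y act)"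
proof -
  interpret group_action G "space Y" act using act by (simp add: borel_action_def)
  have G: "group G" using group_hom by (rule group_hom.axioms(1))
  have "equiv (space Y) (orbit_equiv G Y act)"
  proof (rule equivI)
    show "orbit_equiv G Y act \<subseteq> space Y \<times> space Y" by (auto simp: orbit_equiv_def)
    show "refl_on (space Y) (orbit_equiv G Y act)"
    proof (rule refl_onI)
      fix y assume y: "y \<in> space Y"
      then have "act \<one>\<^bsub>G\<^esub> y = y" using fun_cong[OF id_eq_one, of y] by simp
      moreover have "\<one>\<^bsub>G\<^esub> \<in> carrier G" using group.is_monoid[OF G] by (rule monoid.one_closed)
      ultimately show "(y, y) \<in> orbit_equiv G Y act" using y by (auto simp: orbit_equiv_def)
    qed
    show "sym (orbit_equiv G Y act)"
    proof (rule symI)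
      fix x y assume "(x, y) \<in> orbit_equiv G Y act"
      then obtain g where g: "x \<in> space Y" "y \<in> space Y" "g \<in> carrier G" "act g x = y" by (auto simp: orbit_equiv_def)
      have "act (inv\<^bsub>G\<^esub> g) y = x" using g by (intro orbit_sym_aux)
      moreover have "inv\<^bsub>G\<^esub> g \<in> carrier G" using group.inv_closed[OF G g(3)] .
      ultimately show "(y, x) \<in> orbit_equiv G Y act" using g by (auto simp: orbit_equiv_def)
    qed
    show "trans (orbit_equiv G Y act)"
    proof (rule transI)
      fix x y z assume "(x, y) \<in> orbit_equiv G Y act" "(y, z) \<in> orbit_equiv G Y act"
      then obtain g h where g: "x \<in> space Y" "z \<in> space Y" "g \<in> carrier G" "act g x = y" "h \<in> carrier G" "act h y = z"
        by (auto simp: orbit_equiv_def)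
      have "act (h \<otimes>\<^bsub>G\<^esub> g) x = z" using composition_rule[OF g(1,5,3)] g by simp
      moreover have "h \<otimes>\<^bsub>G\<^esub> g \<in> carrier G"
        using monoid.m_closed[OF group.is_monoid[OF G] g(5,3)] .
      ultimately show "(x, z) \<in> orbit_equiv G Y act" using g by (auto simp: orbit_equiv_def)
    qed
  qed
  moreover have "orbit_equiv G Y act \<in> sets (Y \<Otimes>\<^sub>M Y)"
  proof -
    have "{p \<in> space (Y \<Otimes>\<^sub>M Y). act g (fst p) = snd p} \<in> sets (Y \<Otimes>\<^sub>M Y)" if "g \<in> carrier G" for g
      using borel_action_measurable[OF act that]
      by (intro pred_eq_standard_borel[OF Y] measurable_compose[OF measurable_fst]) auto
    then have "(\<Union>g\<in>carrier G. {p \<in> space (Y \<Otimes>\<^sub>M Y). act g (fst p) = snd p}) \<in> sets (Y \<Otimes>\<^sub>M Y)"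
      using cG by (intro sets.countable_UN'') auto
    then show ?thesis
      by (rule back_subst[of "\<lambda>S. S \<in> sets (Y \<Otimes>\<^sub>M Y)"]) (auto simp: orbit_equiv_def space_pair_measure)
  qed
  moreover have "countable (orbit_equiv G Y act `` {y})" for y
  proof (rule countable_subset)
    show "orbit_equiv G Y act `` {y} \<subseteq> (\<lambda>g. act g y) ` carrier G" by (auto simp: orbit_equiv_def)
    show "countable ((\<lambda>g. act g y) ` carrier G)" using cG by (rule countable_image)
  qed
  ultimately show ?thesis by (simp add: countable_borel_equiv_def borel_equiv_def)
qed

text \<open>The pullback, under the map from \<open>x\<close> to
  \<open>(\<phi> x, \<psi> x)\<close>, of the orbit relation of the diagonal action on pairs,
  intersected with \<open>E\<close> on \<open>C\<close>.\<close>

definition joint_orbit_rel ::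
    "('d, 'm) monoid_scheme \<Rightarrow> ('d \<Rightarrow> 'y \<Rightarrow> 'y) \<Rightarrow> 'x rel \<Rightarrow> 'x set \<Rightarrow> ('x \<Rightarrow> 'y) \<Rightarrow> ('x \<Rightarrow> 'y) \<Rightarrow> 'x rel" where
  "joint_orbit_rel G act E C \<phi> \<psi> = {(x, y) \<in> E. x \<in> C \<and> y \<in> C \<and>
     (\<exists>g\<in>carrier G. \<phi> x = act g (\<phi> y) \<and> \<psi> x = act g (\<psi> y))}"

lemma joint_orbit_rel_countable_borel_equiv:
  fixes M :: "'x measure" and Y :: "'y measure"
  assumes cG: "countable (carrier G)" and Y: "standard_borel Y" and act: "borel_action G Y act"
    and C: "C \<in> sets M" and E: "countable_borel_equiv M E"
    and meas: "\<phi> \<in> measurable (restrict_space M C) Y" "\<psi> \<in> measurable (restrict_space M C) Y"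
  shows "countable_borel_equiv (restrict_space M C) (joint_orbit_rel G act E C \<phi> \<psi>)" (is "countable_borel_equiv _ ?R")
proof -
  interpret group_action G "space Y" act using act by (simp add: borel_action_def)
  have G: "group G" using group_hom by (rule group_hom.axioms(1))
  have spC: "space (restrict_space M C) = C" using C by simp
  have CM: "C \<subseteq> space M" using C by (rule sets.sets_into_space)
  have eqE: "equiv (space M) E" and EM: "E \<in> sets (M \<Otimes>\<^sub>M M)" and cE: "\<And>x. x \<in> space M \<Longrightarrow> countable (E `` {x})"
    using E by (simp_all add: countable_borel_equiv_def borel_equiv_def)
  have mem: "\<phi> x \<in> space Y" "\<psi> x \<in> space Y" if "x \<in> C" for x
    using measurable_space[OF meas(1), of x] measurable_space[OF meas(2), of x] that spC by auto
  have one: "act \<one>\<^bsub>G\<^esub> y = y" if "y \<in> space Y" for y using fun_cong[OF id_eq_one, of y] that by simp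
  have "equiv C ?R"
  proof (rule equivI)
    show "?R \<subseteq> C \<times> C" by (auto simp: joint_orbit_rel_def)
    show "refl_on C ?R"
    proof (rule refl_onI)
      fix x assume x: "x \<in> C"
      then have "(x, x) \<in> E" using eqE CM by (auto simp: equiv_def refl_on_def)
      moreover have "\<phi> x = act \<one>\<^bsub>G\<^esub> (\<phi> x)" "\<psi> x = act \<one>\<^bsub>G\<^esub> (\<psi> x)" using one mem[OF x] by auto
      moreover have "\<one>\<^bsub>G\<^esub> \<in> carrier G" using group.is_monoid[OF G] by (rule monoid.one_closed)
      ultimately show "(x, x) \<in> ?R" using x by (auto simp: joint_orbit_rel_def)
    qed
    show "sym ?R"
    proof (rule symI)
      fix x y assume "(x, y) \<in> ?R"
      then obtain g where g: "(x, y) \<in> E" "x \<in> C" "y \<in> C" "g \<in> carrier G" "\<phi> x = act g (\<phi> y)" "\<psi> x = act g (\<psi> y)"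
        by (auto simp: joint_orbit_rel_def)
      have "act (inv\<^bsub>G\<^esub> g) (\<phi> x) = \<phi> y" "act (inv\<^bsub>G\<^esub> g) (\<psi> x) = \<psi> y"
        using g mem by (auto intro!: orbit_sym_aux)
      moreover have "inv\<^bsub>G\<^esub> g \<in> carrier G" using group.inv_closed[OF G g(4)] .
      moreover have "(y, x) \<in> E" using eqE g(1) by (auto simp: equiv_def dest: symD)
      ultimately show "(y, x) \<in> ?R" using g(2,3) by (force simp: joint_orbit_rel_def)
    qed
    show "trans ?R"
    proof (rule transI)
      fix x y z assume "(x, y) \<in> ?R" "(y, z) \<in> ?R"
      then obtain g h where g: "(x, y) \<in> E" "x \<in> C" "g \<in> carrier G" "\<phi> x = act g (\<phi> y)" "\<psi> x = act g (\<psi> y)"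
          and h: "(y, z) \<in> E" "z \<in> C" "h \<in> carrier G" "\<phi> y = act h (\<phi> z)" "\<psi> y = act h (\<psi> z)"
        by (auto simp: joint_orbit_rel_def)
      have "\<phi> x = act (g \<otimes>\<^bsub>G\<^esub> h) (\<phi> z)" "\<psi> x = act (g \<otimes>\<^bsub>G\<^esub> h) (\<psi> z)"
        using composition_rule[OF _ g(3) h(3)] mem[OF h(2)] g(4,5) h(4,5) by auto
      moreover have "g \<otimes>\<^bsub>G\<^esub> h \<in> carrier G" using monoid.m_closed[OF group.is_monoid[OF G] g(3) h(3)] .
      moreover have "(x, z) \<in> E" using eqE g(1) h(1) by (auto simp: equiv_def dest: transD)
      ultimately show "(x, z) \<in> ?R" using g(2) h(2) by (auto simp: joint_orbit_rel_def)
    qed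
  qed
  moreover have "?R \<in> sets (restrict_space M C \<Otimes>\<^sub>M restrict_space M C)"
  proof -
    let ?N = "restrict_space M C \<Otimes>\<^sub>M restrict_space M C"
    have "{p \<in> space ?N. \<theta> (fst p) = act g (\<theta> (snd p))} \<in> sets ?N"
      if "g \<in> carrier G" "\<theta> \<in> measurable (restrict_space M C) Y" for g \<theta>
      using measurable_compose[OF measurable_fst that(2)]
        measurable_compose[OF measurable_compose[OF measurable_snd that(2)] borel_action_measurable[OF act that(1)]]
      by (rule pred_eq_standard_borel[OF Y])
    then have "(\<Union>g\<in>carrier G. {p \<in> space ?N. \<phi> (fst p) = act g (\<phi> (snd p))} \<inter> {p \<in> space ?N. \<psi> (fst p) = act g (\<psi> (snd p))}) \<in> sets ?N"
      using cG meas by (intro sets.countable_UN'' sets.Int) auto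
    moreover have "E \<inter> (C \<times> C) \<in> sets ?N"
      unfolding sets_pair_restrict_space[OF C] using EM C by auto
    ultimately have "(\<Union>g\<in>carrier G. {p \<in> space ?N. \<phi> (fst p) = act g (\<phi> (snd p))} \<inter> {p \<in> space ?N. \<psi> (fst p) = act g (\<psi> (snd p))}) \<inter>
        (E \<inter> (C \<times> C)) \<in> sets ?N" by (rule sets.Int)
    then show ?thesis
      by (rule back_subst[of "\<lambda>S. S \<in> sets ?N"]) (auto simp: joint_orbit_rel_def space_pair_measure spC)
  qed
  moreover have "countable (?R `` {x})" if "x \<in> C" for x
  proof (rule countable_subset)
    show "?R `` {x} \<subseteq> E `` {x}" by (auto simp: joint_orbit_rel_def)
    show "countable (E `` {x})" using that CM by (intro cE) auto
  qed
  ultimately show ?thesis by (simp add: countable_borel_equiv_def borel_equiv_def spC)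
qed

lemma separated_Hom_space_countable:
  fixes \<mu> :: "'x measure" and Y :: "'y measure" and G :: "('d, 'm) monoid_scheme"
  assumes cG: "countable (carrier G)" and Y: "standard_borel Y" and rigid: "projectively_rigid TYPE(real) G Y act"
    and \<mu>: "standard_borel \<mu>" "prob_space \<mu>" and E: "countable_borel_equiv \<mu> E" and nh: "nowhere_hyperfinite \<mu> E"
    and e: "e > 0" and T: "T \<subseteq> Hom_space E \<mu> (orbit_equiv G Y act) Y"
    and sep: "\<And>p q. p \<in> T \<Longrightarrow> q \<in> T \<Longrightarrow> p \<noteq> q \<Longrightarrow> e \<le> L_dist \<mu> p q"
  shows "countable T"
proof (rule ccontr)
  assume unc: "uncountable T"
  interpret prob_space \<mu> by fact
  have fin: "finite_measure \<mu>" by unfold_locales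
  have act: "borel_action G Y act" using rigid by (simp add: projectively_rigid_def)
  interpret A: group_action G "space Y" act using act by (simp add: borel_action_def)
  have G: "group G" using A.group_hom by (rule group_hom.axioms(1))
  have neG: "carrier G \<noteq> {}" using group.is_monoid[OF G] monoid.one_closed by auto
  have Ebe: "borel_equiv \<mu> E" and EM: "E \<in> sets (\<mu> \<Otimes>\<^sub>M \<mu>)" and Eeq: "equiv (space \<mu>) E"
    and Ec: "\<And>x. x \<in> space \<mu> \<Longrightarrow> countable (E `` {x})"
    using E by (simp_all add: countable_borel_equiv_def borel_equiv_def)
  have Hom: "fst p \<in> sets \<mu>" "snd p \<in> measurable (restrict_space \<mu> (fst p)) Y" "countable_to_one (fst p) (snd p)"
      "\<And>x y. (x, y) \<in> E \<Longrightarrow> x \<in> fst p \<Longrightarrow> y \<in> fst p \<Longrightarrow> (snd p x, snd p y) \<in> orbit_equiv G Y act"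
    if "p \<in> T" for p
    using subsetD[OF T that] by (cases p; auto simp: Hom_space_def L_space_def rel_homomorphism_def rel_restrict_def)+
  define \<gamma> where "\<gamma> = from_nat_into (carrier G)"
  have \<gamma>: "\<gamma> i \<in> carrier G" for i unfolding \<gamma>_def using neG by (rule from_nat_into)
  have \<gamma>_onto: "\<exists>i. \<gamma> i = k" if "k \<in> carrier G" for k
    using from_nat_into_surj[OF cG that] by (simp add: \<gamma>_def)

  have "\<exists>f :: nat \<Rightarrow> 'x \<Rightarrow> 'x. \<exists>N\<in>null_sets \<mu>. (\<forall>n. f n \<in> measurable \<mu> \<mu>) \<and>
     (\<forall>x y. (x, y) \<in> E \<longrightarrow> x \<notin> N \<longrightarrow> (\<exists>n. y = f n x))"
    using \<mu>(1) fin EM Ec by (rule ae_covered_by_functions_countable_sections)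
  then obtain f0 :: "nat \<Rightarrow> 'x \<Rightarrow> 'x" and N where N: "N \<in> null_sets \<mu>" and f0: "\<And>n. f0 n \<in> measurable \<mu> \<mu>"
     and f0_cov: "\<And>x y. (x, y) \<in> E \<Longrightarrow> x \<notin> N \<Longrightarrow> \<exists>n. y = f0 n x" by auto
  \<comment> \<open>The identity is put at index 0 so that \<open>a p 0\<close> records the domain
    of \<open>p\<close>.\<close>
  define f where "f n = (case n of 0 \<Rightarrow> (\<lambda>x. x) | Suc i \<Rightarrow> f0 i)" for n
  have f: "f n \<in> measurable \<mu> \<mu>" for n using f0 by (simp add: f_def split: nat.split)
  have f_cov: "\<exists>n. y = f n x" if xy: "(x, y) \<in> E" "x \<notin> N" for x y
  proof -
    obtain i where "y = f0 i x" using f0_cov[OF xy] ..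
    then have "y = f (Suc i) x" by (simp add: f_def)
    then show ?thesis ..
  qed

  define dom where "dom p n = {x \<in> space \<mu>. x \<in> fst p \<and> f n x \<in> fst p \<and> (x, f n x) \<in> E}"
    for p :: "'x set \<times> ('x \<Rightarrow> 'y)" and n
  \<comment> \<open>The value 0 marks points outside \<open>dom p n\<close>, so that close
    descriptions also have close domains; the successor keeps index 0 of the enumeration apart from
    it.\<close>
  define a where "a p n x = (if x \<in> dom p n then Suc (LEAST i. snd p x = act (\<gamma> i) (snd p (f n x))) else 0)"
    for p :: "'x set \<times> ('x \<Rightarrow> 'y)" and n x
  have dom_sets: "dom p n \<in> sets \<mu>" if p: "p \<in> T" for p n
  proof -
    have "(\<lambda>x. (x, f n x)) \<in> measurable \<mu> (\<mu> \<Otimes>\<^sub>M \<mu>)" using f by simp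
    from measurable_sets[OF this sets.Int[OF EM pair_measureI[OF Hom(1)[OF p] Hom(1)[OF p]]]] show ?thesis
      by (rule back_subst[of "\<lambda>S. S \<in> sets \<mu>"]) (auto simp: dom_def)
  qed
  have a_meas: "a p n \<in> measurable \<mu> (count_space UNIV)" if p: "p \<in> T" for p n
  proof -
    let ?r = "restrict_space \<mu> (dom p n)" and ?B = "restrict_space \<mu> (fst p)"
    have sp: "space ?r = dom p n" using dom_sets[OF p] by (rule space_restrict_space2)
    have maps: "(\<lambda>x. x) \<in> space ?r \<rightarrow> fst p" "f n \<in> space ?r \<rightarrow> fst p" unfolding sp by (auto simp: dom_def)
    have "(\<lambda>x. x) \<in> measurable ?r ?B" "f n \<in> measurable ?r ?B"
      using measurable_restrict_space2[OF maps(1) measurable_restrict_space1] measurable_restrict_space2[OF maps(2) measurable_restrict_space1[OF f]]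
      by simp_all
    from measurable_compose[OF this(1) Hom(2)[OF p]] measurable_compose[OF this(2) Hom(2)[OF p]]
    have m: "snd p \<in> measurable ?r Y" "(\<lambda>x. snd p (f n x)) \<in> measurable ?r Y" by simp_all
    have "{x \<in> space ?r. snd p x = act (\<gamma> i) (snd p (f n x))} \<in> sets ?r" for i
      using m(1) measurable_compose[OF m(2) borel_action_measurable[OF act \<gamma>]] by (rule pred_eq_standard_borel[OF Y])
    then have "(\<lambda>x. LEAST i. snd p x = act (\<gamma> i) (snd p (f n x))) \<in> measurable ?r (count_space UNIV)"
      by (intro measurable_Least) (simp add: pred_def)
    then have "(\<lambda>x. Suc (LEAST i. snd p x = act (\<gamma> i) (snd p (f n x)))) \<in> measurable ?r (count_space UNIV)"
      by (rule measurable_compose) simp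
    then show ?thesis
      unfolding a_def using dom_sets[OF p, of n] by (subst (asm) measurable_restrict_space_iff[where c = 0]) auto
  qed
  have a_Suc: "x \<in> dom p n \<and> snd p x = act (\<gamma> i) (snd p (f n x))" if p: "p \<in> T" and ai: "a p n x = Suc i" for p n x i
  proof -
    have d: "x \<in> dom p n" using ai by (auto simp: a_def split: if_splits)
    then have "(f n x, x) \<in> E" "x \<in> fst p" "f n x \<in> fst p"
      using Eeq by (auto simp: dom_def equiv_def dest: symD)
    then have "(snd p (f n x), snd p x) \<in> orbit_equiv G Y act" using Hom(4)[OF p] by auto
    then obtain g where "g \<in> carrier G" "act g (snd p (f n x)) = snd p x" by (auto simp: orbit_equiv_def)
    then have "\<exists>i. snd p x = act (\<gamma> i) (snd p (f n x))" using \<gamma>_onto by metis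
    then have "snd p x = act (\<gamma> (LEAST i. snd p x = act (\<gamma> i) (snd p (f n x)))) (snd p (f n x))" by (rule LeastI_ex)
    moreover have "(LEAST i. snd p x = act (\<gamma> i) (snd p (f n x))) = i" using ai d by (simp add: a_def)
    ultimately show ?thesis using d by simp
  qed
  have a_0: "a p 0 x \<noteq> 0 \<longleftrightarrow> x \<in> fst p" if p: "p \<in> T" for p x
    using Eeq sets.sets_into_space[OF Hom(1)[OF p]] by (auto simp: a_def dom_def f_def equiv_def refl_on_def)

  \<comment> \<open>The tolerances \<open>(1/2)^k\<close> are summable, as Borel-Cantelli requires,
    and the number of descriptions compared grows with \<open>k\<close>, so every \<open>n\<close>
    is eventually controlled.\<close>
  have "\<exists>t\<in>T. \<forall>k::nat. \<exists>s\<in>T. s \<noteq> t \<and> (\<forall>n\<le>k. measure \<mu> {x \<in> space \<mu>. a t n x \<noteq> a s n x} < (1/2)^k)"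
    by (rule uncountable_family_close[OF \<mu>(1) fin unc a_meas]) auto
  then obtain t where t: "t \<in> T"
    and "\<forall>k::nat. \<exists>s. s \<in> T \<and> s \<noteq> t \<and> (\<forall>n\<le>k. measure \<mu> {x \<in> space \<mu>. a t n x \<noteq> a s n x} < (1/2)^k)"
    unfolding Bex_def by (elim exE conjE)
  from choice[OF this(2)] obtain s where
    "\<forall>k. s k \<in> T \<and> s k \<noteq> t \<and> (\<forall>n\<le>k. measure \<mu> {x \<in> space \<mu>. a t n x \<noteq> a (s k) n x} < (1/2)^k)" ..
  then have s: "\<And>k. s k \<in> T" "\<And>k. s k \<noteq> t"
    "\<And>k n. n \<le> k \<Longrightarrow> measure \<mu> {x \<in> space \<mu>. a t n x \<noteq> a (s k) n x} < (1/2)^k" by simp_all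
  define W where "W n k = {x \<in> space \<mu>. a t n x \<noteq> a (s k) n x}" for n k
  have W_sets: "W n k \<in> sets \<mu>" for n k
  proof -
    have "{x \<in> space \<mu>. a t n x = a (s k) n x} \<in> sets \<mu>"
    proof -
      have "(\<Union>i. (a t n -` {i} \<inter> space \<mu>) \<inter> (a (s k) n -` {i} \<inter> space \<mu>)) \<in> sets \<mu>"
        by (intro sets.countable_UN'' sets.Int measurable_sets[OF a_meas[OF t]] measurable_sets[OF a_meas[OF s(1)]]) auto
      then show ?thesis by (rule back_subst[of "\<lambda>S. S \<in> sets \<mu>"]) auto
    qed
    then have "space \<mu> - {x \<in> space \<mu>. a t n x = a (s k) n x} \<in> sets \<mu>" by auto
    then show ?thesis by (rule back_subst[of "\<lambda>S. S \<in> sets \<mu>"]) (auto simp: W_def)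
  qed
  have W_small: "measure \<mu> (W n k) < (1/2)^k" if "n \<le> k" for n k using s(3)[OF that] by (simp add: W_def)

  let ?B = "fst t" and ?\<phi> = "snd t" and ?Bk = "\<lambda>k. fst (s k)" and ?\<psi> = "\<lambda>k. snd (s k)"
  have BB: "?B \<inter> ?Bk k \<in> sets \<mu>" for k using Hom(1)[OF t] Hom(1)[OF s(1)] by (rule sets.Int)
  \<comment> \<open>The common domain is trimmed to a set with a real copy, where rigidity is
    available, at a cost below \<open>(1/2)^k\<close>.\<close>
  have "\<forall>k. \<exists>C. C \<in> sets \<mu> \<and> C \<subseteq> ?B \<inter> ?Bk k \<and> measure \<mu> (?B \<inter> ?Bk k - C) < (1/2)^k \<and> (\<exists>X g h. real_copy \<mu> C X g h)"
  proof
    fix k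
    have "\<exists>C\<in>sets \<mu>. C \<subseteq> ?B \<inter> ?Bk k \<and> measure \<mu> (?B \<inter> ?Bk k - C) < (1/2)^k \<and> (\<exists>X g h. real_copy \<mu> C X g h)"
      by (rule exists_real_copy[OF \<mu>(1) fin BB]) simp
    then show "\<exists>C. C \<in> sets \<mu> \<and> C \<subseteq> ?B \<inter> ?Bk k \<and> measure \<mu> (?B \<inter> ?Bk k - C) < (1/2)^k \<and> (\<exists>X g h. real_copy \<mu> C X g h)"
      by (simp only: Bex_def)
  qed
  from choice[OF this] obtain C where
    "\<forall>k. C k \<in> sets \<mu> \<and> C k \<subseteq> ?B \<inter> ?Bk k \<and> measure \<mu> (?B \<inter> ?Bk k - C k) < (1/2)^k \<and> (\<exists>X g h. real_copy \<mu> (C k) X g h)" ..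
  then have C: "\<And>k. C k \<in> sets \<mu>" "\<And>k. C k \<subseteq> ?B \<inter> ?Bk k" "\<And>k. measure \<mu> (?B \<inter> ?Bk k - C k) < (1/2)^k"
    "\<And>k. \<exists>X g h. real_copy \<mu> (C k) X g h" by simp_all
  have restr: "snd p \<in> measurable (restrict_space \<mu> (C k)) Y" "countable_to_one (C k) (snd p)"
    if p: "p \<in> T" and sub: "C k \<subseteq> fst p" for p k
  proof -
    have sp: "space (restrict_space \<mu> (C k)) = C k" using C(1) by (rule space_restrict_space2)
    have "(\<lambda>x. x) \<in> measurable (restrict_space \<mu> (C k)) (restrict_space \<mu> (fst p))"
      using sub by (intro measurable_restrict_space2 measurable_restrict_space1) (auto simp: sp)
    from measurable_compose[OF this Hom(2)[OF p]] show "snd p \<in> measurable (restrict_space \<mu> (C k)) Y" by simp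
    have "countable {x \<in> C k. snd p x = y}" for y
    proof (rule countable_subset)
      show "{x \<in> C k. snd p x = y} \<subseteq> {x \<in> fst p. snd p x = y}" using sub by auto
      show "countable {x \<in> fst p. snd p x = y}" using Hom(3)[OF p] by (simp add: countable_to_one_def)
    qed
    then show "countable_to_one (C k) (snd p)" by (simp add: countable_to_one_def)
  qed
  have C_t: "C k \<subseteq> fst t" and C_s: "C k \<subseteq> fst (s k)" for k using C(2)[of k] by auto
  define R where "R k = joint_orbit_rel G act E (C k) ?\<phi> (?\<psi> k)" for k
  define D where "D k = {x \<in> C k. ?\<phi> x \<noteq> ?\<psi> k x}" for k
  have R_cbe: "countable_borel_equiv (restrict_space \<mu> (C k)) (R k)" for k
    unfolding R_def
    by (rule joint_orbit_rel_countable_borel_equiv[OF cG Y act C(1) E restr(1)[OF t C_t] restr(1)[OF s(1) C_s]])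
  have D_hyp: "hyperfinite (restrict_space \<mu> (D k)) (R k \<inter> (D k \<times> D k))" for k
  proof -
    obtain X g h where X: "real_copy \<mu> (C k) X g h" using C(4)[of k] by auto
    show ?thesis unfolding D_def
      by (rule projectively_rigid_hyperfinite[OF rigid cG neG Y C(1) X restr(1)[OF t C_t] restr(1)[OF s(1) C_s]
        restr(2)[OF t C_t] restr(2)[OF s(1) C_s] R_cbe]) (auto simp: R_def joint_orbit_rel_def)
  qed
  have D_sets: "D k \<in> sets \<mu>" for k
  proof -
    have sp: "space (restrict_space \<mu> (C k)) = C k" using C(1) by (rule space_restrict_space2)
    have "{x \<in> space (restrict_space \<mu> (C k)). ?\<phi> x = ?\<psi> k x} \<in> sets (restrict_space \<mu> (C k))"
      using restr(1)[OF t C_t] restr(1)[OF s(1) C_s] by (rule pred_eq_standard_borel[OF Y])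
    then have "C k - {x \<in> C k. ?\<phi> x = ?\<psi> k x} \<in> sets \<mu>" using C(1)[of k] by (auto simp: sp sets_restrict_space_iff)
    then show ?thesis by (rule back_subst[of "\<lambda>S. S \<in> sets \<mu>"]) (auto simp: D_def)
  qed
  \<comment> \<open>One \<open>(1/2)^k\<close> pays for the trimming, the other for the points in
    exactly one of the two domains, which lie in \<open>W 0 k\<close>.\<close>
  have D_large: "e - 2 * (1/2)^k \<le> measure \<mu> (D k)" for k
  proof -
    have "difference_set t (s k) \<subseteq> D k \<union> (?B \<inter> ?Bk k - C k) \<union> W 0 k"
    proof
      fix x assume "x \<in> difference_set t (s k)"
      then consider "x \<in> ?B" "x \<in> ?Bk k" "?\<phi> x \<noteq> ?\<psi> k x" | "x \<in> ?B \<longleftrightarrow> x \<notin> ?Bk k"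
        unfolding difference_set_def by (auto simp: case_prod_beta)
      then show "x \<in> D k \<union> (?B \<inter> ?Bk k - C k) \<union> W 0 k"
      proof cases
        case 1 then show ?thesis by (auto simp: D_def)
      next
        case 2
        moreover have "x \<in> space \<mu>"
          using 2 sets.sets_into_space[OF Hom(1)[OF t]] sets.sets_into_space[OF Hom(1)[OF s(1)[of k]]] by auto
        ultimately have "x \<in> W 0 k" using a_0[OF t, of x] a_0[OF s(1)[of k], of x] by (auto simp: W_def)
        then show ?thesis by simp
      qed
    qed
    moreover have sets: "D k \<union> (?B \<inter> ?Bk k - C k) \<in> sets \<mu>" using D_sets BB C(1) by auto
    ultimately have "measure \<mu> (difference_set t (s k)) \<le> measure \<mu> (D k \<union> (?B \<inter> ?Bk k - C k) \<union> W 0 k)"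
      using W_sets by (intro finite_measure_mono) auto
    also have "\<dots> \<le> measure \<mu> (D k \<union> (?B \<inter> ?Bk k - C k)) + measure \<mu> (W 0 k)"
      using sets W_sets by (rule measure_Un_le)
    also have "measure \<mu> (D k \<union> (?B \<inter> ?Bk k - C k)) \<le> measure \<mu> (D k) + measure \<mu> (?B \<inter> ?Bk k - C k)"
      using D_sets sets.Diff[OF BB C(1)] by (rule measure_Un_le)
    finally have "measure \<mu> (difference_set t (s k)) \<le> measure \<mu> (D k) + measure \<mu> (?B \<inter> ?Bk k - C k) + measure \<mu> (W 0 k)" by simp
    moreover have "e \<le> measure \<mu> (difference_set t (s k))"
      using sep[OF t s(1)[of k]] s(2)[of k] by (auto simp: L_dist_def)
    ultimately show ?thesis using C(3)[of k] W_small[of 0 k] by linarith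
  qed
  define L where "L = (\<Inter>m. \<Union>k\<in>{m..}. D k)"
  have L_sets: "L \<in> sets \<mu>" unfolding L_def using D_sets by auto
  \<comment> \<open>Every tail union contains sets \<open>D k\<close> whose lower bounds tend to
    \<open>e\<close>, and finiteness of the measure passes the bound on to the decreasing
    intersection.\<close>
  have L_large: "e \<le> measure \<mu> L"
  proof -
    have "e \<le> measure \<mu> (\<Union>k\<in>{m..}. D k)" for m
    proof (rule LIMSEQ_le_const2)
      show "(\<lambda>k. e - 2 * (1/2)^k) \<longlonglongrightarrow> e" by (auto intro!: tendsto_eq_intros LIMSEQ_realpow_zero)
      have "e - 2 * (1/2)^k \<le> measure \<mu> (\<Union>k\<in>{m..}. D k)" if "k \<ge> m" for k
      proof -
        have "measure \<mu> (D k) \<le> measure \<mu> (\<Union>k\<in>{m..}. D k)" using D_sets that by (intro finite_measure_mono) auto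
        then show ?thesis using D_large[of k] by linarith
      qed
      then show "\<exists>N. \<forall>k\<ge>N. e - 2 * (1/2)^k \<le> measure \<mu> (\<Union>k\<in>{m..}. D k)" by auto
    qed
    moreover have "(\<lambda>m. measure \<mu> (\<Union>k\<in>{m..}. D k)) \<longlonglongrightarrow> measure \<mu> L"
      unfolding L_def
    proof (rule finite_Lim_measure_decseq)
      show "decseq (\<lambda>m. \<Union>k\<in>{m..}. D k)" unfolding decseq_def by (intro allI impI UN_mono) auto
    qed (use D_sets in auto)
    ultimately show ?thesis by (intro LIMSEQ_le_const) auto
  qed

  have "AE x in \<mu>. \<forall>\<^sub>F k in sequentially. x \<notin> W n k" for n
    using W_sets less_imp_le[OF W_small] by (rule AE_eventually_notin_geometric)
  then have "AE x in \<mu>. \<forall>n. \<forall>\<^sub>F k in sequentially. x \<notin> W n k" by (simp add: AE_all_countable)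
  moreover have "AE x in \<mu>. \<forall>\<^sub>F k in sequentially. x \<notin> ?B \<inter> ?Bk k - C k"
    using sets.Diff[OF BB C(1)] less_imp_le[OF C(3)] by (rule AE_eventually_notin_geometric)
  moreover have "AE x in \<mu>. x \<notin> N" using N by (rule AE_not_in)
  ultimately have "AE x in \<mu>. x \<notin> N \<and> (\<forall>n. \<forall>\<^sub>F k in sequentially. x \<notin> W n k) \<and>
      (\<forall>\<^sub>F k in sequentially. x \<notin> ?B \<inter> ?Bk k - C k)" by auto
  then obtain N' where good: "\<And>x. x \<in> space \<mu> - N' \<Longrightarrow> x \<notin> N \<and>
      (\<forall>n. \<forall>\<^sub>F k in sequentially. x \<notin> W n k) \<and> (\<forall>\<^sub>F k in sequentially. x \<notin> ?B \<inter> ?Bk k - C k)"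
    and N': "N' \<in> null_sets \<mu>"
    by (rule AE_E3) (rule that)
  define A where "A = L - N'"
  have A: "A \<in> sets \<mu>" unfolding A_def using L_sets N' by auto
  have A_sub: "A \<subseteq> (\<Inter>m. \<Union>k\<in>{m..}. D k)" by (auto simp: A_def L_def)
  have A_good: "x \<in> ?B" "x \<notin> N" "\<And>n. \<forall>\<^sub>F k in sequentially. x \<notin> W n k"
      "\<forall>\<^sub>F k in sequentially. x \<notin> ?B \<inter> ?Bk k - C k" if x: "x \<in> A" for x
  proof -
    have "x \<in> (\<Union>k\<in>{0..}. D k)" using x A_sub by blast
    then show "x \<in> ?B" using C_t by (auto simp: D_def)
    have "x \<in> space \<mu> - N'" using x sets.sets_into_space[OF A] by (auto simp: A_def)
    from good[OF this] show "x \<notin> N" "\<And>n. \<forall>\<^sub>F k in sequentially. x \<notin> W n k"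
      "\<forall>\<^sub>F k in sequentially. x \<notin> ?B \<inter> ?Bk k - C k" by simp_all
  qed
  \<comment> \<open>Write \<open>y = f n x\<close>. For large \<open>k\<close> the
    \<open>n\<close>-th descriptions of \<open>t\<close> and \<open>s k\<close> agree at
    \<open>x\<close>, so the same \<open>\<gamma> i\<close> carries the values of both functions at
    \<open>y\<close> to those at \<open>x\<close>, and neither point falls into the trimmed
    part.\<close>
  have ev: "\<exists>m. \<forall>k\<ge>m. (x \<in> D k \<or> y \<in> D k) \<longrightarrow> (x, y) \<in> R k \<inter> (D k \<times> D k)"
    if x: "x \<in> A" and y: "y \<in> A" and xy: "(x, y) \<in> E" for x y
  proof -
    obtain n where n: "y = f n x" using f_cov[OF xy A_good(2)[OF x]] ..
    have xs: "x \<in> space \<mu>" using x sets.sets_into_space[OF A] by auto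
    have "x \<in> dom t n" using xs A_good(1)[OF x] A_good(1)[OF y] xy by (simp add: dom_def n)
    then obtain i where i: "a t n x = Suc i" by (simp add: a_def)
    have "\<forall>\<^sub>F k in sequentially. (x \<in> D k \<or> y \<in> D k) \<longrightarrow> (x, y) \<in> R k \<inter> (D k \<times> D k)"
      using A_good(3)[OF x, of n] A_good(4)[OF x] A_good(4)[OF y]
    proof eventually_elim
      case (elim k)
      have "a (s k) n x = Suc i" using elim(1) xs i by (auto simp: W_def)
      from a_Suc[OF s(1) this] have k: "x \<in> ?Bk k" "y \<in> ?Bk k" "?\<psi> k x = act (\<gamma> i) (?\<psi> k y)"
        by (auto simp: dom_def n)
      have "?\<phi> x = act (\<gamma> i) (?\<phi> y)" using a_Suc[OF t i] by (simp add: n)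
      moreover have xyC: "x \<in> C k" "y \<in> C k" using elim(2,3) k A_good(1)[OF x] A_good(1)[OF y] by auto
      ultimately have Rk: "(x, y) \<in> R k" using xy k(3) \<gamma> by (auto simp: R_def joint_orbit_rel_def)
      have Rk': "(y, x) \<in> R k"
        using R_cbe[of k] Rk by (auto simp: countable_borel_equiv_def borel_equiv_def equiv_def dest: symD)
      \<comment> \<open>One group element maps the values of both functions at \<open>v\<close> to
        those at \<open>u\<close>, so agreement at \<open>v\<close> forces agreement at
        \<open>u\<close>. Used in both directions, this puts both points of the pair in
        \<open>D k\<close> or neither.\<close>
      have R_eq: "?\<phi> u = ?\<psi> k u" if "(u, v) \<in> R k" "?\<phi> v = ?\<psi> k v" for u v
      proof -
        from that(1) obtain g where "?\<phi> u = act g (?\<phi> v)" "?\<psi> k u = act g (?\<psi> k v)"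
          by (auto simp: R_def joint_orbit_rel_def)
        then show ?thesis using that(2) by simp
      qed
      have "?\<phi> x = ?\<psi> k x \<longleftrightarrow> ?\<phi> y = ?\<psi> k y"
        using R_eq[OF Rk] R_eq[OF Rk'] by (rule iffI[rotated])
      then show ?case using Rk xyC by (auto simp: D_def)
    qed
    then show ?thesis by (simp add: eventually_sequentially)
  qed
  have cov: "\<exists>i. y = f i x" if "x \<in> A" "(x, y) \<in> E" for x y
    using f_cov[OF that(2) A_good(2)[OF that(1)]] .
  have "\<exists>D'\<in>sets \<mu>. D' \<subseteq> A \<and> A - D' \<in> null_sets \<mu> \<and> hyperfinite (restrict_space \<mu> D') (E \<inter> (D' \<times> D'))"
    by (rule hyperfinite_limsup[OF Ebe f D_sets D_hyp A A_sub]) (rule cov ev; assumption)+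
  then obtain D' where D': "D' \<in> sets \<mu>" "D' \<subseteq> A" "A - D' \<in> null_sets \<mu>"
      "hyperfinite (restrict_space \<mu> D') (E \<inter> (D' \<times> D'))"
    by (elim bexE conjE)
  \<comment> \<open>\<open>D'\<close> is all of \<open>L\<close> up to null sets, and
    \<open>L\<close> has measure at least \<open>e\<close>.\<close>
  have "emeasure \<mu> D' \<noteq> 0"
  proof
    assume "emeasure \<mu> D' = 0"
    then have "D' \<in> null_sets \<mu>" using D'(1) by auto
    from null_sets.Un[OF null_sets.Un[OF this D'(3)] N'] have "D' \<union> (A - D') \<union> N' \<in> null_sets \<mu>" .
    then have "L \<in> null_sets \<mu>"
      by (rule null_sets_subset) (use L_sets in \<open>auto simp: A_def\<close>)
    then have "measure \<mu> L = 0" by (auto simp: measure_def)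
    then show False using L_large e by simp
  qed
  then have "emeasure \<mu> D' > 0" by (simp add: zero_less_iff_neq_zero)
  then show False using nh D'(1,4) unfolding nowhere_hyperfinite_def rel_restrict_def by auto
qed

theorem theorem3p5:
  fixes \<Delta> :: "('d, 'm) monoid_scheme" and Y :: "'y measure" and act :: "'d \<Rightarrow> 'y \<Rightarrow> 'y"
  assumes "group \<Delta>" and "countable (carrier \<Delta>)"
    and "standard_borel Y"
    and "borel_action \<Delta> Y act"
    and "projectively_rigid TYPE(real) \<Delta> Y act"
  shows "projectively_separable TYPE('x) Y (orbit_equiv \<Delta> Y act)"
  unfolding projectively_separable_def
proof (intro conjI allI impI)
  show "countable_borel_equiv Y (orbit_equiv \<Delta> Y act)"
    using assms(2-4) by (rule orbit_equiv_countable_borel_equiv)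
  fix \<mu> :: "'x measure" and E
  assume \<mu>: "standard_borel \<mu>" "prob_space \<mu>" "countable_borel_equiv \<mu> E" "nowhere_hyperfinite \<mu> E"
  show "separable_space (pseudometric_topology (Hom_space E \<mu> (orbit_equiv \<Delta> Y act) Y) (L_dist \<mu>))"
  proof (rule separable_pseudometric_topology)
    show "L_dist \<mu> p p = 0" for p :: "'x set \<times> ('x \<Rightarrow> 'y)"
      by (simp add: L_dist_def difference_set_def case_prod_beta)
    show "L_dist \<mu> p q = L_dist \<mu> q p" for p q :: "'x set \<times> ('x \<Rightarrow> 'y)"
      unfolding L_dist_def difference_set_def case_prod_beta by (rule arg_cong[where f = "measure \<mu>"]) auto
  qed (rule separated_Hom_space_countable[OF assms(2,3,5) \<mu>])
qed

end
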